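(* Let $N\ge 1$ and let $\Omega\subset\mathbb{R}^N$ be a bounded open set with Lipschitz boundary. Consider the problem $$(P_{\lambda,k})\qquad (I-\Delta)^{\ln}u=\lambda u+k\,u\ln|u|\ \text{ in }\Omega,\qquad u=0\ \text{ in }\mathbb{R}^N\setminus\Omega .$$ (i) For every $k\in(0,\tfrac4N)$ and $\lambda\in\mathbb{R}$, problem $(P_{\lambda,k})$ has a Nehari least-energy solution $u\in\mathcal{H}_0^{\ln}(\Omega)\setminus\{0\}$, and $$J_{\ln}(u)=\inf_{v\in\mathcal{N}}J_{\ln}(v)=\inf_{\sigma\in\mathcal{T}}\max_{t\in[0,1]}J_{\ln}(\sigma(t))>0,$$ where $\mathcal{T}:=\{\sigma\in C^0([0,1],\mathcal{H}_0^{\ln}(\Omega)):\ \sigma(0)=0,\ \sigma(1)\ne0,\ J_{\ln}(\sigma(1))\le0\}$. Furthermore, all (Nehari) least-energy solutions of $(P_{\lambda,k})$ do not change sign in $\Omega$. (ii) For every $k<0$ and $\lambda\in\mathbb{R}$, problem $(P_{\lambda,k})$ has a global least-energy solution $u\in\mathcal{H}_0^{\ln}(\Omega)\setminus\{0\}$. Moreover, the global least-energy solutions of $(P_{\lambda,k})$ do not change sign in $\Omega$, and the global least-energy solution is unique up to a sign.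
   Context: All functions are real-valued. Let $K_\nu$ be the modified Bessel function of the second kind, $d_N:=\pi^{-N/2}$, $\omega(r):=2^{1-N/2}r^{N/2}K_{N/2}(r)$ and $J(y):=d_N\,\omega(|y|)/|y|^N$. The logarithmic Schrödinger operator is $(I-\Delta)^{\ln}u(x)=\int_{\mathbb{R}^N}(u(x)-u(x+y))J(y)\,dy$; it has Fourier symbol $\ln(1+|\xi|^2)$. Set $$\mathcal{E}_\omega(u,v)=\tfrac12\int_{\mathbb{R}^N}\int_{\mathbb{R}^N}(u(x)-u(y))(v(x)-v(y))J(x-y)\,dx\,dy,$$ $H^{\ln}(\mathbb{R}^N)=\{u\in L^2(\mathbb{R}^N):\mathcal{E}_\omega(u,u)<\infty\}$ and $\mathcal{H}_0^{\ln}(\Omega)=\{u\in H^{\ln}(\mathbb{R}^N):u\equiv0\text{ in }\mathbb{R}^N\setminus\Omega\}$, a Hilbert space with scalar product $\mathcal{E}_\omega$ and norm $\|u\|=\sqrt{\mathcal{E}_\omega(u,u)}$ (it is also the completion of $C_c^\infty(\Omega)$ in $H^{\ln}(\mathbb{R}^N)$). Convention: $t\ln|t|=0$ and $t^2\ln t^2=0$ at $t=0$. A function $u\in\mathcal{H}_0^{\ln}(\Omega)$ is a (weak) solution of $(P_{\lambda,k})$ if $\mathcal{E}_\omega(u,\varphi)=\lambda\int_\Omega u\varphi\,dx+k\int_\Omega\varphi u\ln|u|\,dx$ for all $\varphi\in\mathcal{H}_0^{\ln}(\Omega)$. The energy functional on $\mathcal{H}_0^{\ln}(\Omega)$ is $$J_{\ln}(u)=\tfrac12\mathcal{E}_\omega(u,u)-\tfrac\lambda2\int_\Omega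 u^2dx+\tfrac k4\int_\Omega u^2dx-\tfrac k4\int_\Omega u^2\ln u^2dx,$$ and $\mathcal{N}=\{u\in\mathcal{H}_0^{\ln}(\Omega)\setminus\{0\}:\mathcal{E}_\omega(u,u)=\lambda\int_\Omega u^2dx+k\int_\Omega u^2\ln|u|dx\}$. A solution $u\in\mathcal{N}$ is a Nehari least-energy solution if $J_{\ln}(u)=\inf_{\mathcal{N}}J_{\ln}$, and a global least-energy solution if $J_{\ln}(u)=\inf_{\mathcal{H}_0^{\ln}(\Omega)}J_{\ln}$. "Does not change sign" means $u\ge0$ a.e. or $u\le0$ a.e. *)

theory Defs
  imports "HOL-Analysis.Analysis"
begin

(* Functions on R^N are Borel representatives u :: 'a => real with N = DIM('a); all notions
   below are invariant under changing u on a null set, and "u = 0" and "u = v" as elements of the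
   function spaces are rendered as equality almost everywhere. *)

(* The standard integral representation (DLMF 10.32.9), valid for every real order and r > 0. *)
definition bessel_K :: "real \<Rightarrow> real \<Rightarrow> real" where
  "bessel_K \<nu> r = (LINT t:{0..}|lborel. exp (- r * cosh t) * cosh (\<nu> * t))"

definition omega_fun :: "nat \<Rightarrow> real \<Rightarrow> real" where
  "omega_fun N r = 2 powr (1 - real N / 2) * r powr (real N / 2) * bessel_K (real N / 2) r"

definition d_const :: "nat \<Rightarrow> real" where
  "d_const N = pi powr (- (real N / 2))"

definition J_kernel :: "'a::euclidean_space \<Rightarrow> real" where
  "J_kernel y = d_const DIM('a) * omega_fun DIM('a) (norm y) / norm y ^ DIM('a)"

definition E_integrand ::
    "('a::euclidean_space \<Rightarrow> real) \<Rightarrow> ('a \<Rightarrow> real) \<Rightarrow> 'a \<times> 'a \<Rightarrow> real" where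
  "E_integrand u v = (\<lambda>(x, y). (u x - u y) * (v x - v y) * J_kernel (x - y))"

definition E_omega :: "('a::euclidean_space \<Rightarrow> real) \<Rightarrow> ('a \<Rightarrow> real) \<Rightarrow> real" where
  "E_omega u v = (1/2) * (\<integral>z. E_integrand u v z \<partial>(lborel \<Otimes>\<^sub>M lborel))"

(* The integrand of E_omega u u is nonnegative, so its integrability is finiteness of E_omega u u. *)
definition H_ln :: "('a::euclidean_space \<Rightarrow> real) set" where
  "H_ln = {u. u \<in> borel_measurable lborel \<and> integrable lborel (\<lambda>x. (u x)\<^sup>2) \<and>
              integrable (lborel \<Otimes>\<^sub>M lborel) (E_integrand u u)}"

definition H0_ln :: "'a::euclidean_space set \<Rightarrow> ('a \<Rightarrow> real) set" where
  "H0_ln \<Omega> = {u \<in> H_ln. AE x in lborel. x \<notin> \<Omega> \<longrightarrow> u x = 0}"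

definition H_norm :: "('a::euclidean_space \<Rightarrow> real) \<Rightarrow> real" where
  "H_norm u = sqrt (E_omega u u)"

definition ae_zero :: "('a::euclidean_space \<Rightarrow> real) \<Rightarrow> bool" where
  "ae_zero u \<longleftrightarrow> (AE x in lborel. u x = 0)"

(* In the next three definitions the conventions t * ln |t| = 0 and t^2 * ln (t^2) = 0 at t = 0
   hold because of the vanishing first factor. For u, phi in H0_ln and bounded open \<Omega> all the
   integrands are integrable, by the logarithmic Sobolev inequality. *)
definition weak_solution ::
    "'a::euclidean_space set \<Rightarrow> real \<Rightarrow> real \<Rightarrow> ('a \<Rightarrow> real) \<Rightarrow> bool" where
  "weak_solution \<Omega> l k u \<longleftrightarrow> u \<in> H0_ln \<Omega> \<and>
     (\<forall>\<phi>\<in>H0_ln \<Omega>. E_omega u \<phi> = l * (LINT x:\<Omega>|lborel. u x * \<phi> x)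
                              + k * (LINT x:\<Omega>|lborel. \<phi> x * u x * ln \<bar>u x\<bar>))"

definition J_ln ::
    "'a::euclidean_space set \<Rightarrow> real \<Rightarrow> real \<Rightarrow> ('a \<Rightarrow> real) \<Rightarrow> real" where
  "J_ln \<Omega> l k u = (1/2) * E_omega u u
       - (l/2) * (LINT x:\<Omega>|lborel. (u x)\<^sup>2)
       + (k/4) * (LINT x:\<Omega>|lborel. (u x)\<^sup>2)
       - (k/4) * (LINT x:\<Omega>|lborel. (u x)\<^sup>2 * ln ((u x)\<^sup>2))"

definition nehari :: "'a::euclidean_space set \<Rightarrow> real \<Rightarrow> real \<Rightarrow> ('a \<Rightarrow> real) set" where
  "nehari \<Omega> l k = {u \<in> H0_ln \<Omega>. \<not> ae_zero u \<and>
      E_omega u u = l * (LINT x:\<Omega>|lborel. (u x)\<^sup>2)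
                  + k * (LINT x:\<Omega>|lborel. (u x)\<^sup>2 * ln \<bar>u x\<bar>)}"

(* Infima are taken in the extended reals, so that they are meaningful without any boundedness
   or nonemptiness assumption. *)
definition nehari_least_energy_solution ::
    "'a::euclidean_space set \<Rightarrow> real \<Rightarrow> real \<Rightarrow> ('a \<Rightarrow> real) \<Rightarrow> bool" where
  "nehari_least_energy_solution \<Omega> l k u \<longleftrightarrow> weak_solution \<Omega> l k u \<and> u \<in> nehari \<Omega> l k \<and>
     ereal (J_ln \<Omega> l k u) = (INF v\<in>nehari \<Omega> l k. ereal (J_ln \<Omega> l k v))"

definition global_least_energy_solution ::
    "'a::euclidean_space set \<Rightarrow> real \<Rightarrow> real \<Rightarrow> ('a \<Rightarrow> real) \<Rightarrow> bool" where
  "global_least_energy_solution \<Omega> l k u \<longleftrightarrow> weak_solution \<Omega> l k u \<and> u \<in> nehari \<Omega> l k \<and>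
     ereal (J_ln \<Omega> l k u) = (INF v\<in>H0_ln \<Omega>. ereal (J_ln \<Omega> l k v))"

(* Continuity of a path is with respect to the norm H_norm of H0_ln. *)
definition mountain_paths ::
    "'a::euclidean_space set \<Rightarrow> real \<Rightarrow> real \<Rightarrow> (real \<Rightarrow> 'a \<Rightarrow> real) set" where
  "mountain_paths \<Omega> l k = {\<sigma>. (\<forall>t\<in>{0..1}. \<sigma> t \<in> H0_ln \<Omega>) \<and>
      (\<forall>t\<in>{0..1}. ((\<lambda>s. H_norm (\<lambda>x. \<sigma> s x - \<sigma> t x)) \<longlongrightarrow> 0) (at t within {0..1})) \<and>
      ae_zero (\<sigma> 0) \<and> \<not> ae_zero (\<sigma> 1) \<and> J_ln \<Omega> l k (\<sigma> 1) \<le> 0}"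

definition no_sign_change :: "'a::euclidean_space set \<Rightarrow> ('a \<Rightarrow> real) \<Rightarrow> bool" where
  "no_sign_change \<Omega> u \<longleftrightarrow>
     (AE x in lborel. x \<in> \<Omega> \<longrightarrow> u x \<ge> 0) \<or> (AE x in lborel. x \<in> \<Omega> \<longrightarrow> u x \<le> 0)"

(* Near each boundary point, \<Omega> is the strict epigraph, in the direction of some unit vector e, of a
   Lipschitz function g on the hyperplane orthogonal to e. *)
definition lipschitz_boundary :: "'a::euclidean_space set \<Rightarrow> bool" where
  "lipschitz_boundary \<Omega> \<longleftrightarrow> (\<forall>p\<in>frontier \<Omega>. \<exists>r>0. \<exists>e g L. norm e = 1 \<and>
     L-lipschitz_on {z. z \<bullet> e = 0} g \<and>
     \<Omega> \<inter> ball p r = {x \<in> ball p r. g (x - (x \<bullet> e) *\<^sub>R e) < x \<bullet> e})"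

end

theory Submission
  imports Defs "HOL-Complex_Analysis.Great_Picard" "HOL-Library.Diagonal_Subsequence"
begin

text \<open>The argument rests on one analytic fact and one algebraic one.

The analytic fact is a logarithmic Sobolev inequality with the sharp leading constant. Near the
origin the kernel is asymptotic to \<open>c / |y| ^ N\<close>, where \<open>c\<close> times the surface of the unit sphere
is \<open>2\<close>; hence the kernel has mass about \<open>2 ln (1 / \<rho>)\<close> outside a ball of radius \<open>\<rho>\<close>. Choosing
\<open>\<rho> = |u(x)| powr (- 2 / N)\<close> separately for every point \<open>x\<close> turns this mass into \<open>ln u\<^sup>2\<close>, and
\<open>log_sobolev\<close> bounds \<open>\<kappa> \<integral> u\<^sup>2 ln (u\<^sup>2 / \<Lambda>\<^sup>2)\<close> over \<open>{|u| > \<Lambda>}\<close>, for \<open>0 < \<kappa> < 4 / N\<close>, by twice the part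
of the energy that comes from pairs of points closer than a prescribed \<open>\<delta>\<close>; here \<open>\<Lambda>\<close> depends on \<open>\<kappa>\<close>,
on \<open>\<delta>\<close> and on a bound for the \<open>L\<^sup>2\<close> norm of \<open>u\<close>. In particular the entropy \<open>\<integral> u\<^sup>2 ln u\<^sup>2\<close> is finite
on the energy space. The inequality makes \<open>J_ln\<close> coercive on \<open>L\<^sup>2\<close>-spheres for \<open>k < 4 / N\<close>; it makes the entropy
continuous in the energy norm, because the energy of close pairs is small; and it
gives lower semicontinuity although the entropy has critical growth, because the energy of close
pairs absorbs the large values of \<open>u\<close>, while the energy of distant pairs is lower semicontinuous
by Fatou's lemma.

The algebraic fact is how \<open>J_ln\<close> behaves on rays. For \<open>k > 0\<close>, let \<open>m\<close> be the minimum of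
\<open>E_omega u u - k / 2 \<integral> u\<^sup>2 ln u\<^sup>2\<close> over the unit sphere of \<open>L\<^sup>2\<close>; it is attained, because energy bounds
give compactness in \<open>L\<^sup>2\<close> (\<open>energy_bounded_compact\<close>). Scaling yields \<open>J_ln(u) \<ge> profile(\<parallel>u\<parallel>\<^sup>2)\<close> for an
explicit function \<open>profile\<close> of one real variable with its maximum \<open>k S / 4\<close> at \<open>S\<close>, with equality
on the ray through the minimiser (\<open>J_ln_profile\<close>). All claims for \<open>0 < k < 4 / N\<close> follow from this
comparison: a Nehari point has \<open>J_ln = k \<parallel>u\<parallel>\<^sup>2 / 4\<close>, hence \<open>\<parallel>u\<parallel>\<^sup>2 \<ge> S\<close>; along a mountain path
\<open>\<parallel>\<sigma>(t)\<parallel>\<^sup>2\<close> must cross \<open>S\<close>, and the ray itself is an optimal path; and at the optimal point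
\<open>J_ln - profile(\<parallel>\<cdot>\<parallel>\<^sup>2)\<close> has a minimum while \<open>profile\<close> is stationary, so \<open>J_ln\<close> is stationary too
(\<open>euler_lagrange\<close>).

For \<open>k < 0\<close> the functional is uniformly convex as a function of \<open>u\<^sup>2\<close>: passing to the quadratic mean
of \<open>u\<close> and \<open>v\<close> does not increase the mean energy and lowers the entropy term at least by a
multiple of \<open>\<parallel>|u| - |v|\<parallel>\<^sup>2\<close> (\<open>J_ln_quadratic_mean\<close>). So nonnegative minimising sequences are Cauchy
in \<open>L\<^sup>2\<close>, which gives existence, and two minimisers have the same modulus, which gives uniqueness.

In both cases minimality forces a sign: replacing \<open>u\<close> by \<open>|u|\<close> strictly lowers the energy as soon as
both \<open>{u > 0}\<close> and \<open>{u < 0}\<close> have positive measure, because the kernel is positive off the origin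
(\<open>minimal_no_sign_change\<close>).\<close>

section \<open>Polar coordinates and the kernel\<close>

text \<open>Both sides are integrals of \<open>f\<close> against measures on the line that agree on all half-lines
\<open>{..a}\<close>, by the volume formula for balls; half-lines are an intersection-stable generator.\<close>

lemma nn_integral_radial:
  fixes f :: "real \<Rightarrow> ennreal"
  assumes [measurable]: "f \<in> borel_measurable borel"
  shows "(\<integral>\<^sup>+z. f (norm (z::'a::euclidean_space)) \<partial>lborel) =
    (\<integral>\<^sup>+r. ennreal (real DIM('a) * unit_ball_vol (real DIM('a)) * r ^ (DIM('a) - 1)) * indicator {0..} r * f r \<partial>lborel)"
proof -
  let ?V = "unit_ball_vol (real DIM('a))"
  let ?g = "\<lambda>r. ennreal (real DIM('a) * ?V * r ^ (DIM('a) - 1)) * indicator {0..} r"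
  let ?M = "distr (lborel :: 'a measure) borel norm" and ?N = "density (lborel :: real measure) ?g"
  have V: "?V \<ge> 0" by (simp add: less_imp_le)
  have M: "emeasure ?M {..a} = (if a \<ge> 0 then ennreal (?V * a ^ DIM('a)) else 0)" for a
  proof -
    have "emeasure ?M {..a} = emeasure (lborel :: 'a measure) (norm -` {..a} \<inter> space lborel)"
      by (subst emeasure_distr) auto
    also have "norm -` {..a} \<inter> space lborel = (cball 0 a :: 'a set)" by auto
    finally show ?thesis by (auto simp: emeasure_cball)
  qed
  have N: "emeasure ?N {..a} = (if a \<ge> 0 then ennreal (?V * a ^ DIM('a)) else 0)" for a
  proof (cases "a \<ge> 0")
    case True
    have "emeasure ?N {..a} = (\<integral>\<^sup>+r. ?g r * indicator {..a} r \<partial>lborel)"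
      by (subst emeasure_density) auto
    also have "\<dots> = (\<integral>\<^sup>+r. ennreal (real DIM('a) * ?V * r ^ (DIM('a) - 1)) * indicator {0..a} r \<partial>lborel)"
      by (intro nn_integral_cong) (auto split: split_indicator)
    also have "\<dots> = ennreal (?V * a ^ DIM('a) - ?V * 0 ^ DIM('a))"
      using True V by (intro nn_integral_FTC_Icc) (auto intro!: derivative_eq_intros)
    finally show ?thesis using True by simp
  next
    case False
    have "emeasure ?N {..a} = (\<integral>\<^sup>+r. ?g r * indicator {..a} r \<partial>lborel)"
      by (subst emeasure_density) auto
    also have "\<dots> = (\<integral>\<^sup>+(r::real). 0 \<partial>lborel)"
      using False by (intro nn_integral_cong) (auto split: split_indicator)
    finally show ?thesis using False by simp
  qed
  have "?M = ?N"
  proof (rule measure_eqI_generator_eq[where E="range (\<lambda>a. {..a::real})" and \<Omega>=UNIV and A="\<lambda>i. {..real i}"])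
    show "Int_stable (range (\<lambda>a. {..a::real}))"
      by (auto simp: Int_stable_def)
    show "sets ?M = sigma_sets UNIV (range (\<lambda>a. {..a::real}))"
      by (subst sets_distr, subst borel_eq_atMost) simp
    show "sets ?N = sigma_sets UNIV (range (\<lambda>a. {..a::real}))"
      by (subst sets_density, subst sets_lborel, subst borel_eq_atMost) simp
    show "(\<Union>i. {..real i}) = UNIV" using real_arch_simple by auto
    next
    fix X assume "X \<in> range (\<lambda>a. {..a::real})"
    then show "emeasure ?M X = emeasure ?N X" using M N by (auto simp only:)
  qed (auto simp only: M, auto)
  then have "(\<integral>\<^sup>+r. f r \<partial>?M) = (\<integral>\<^sup>+r. f r \<partial>?N)" by simp
  then show ?thesis
    by (simp add: nn_integral_distr nn_integral_density)
qed

text \<open>The upper incomplete Gamma function \<open>\<Gamma>(\<nu>, a)\<close>; the parameter \<open>a\<close> comes first.\<close>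

definition upper_Gamma :: "real \<Rightarrow> real \<Rightarrow> ennreal" where
  "upper_Gamma a \<nu> = (\<integral>\<^sup>+s. ennreal (s powr (\<nu> - 1) / exp s) * indicator {a..} s \<partial>lborel)"

lemma upper_Gamma_0: "\<nu> > 0 \<Longrightarrow> upper_Gamma 0 \<nu> = ennreal (Gamma \<nu>)"
  unfolding upper_Gamma_def
  by (subst Gamma_conv_nn_integral_real) (auto intro!: nn_integral_cong split: split_indicator)

text \<open>On \<open>{a..}\<close> one has \<open>1 \<le> (s / a) powr p\<close>, so a higher exponent buys decay in \<open>a\<close>.\<close>

lemma upper_Gamma_le: 
  assumes "a > 0" "\<nu> > 0" "p \<ge> 0"
  shows "upper_Gamma a \<nu> \<le> ennreal (a powr (-p) * Gamma (\<nu> + p))"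
proof -
  have "upper_Gamma a \<nu> \<le> (\<integral>\<^sup>+s. ennreal (a powr (-p)) * (ennreal (s powr (\<nu> + p - 1) / exp s) * indicator {0..} s) \<partial>lborel)"
    unfolding upper_Gamma_def
  proof (rule nn_integral_mono)
    fix s :: real
    have "s powr (\<nu> - 1) \<le> a powr (-p) * s powr (\<nu> + p - 1)" if "a \<le> s"
    proof -
      have "a powr p \<le> s powr p" using that assms by (intro powr_mono2) auto
      then have "1 \<le> a powr (-p) * s powr p"
        using assms by (simp add: powr_minus field_simps)
      then have "s powr (\<nu> - 1) * 1 \<le> s powr (\<nu> - 1) * (a powr (-p) * s powr p)"
        by (intro mult_left_mono) auto
      also have "s powr (\<nu> - 1) * (a powr (-p) * s powr p) = a powr (-p) * (s powr (\<nu> - 1 + p))"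
        by (simp only: powr_add mult_ac)
      finally show ?thesis by (simp add: algebra_simps)
    qed
    then show "ennreal (s powr (\<nu> - 1) / exp s) * indicator {a..} s
       \<le> ennreal (a powr (-p)) * (ennreal (s powr (\<nu> + p - 1) / exp s) * indicator {0..} s)"
      using assms by (auto simp: ennreal_mult'[symmetric] divide_simps split: split_indicator intro!: ennreal_leI)
  qed
  also have "\<dots> = ennreal (a powr (-p)) * upper_Gamma 0 (\<nu> + p)"
    unfolding upper_Gamma_def by (subst nn_integral_cmult) auto
  also have "\<dots> = ennreal (a powr (-p) * Gamma (\<nu> + p))"
    using assms by (subst upper_Gamma_0) (auto simp: ennreal_mult'[symmetric])
  finally show ?thesis .
qed

text \<open>Monotone convergence as the lower limit of integration decreases to \<open>0\<close>.\<close>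

lemma upper_Gamma_near_Gamma:
  assumes "\<nu> > 0" "c < Gamma \<nu>"
  shows "\<exists>a>0. ennreal c \<le> upper_Gamma a \<nu>"
proof (cases "c \<ge> 0")
  case True
  let ?f = "\<lambda>n s. ennreal (s powr (\<nu> - 1) / exp s) * indicator {inverse (real (Suc n))..} s"
  have "(\<lambda>n. \<integral>\<^sup>+s. ?f n s \<partial>lborel) \<longlonglongrightarrow> (\<integral>\<^sup>+s. ennreal (s powr (\<nu> - 1) / exp s) * indicator {0<..} s \<partial>lborel)"
  proof (rule nn_integral_LIMSEQ)
    show "incseq ?f"
    proof (intro incseq_SucI le_funI)
      fix n s
      have "inverse (real (Suc (Suc n))) \<le> inverse (real (Suc n))" by (intro le_imp_inverse_le) auto
      then show "?f n s \<le> ?f (Suc n) s" by (intro mult_left_mono) (auto simp: indicator_def simp del: of_nat_Suc inverse_le_iff_le)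
    qed
    fix s :: real
    show "(\<lambda>n. ?f n s) \<longlonglongrightarrow> ennreal (s powr (\<nu> - 1) / exp s) * indicator {0<..} s"
    proof (cases "s > 0")
      case True
      then obtain n where n: "inverse (real (Suc n)) < s" using reals_Archimedean by blast
      have "\<forall>\<^sub>F m in sequentially. ?f m s = ennreal (s powr (\<nu> - 1) / exp s) * indicator {0<..} s"
        using eventually_ge_at_top[of n]
      proof eventually_elim
        case (elim m)
        have "inverse (real (Suc m)) \<le> inverse (real (Suc n))" using elim by (intro le_imp_inverse_le) auto
        then have "inverse (real (Suc m)) \<le> s" using n by linarith
        then show ?case using True by (simp add: indicator_def)
      qed
      then show ?thesis by (rule tendsto_eventually)
    next
      case False
      have "inverse (real (Suc m)) > s" for m using False
        by (intro le_less_trans[of s 0]) auto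
      then have "(\<lambda>m. ?f m s) = (\<lambda>m. 0)" by (auto simp: not_le indicator_def simp del: of_nat_Suc)
      then show ?thesis using False by (simp only:) simp
    qed
  qed auto
  also have "(\<integral>\<^sup>+s. ennreal (s powr (\<nu> - 1) / exp s) * indicator {0<..} s \<partial>lborel) = upper_Gamma 0 \<nu>"
    unfolding upper_Gamma_def
    by (rule nn_integral_cong_AE, rule AE_mp[OF AE_lborel_singleton[of 0]], rule AE_I2) (auto simp: indicator_def)
  also have "\<dots> = ennreal (Gamma \<nu>)" using assms upper_Gamma_0 by auto
  finally have "\<forall>\<^sub>F n in sequentially. ennreal c < (\<integral>\<^sup>+s. ?f n s \<partial>lborel)"
    using assms True by (intro order_tendstoD(1)) (auto simp: ennreal_less_iff)
  then obtain n where "ennreal c < (\<integral>\<^sup>+s. ?f n s \<partial>lborel)"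
    using eventually_happens'[OF sequentially_bot] by blast
  then show ?thesis unfolding upper_Gamma_def by (intro exI[of _ "inverse (real (Suc n))"]) auto
qed (auto intro!: exI[of _ 1] simp: ennreal_neg)

lemma upper_Gamma_antimono: "a \<le> b \<Longrightarrow> upper_Gamma b \<nu> \<le> upper_Gamma a \<nu>"
  unfolding upper_Gamma_def by (intro nn_integral_mono) (auto split: split_indicator)

text \<open>The substitution \<open>s = (r / 2) exp t\<close> identifies the integral of the dominating part of the
Bessel integrand with an incomplete Gamma function.\<close>

lemma nn_integral_exp_subst:
  assumes r: "r > 0"
  shows "(\<integral>\<^sup>+t. ennreal (exp (- (r/2) * exp t) * exp (\<nu> * t)) * indicator {0..} t \<partial>lborel)
     = ennreal ((2 / r) powr \<nu>) * upper_Gamma (r/2) \<nu>"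
proof -
  let ?f = "\<lambda>s. ennreal ((2/r) powr \<nu> * (s powr (\<nu> - 1) / exp s))"
  let ?g = "\<lambda>t. (r/2) * exp t"
  let ?h = "\<lambda>t. ennreal (exp (- (r/2) * exp t) * exp (\<nu> * t))"
  have fin: "(\<integral>\<^sup>+s. ?f s * indicator {r/2..?g (real n)} s \<partial>lborel) = (\<integral>\<^sup>+t. ?h t * indicator {0..real n} t \<partial>lborel)" for n
  proof (cases "n = 0")
    case True
    have "(\<integral>\<^sup>+s. ?f s * indicator {r/2..?g (real n)} s \<partial>lborel) = (\<integral>\<^sup>+(s::real). 0 \<partial>lborel)"
      by (rule nn_integral_cong_AE, rule AE_mp[OF AE_lborel_singleton[of "r/2"]], rule AE_I2) (simp add: True)
    moreover have "(\<integral>\<^sup>+t. ?h t * indicator {0..real n} t \<partial>lborel) = (\<integral>\<^sup>+(s::real). 0 \<partial>lborel)"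
      by (rule nn_integral_cong_AE, rule AE_mp[OF AE_lborel_singleton[of "0"]], rule AE_I2) (simp add: True)
    ultimately show ?thesis by simp
  next
    case False
    have "(\<integral>\<^sup>+s. ?f s * indicator {?g 0..?g (real n)} s \<partial>lborel)
        = (\<integral>\<^sup>+t. ?f (?g t) * ennreal (?g t) * indicator {0..real n} t \<partial>lborel)"
      using r False by (intro nn_integral_substitution_aux) (auto intro!: derivative_eq_intros continuous_intros)
    also have "\<dots> = (\<integral>\<^sup>+t. ?h t * indicator {0..real n} t \<partial>lborel)"
    proof (intro nn_integral_cong)
      fix t :: real
      have "?g t = ?g t powr 1" using r by simp
      then have "(2/r) powr \<nu> * (?g t powr (\<nu> - 1) / exp (?g t)) * ?g t = (2/r) powr \<nu> * (?g t powr (\<nu> - 1) * ?g t powr 1) / exp (?g t)"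
        by (metis (no_types, opaque_lifting) times_divide_eq_right times_divide_eq_left mult.assoc)
      also have "?g t powr (\<nu> - 1) * ?g t powr 1 = ?g t powr \<nu>" by (simp only: powr_add[symmetric]) simp
      also have "\<dots> = (r/2) powr \<nu> * exp (\<nu> * t)" using r by (simp add: powr_def ln_mult ln_div exp_add[symmetric] algebra_simps)
      also have "(2/r) powr \<nu> * ((r/2) powr \<nu> * exp (\<nu> * t)) / exp (?g t)
        = ((2/r) powr \<nu> * (r/2) powr \<nu>) * exp (\<nu> * t) / exp (?g t)" by simp
      also have "(2/r) powr \<nu> * (r/2) powr \<nu> = 1" using r by (subst powr_mult[symmetric]) auto
      finally have *: "(2/r) powr \<nu> * (?g t powr (\<nu> - 1) / exp (?g t)) * ?g t = exp (- (r/2) * exp t) * exp (\<nu> * t)"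
        by (simp add: exp_minus field_simps)
      have "?f (?g t) * ennreal (?g t) = ennreal ((2/r) powr \<nu> * (?g t powr (\<nu> - 1) / exp (?g t)) * ?g t)"
        using r by (intro ennreal_mult[symmetric]) auto
      then show "?f (?g t) * ennreal (?g t) * indicator {0..real n} t = ?h t * indicator {0..real n} t"
        using * by simp
    qed
    finally show ?thesis by simp
  qed
  have l1: "(\<lambda>n. \<integral>\<^sup>+t. ?h t * indicator {0..real n} t \<partial>lborel) \<longlonglongrightarrow> (\<integral>\<^sup>+t. ?h t * indicator {0..} t \<partial>lborel)"
  proof (rule nn_integral_LIMSEQ)
    show "incseq (\<lambda>n t. ?h t * indicator {0..real n} t)"
      by (auto intro!: incseq_SucI le_funI split: split_indicator)
    fix t :: real
    obtain N where N: "t \<le> real N" using real_arch_simple by blast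
    have "\<forall>\<^sub>F n in sequentially. ?h t * indicator {0..real n} t = ?h t * indicator {0..} t"
      using eventually_ge_at_top[of N] by eventually_elim (use N in \<open>auto split: split_indicator\<close>)
    then show "(\<lambda>n. ?h t * indicator {0..real n} t) \<longlonglongrightarrow> ?h t * indicator {0..} t"
      by (rule tendsto_eventually)
  qed auto
  \<comment> \<open>The upper limits \<open>(r / 2) exp n\<close> exhaust the half-line, since \<open>exp n \<ge> n\<close>.\<close>
  have l2: "(\<lambda>n. \<integral>\<^sup>+s. ?f s * indicator {r/2..?g (real n)} s \<partial>lborel) \<longlonglongrightarrow> (\<integral>\<^sup>+s. ?f s * indicator {r/2..} s \<partial>lborel)"
  proof (rule nn_integral_LIMSEQ)
    have "?g (real n) \<le> ?g (real (Suc n))" for n using r by auto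
    then show "incseq (\<lambda>n s. ?f s * indicator {r/2..?g (real n)} s)"
      using order_trans by (fastforce intro!: incseq_SucI le_funI split: split_indicator)
    fix s :: real
    obtain N where N: "s * (2/r) \<le> real N" using real_arch_simple by blast
    have "\<forall>\<^sub>F n in sequentially. ?f s * indicator {r/2..?g (real n)} s = ?f s * indicator {r/2..} s"
      using eventually_ge_at_top[of N]
    proof eventually_elim
      case (elim n)
      have "s * (2/r) \<le> exp (real n)" using N elim exp_ge_add_one_self[of "real n"] by linarith
      then have "s \<le> ?g (real n)" using r by (simp add: field_simps)
      then show ?case by (auto split: split_indicator)
    qed
    then show "(\<lambda>n. ?f s * indicator {r/2..?g (real n)} s) \<longlonglongrightarrow> ?f s * indicator {r/2..} s"
      by (rule tendsto_eventually)
  qed auto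
  have "(\<integral>\<^sup>+t. ?h t * indicator {0..} t \<partial>lborel) = (\<integral>\<^sup>+s. ?f s * indicator {r/2..} s \<partial>lborel)"
    using LIMSEQ_unique[OF l1] l2 fin by auto
  also have "\<dots> = ennreal ((2 / r) powr \<nu>) * upper_Gamma (r/2) \<nu>"
    unfolding upper_Gamma_def by (subst nn_integral_cmult[symmetric]) (auto simp: ennreal_mult'[symmetric] mult.assoc intro!: nn_integral_cong split: split_indicator)
  finally show ?thesis .
qed

lemma bessel_integrand_bounds:
  assumes "r > 0" "\<nu> > 0" "t \<ge> (0::real)"
  shows "exp (- r * cosh t) * cosh (\<nu> * t) \<le> exp (- (r/2) * exp t) * exp (\<nu> * t)"
    and "exp (- r / 2) / 2 * (exp (- (r/2) * exp t) * exp (\<nu> * t)) \<le> exp (- r * cosh t) * cosh (\<nu> * t)"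
proof -
  have c1: "exp t / 2 \<le> cosh t" "cosh t \<le> exp t / 2 + 1 / 2"
    using assms by (auto simp: cosh_field_def)
  have c2: "exp (\<nu> * t) / 2 \<le> cosh (\<nu> * t)" 
    by (auto simp: cosh_field_def)
  have "exp (-(\<nu> * t)) \<le> exp (\<nu> * t)" using assms by auto
  then have c3: "cosh (\<nu> * t) \<le> exp (\<nu> * t)"
    by (auto simp: cosh_field_def)
  have "- r * cosh t \<le> - (r/2) * exp t" using c1 assms mult_left_mono[of "exp t / 2" "cosh t" r] by simp
  then show "exp (- r * cosh t) * cosh (\<nu> * t) \<le> exp (- (r/2) * exp t) * exp (\<nu> * t)"
    using c3 by (intro mult_mono) auto
  have e: "- r / 2 + - (r/2) * exp t \<le> - r * cosh t" using c1 assms mult_left_mono[of "cosh t" "exp t / 2 + 1/2" r]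
    by (simp add: algebra_simps)
  have "exp (- r / 2) / 2 * (exp (- (r/2) * exp t) * exp (\<nu> * t)) = exp (- r / 2 + - (r/2) * exp t) * (exp (\<nu> * t) / 2)"
    by (subst exp_add) simp
  also have "\<dots> \<le> exp (- r * cosh t) * cosh (\<nu> * t)"
    using e c2 by (intro mult_mono) auto
  finally show "exp (- r / 2) / 2 * (exp (- (r/2) * exp t) * exp (\<nu> * t)) \<le> exp (- r * cosh t) * cosh (\<nu> * t)" .
qed

lemma upper_Gamma_finite: "a > 0 \<Longrightarrow> \<nu> > 0 \<Longrightarrow> upper_Gamma a \<nu> < \<infinity>"
  using upper_Gamma_le[of a \<nu> 0] by (auto simp: less_top[symmetric] top_unique)

lemma upper_Gamma_pos: "a > 0 \<Longrightarrow> 0 < upper_Gamma a \<nu>"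
proof (rule ccontr)
  assume a: "a > 0" and "\<not> 0 < upper_Gamma a \<nu>"
  then have "upper_Gamma a \<nu> = 0" by simp
  then have "AE s in lborel. ennreal (s powr (\<nu> - 1) / exp s) * indicator {a..} s = 0"
    unfolding upper_Gamma_def by (subst (asm) nn_integral_0_iff_AE) auto
  then have "AE s in lborel. s \<notin> {a..a+1}"
    by eventually_elim (use a in \<open>auto simp: indicator_def ennreal_eq_0_iff divide_le_0_iff split: if_splits\<close>)
  then have "emeasure lborel {a..a+1} = 0"
    by (subst (asm) AE_iff_measurable[of "{a..a+1}"]) auto
  then show False by simp
qed

text \<open>Since \<open>cosh t\<close> lies between \<open>exp t / 2\<close> and \<open>exp t / 2 + 1 / 2\<close>, and \<open>cosh (\<nu> t)\<close> between
\<open>exp (\<nu> t) / 2\<close> and \<open>exp (\<nu> t)\<close>, the Bessel function is comparable to an incomplete Gamma function.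
The lower bound becomes asymptotically exact as \<open>r\<close> tends to \<open>0\<close>.\<close>

lemma bessel_K_bounds:
  assumes r: "r > 0" and \<nu>: "\<nu> > 0"
  shows "ennreal (bessel_K \<nu> r) \<le> ennreal ((2 / r) powr \<nu>) * upper_Gamma (r/2) \<nu>"
    and "ennreal (exp (- r / 2) / 2) * (ennreal ((2 / r) powr \<nu>) * upper_Gamma (r/2) \<nu>) \<le> ennreal (bessel_K \<nu> r)"
proof -
  let ?b = "\<lambda>t. exp (- r * cosh t) * cosh (\<nu> * t)"
  let ?h = "\<lambda>t. exp (- (r/2) * exp t) * exp (\<nu> * t)"
  have up: "(\<integral>\<^sup>+t. ennreal (?b t) * indicator {0..} t \<partial>lborel) \<le> ennreal ((2 / r) powr \<nu>) * upper_Gamma (r/2) \<nu>"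
    unfolding nn_integral_exp_subst[OF r, symmetric]
    using bessel_integrand_bounds(1)[OF r \<nu>] by (intro nn_integral_mono) (auto split: split_indicator intro!: ennreal_leI)
  have lo: "ennreal (exp (- r / 2) / 2) * (ennreal ((2 / r) powr \<nu>) * upper_Gamma (r/2) \<nu>) \<le> (\<integral>\<^sup>+t. ennreal (?b t) * indicator {0..} t \<partial>lborel)"
    unfolding nn_integral_exp_subst[OF r, symmetric]
  proof (subst nn_integral_cmult[symmetric], simp, intro nn_integral_mono)
    fix t :: real
    show "ennreal (exp (- r / 2) / 2) * (ennreal (?h t) * indicator {0..} t) \<le> ennreal (?b t) * indicator {0..} t"
      using bessel_integrand_bounds(2)[OF r \<nu>, of t] 
      by (auto split: split_indicator simp: ennreal_mult'[symmetric] simp del: ennreal_half intro!: ennreal_leI)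
  qed
  have m: "(\<lambda>t. indicator {0..} t *\<^sub>R ?b t) \<in> borel_measurable lborel"
    unfolding cosh_field_def by measurable
  have b0: "?b t \<ge> 0" for t by (auto intro!: mult_nonneg_nonneg cosh_real_nonneg)
  have e: "(\<integral>\<^sup>+t. ennreal (indicator {0..} t *\<^sub>R ?b t) \<partial>lborel) = (\<integral>\<^sup>+t. ennreal (?b t) * indicator {0..} t \<partial>lborel)"
    by (intro nn_integral_cong) (auto split: split_indicator)
  have "(\<integral>\<^sup>+t. ennreal (indicator {0..} t *\<^sub>R ?b t) \<partial>lborel) < \<infinity>"
    unfolding e using upper_Gamma_finite[of "r/2" \<nu>] r \<nu> by (intro le_less_trans[OF up]) (auto simp: ennreal_mult_less_top)
  then have i: "integrable lborel (\<lambda>t. indicator {0..} t *\<^sub>R ?b t)"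
    using m b0 by (intro integrableI_nonneg) auto
  have "ennreal (bessel_K \<nu> r) = (\<integral>\<^sup>+t. ennreal (?b t) * indicator {0..} t \<partial>lborel)"
    unfolding bessel_K_def set_lebesgue_integral_def e[symmetric]
    using b0 by (subst nn_integral_eq_integral[OF i]) (auto split: split_indicator)
  then show "ennreal (bessel_K \<nu> r) \<le> ennreal ((2 / r) powr \<nu>) * upper_Gamma (r/2) \<nu>"
     "ennreal (exp (- r / 2) / 2) * (ennreal ((2 / r) powr \<nu>) * upper_Gamma (r/2) \<nu>) \<le> ennreal (bessel_K \<nu> r)"
    using up lo by auto
qed

lemma omega_fun_upper:
  assumes N: "N > 0" and r: "r > 0" and p: "p \<ge> 0"
  shows "omega_fun N r \<le> 2 powr (1 + p) * Gamma (real N / 2 + p) * r powr (- p)"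
proof -
  define \<nu> where "\<nu> = real N / 2"
  have \<nu>: "\<nu> > 0" using N by (simp add: \<nu>_def)
  have "ennreal (bessel_K \<nu> r) \<le> ennreal ((2 / r) powr \<nu>) * ennreal ((r/2) powr (- p) * Gamma (\<nu> + p))"
    using r \<nu> p by (intro order_trans[OF bessel_K_bounds(1)] mult_left_mono upper_Gamma_le) auto
  also have "\<dots> = ennreal ((2 / r) powr \<nu> * ((r/2) powr (- p) * Gamma (\<nu> + p)))"
    using \<nu> p by (subst ennreal_mult) (auto intro!: mult_nonneg_nonneg less_imp_le[OF Gamma_real_pos])
  finally have "bessel_K \<nu> r \<le> (2 / r) powr \<nu> * ((r/2) powr (- p) * Gamma (\<nu> + p))"
    using \<nu> p by (subst (asm) ennreal_le_iff) (auto intro!: mult_nonneg_nonneg less_imp_le[OF Gamma_real_pos])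
  then have "omega_fun N r \<le> 2 powr (1 - \<nu>) * r powr \<nu> * ((2 / r) powr \<nu> * ((r/2) powr (- p) * Gamma (\<nu> + p)))"
    unfolding omega_fun_def \<nu>_def[symmetric] by (intro mult_left_mono) auto
  also have "\<dots> = (2 powr (1 - \<nu>) * 2 powr \<nu>) * 2 powr p * r powr (- p) * Gamma (\<nu> + p)"
    using r by (simp add: powr_divide powr_minus divide_simps)
  also have "\<dots> = 2 powr (1 + p) * Gamma (\<nu> + p) * r powr (- p)"
    by (simp add: powr_add[symmetric] powr_add)
  finally show ?thesis by (simp add: \<nu>_def)
qed

lemma omega_fun_lower:
  assumes N: "N > 0" and r: "r > 0"
  shows "ennreal (exp (- r / 2)) * upper_Gamma (r / 2) (real N / 2) \<le> ennreal (omega_fun N r)"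
proof -
  define \<nu> where "\<nu> = real N / 2"
  have \<nu>: "\<nu> > 0" using N by (simp add: \<nu>_def)
  have "2 powr (1 - \<nu>) * r powr \<nu> * (exp (- r / 2) / 2) * ((2 / r) powr \<nu>) = (2 powr (1 - \<nu>) * 2 powr \<nu>) * (exp (- r / 2) / 2)"
    using r by (simp add: powr_divide powr_minus divide_simps)
  also have "2 powr (1 - \<nu>) * 2 powr \<nu> = (2::real)" by (simp add: powr_add[symmetric])
  finally have eq: "2 powr (1 - \<nu>) * r powr \<nu> * (exp (- r / 2) / 2) * ((2 / r) powr \<nu>) = exp (- r / 2)" by simp
  have "ennreal (2 powr (1 - \<nu>) * r powr \<nu>) * (ennreal (exp (- r / 2) / 2) * (ennreal ((2 / r) powr \<nu>) * upper_Gamma (r/2) \<nu>))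
     \<le> ennreal (2 powr (1 - \<nu>) * r powr \<nu>) * ennreal (bessel_K \<nu> r)"
    using r \<nu> by (intro mult_left_mono bessel_K_bounds) auto
  also have "\<dots> = ennreal (omega_fun N r)"
    unfolding omega_fun_def \<nu>_def[symmetric] by (simp add: ennreal_mult')
  also have "ennreal (2 powr (1 - \<nu>) * r powr \<nu>) * (ennreal (exp (- r / 2) / 2) * (ennreal ((2 / r) powr \<nu>) * upper_Gamma (r/2) \<nu>))
     = ennreal (2 powr (1 - \<nu>) * r powr \<nu> * (exp (- r / 2) / 2) * ((2 / r) powr \<nu>)) * upper_Gamma (r/2) \<nu>"
    using r by (simp only: ennreal_mult' ennreal_mult'' mult.assoc powr_ge_zero exp_ge_zero divide_nonneg_nonneg zero_le_numeral mult_nonneg_nonneg)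
  finally show ?thesis unfolding eq by (simp add: \<nu>_def)
qed

lemma omega_fun_pos: "N > 0 \<Longrightarrow> r > 0 \<Longrightarrow> omega_fun N r > 0"
proof -
  assume a: "N > 0" "r > 0"
  have "0 < ennreal (exp (- r / 2)) * upper_Gamma (r / 2) (real N / 2)"
    using upper_Gamma_pos[of "r/2" "real N / 2"] a by (simp add: ennreal_zero_less_mult_iff)
  also have "\<dots> \<le> ennreal (omega_fun N r)" using omega_fun_lower a by auto
  finally show ?thesis by simp
qed

text \<open>The number \<open>\<Gamma>(N / 2)\<close> is the limit of \<open>\<omega>\<close> at \<open>0\<close>. The lower bound has to come arbitrarily close
to it, because the threshold \<open>4 / N\<close> depends on this constant.\<close>

lemma omega_fun_near_0:
  assumes N: "N > 0" and c: "c < Gamma (real N / 2)"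
  shows "\<exists>\<delta>>0. \<forall>r. 0 < r \<and> r < \<delta> \<longrightarrow> c \<le> omega_fun N r"
proof -
  let ?\<nu> = "real N / 2"
  have G: "Gamma ?\<nu> > 0" using N by (intro Gamma_real_pos) auto
  obtain c' where c': "max 0 c < c'" "c' < Gamma ?\<nu>"
    using dense[of "max 0 c" "Gamma ?\<nu>"] c G by auto
  obtain a where a: "a > 0" "ennreal c' \<le> upper_Gamma a ?\<nu>" using upper_Gamma_near_Gamma[of ?\<nu> c'] N c' by auto
  have "((\<lambda>r. exp (- r / 2) * c') \<longlongrightarrow> exp (- 0 / 2) * c') (at_right 0)"
    by (intro tendsto_intros) auto
  then have "\<forall>\<^sub>F r in at_right 0. max 0 c < exp (- r / 2) * c'"
    using c' by (intro order_tendstoD(1)) auto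
  then obtain b where b: "b > 0" "\<And>r. 0 < r \<Longrightarrow> r < b \<Longrightarrow> max 0 c < exp (- r / 2) * c'"
    by (auto simp: eventually_at_right_field)
  show ?thesis
  proof (intro exI[of _ "min b (2 * a)"] conjI allI impI)
    fix r assume r: "0 < r \<and> r < min b (2 * a)"
    have "ennreal c \<le> ennreal (exp (- r / 2) * c')" using b(2)[of r] r by (intro ennreal_leI) auto
    also have "\<dots> = ennreal (exp (- r / 2)) * ennreal c'" by (simp add: ennreal_mult')
    also have "\<dots> \<le> ennreal (exp (- r / 2)) * upper_Gamma (r / 2) ?\<nu>"
      using r by (intro mult_left_mono order_trans[OF a(2) upper_Gamma_antimono]) auto
    also have "\<dots> \<le> ennreal (omega_fun N r)" using omega_fun_lower N r by auto
    finally show "c \<le> omega_fun N r" 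
      using omega_fun_pos[of N r] N r by (subst (asm) ennreal_le_iff) auto
  qed (use a b in auto)
qed

lemma bessel_K_measurable [measurable]: "bessel_K \<nu> \<in> borel_measurable borel"
proof -
  have "(\<lambda>r. \<integral>t. indicator {0..} t *\<^sub>R (exp (- r * cosh t) * cosh (\<nu> * t)) \<partial>lborel) \<in> borel_measurable borel"
    unfolding cosh_field_def by measurable
  then show ?thesis unfolding bessel_K_def[abs_def] set_lebesgue_integral_def .
qed

lemma J_kernel_measurable [measurable]: "(J_kernel :: 'a::euclidean_space \<Rightarrow> real) \<in> borel_measurable borel"
  unfolding J_kernel_def[abs_def] omega_fun_def by measurable

lemma J_kernel_pos: "z \<noteq> 0 \<Longrightarrow> J_kernel (z::'a::euclidean_space) > 0"
  unfolding J_kernel_def d_const_def using omega_fun_pos[of "DIM('a)" "norm z"]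
  by (intro divide_pos_pos mult_pos_pos) auto

lemma J_kernel_0 [simp]: "J_kernel (0::'a::euclidean_space) = 0"
  by (simp add: J_kernel_def)

lemma J_kernel_nonneg [simp]: "J_kernel (z::'a::euclidean_space) \<ge> 0"
  using J_kernel_pos[of z] by (cases "z = 0") auto

lemma J_kernel_minus [simp]: "J_kernel (- z) = J_kernel (z::'a::euclidean_space)"
  by (simp add: J_kernel_def)

lemma J_kernel_sym: "J_kernel (x - y) = J_kernel (y - x :: 'a::euclidean_space)"
  using J_kernel_minus[of "x - y"] by simp

text \<open>The first bound describes the singularity, the second one makes the kernel integrable at
infinity.\<close>

lemma J_kernel_upper:
  "\<exists>C>0. \<forall>z::'a::euclidean_space. J_kernel z \<le> C / norm z ^ DIM('a) \<and> J_kernel z \<le> C / norm z ^ (DIM('a) + 1)"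
proof -
  let ?n = "real DIM('a)"
  define C where "C = d_const DIM('a) * (2 * Gamma (?n/2) + 4 * Gamma (?n / 2 + 1))"
  have G: "Gamma (?n/2) > 0" "Gamma (?n / 2 + 1) > 0" by (auto intro!: Gamma_real_pos)
  have d: "d_const DIM('a) > 0" by (simp add: d_const_def)
  have Cp: "C > 0" unfolding C_def using G d by (intro mult_pos_pos add_pos_pos) auto
  moreover have "J_kernel z \<le> C / norm z ^ DIM('a) \<and> J_kernel z \<le> C / norm z ^ (DIM('a) + 1)" for z :: 'a
  proof (cases "z = 0")
    case False
    have "omega_fun DIM('a) (norm z) \<le> 2 * Gamma (?n/2)"
      using omega_fun_upper[of "DIM('a)" "norm z" 0] False by auto
    then have "d_const DIM('a) * omega_fun DIM('a) (norm z) \<le> C"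
      unfolding C_def using d G by (intro mult_left_mono) linarith+
    then have 1: "J_kernel z \<le> C / norm z ^ DIM('a)"
      unfolding J_kernel_def by (intro divide_right_mono) auto
    have "omega_fun DIM('a) (norm z) \<le> (4 * Gamma (?n/2+1)) / norm z"
      using omega_fun_upper[of "DIM('a)" "norm z" 1] False by (auto simp: powr_minus field_simps)
    also have "\<dots> \<le> (2 * Gamma (?n/2) + 4 * Gamma (?n / 2 + 1)) / norm z" using G by (intro divide_right_mono) auto
    finally have "d_const DIM('a) * omega_fun DIM('a) (norm z) \<le> C / norm z"
      unfolding C_def times_divide_eq_right[symmetric] using d by (intro mult_left_mono) auto
    then have "J_kernel z \<le> (C / norm z) / norm z ^ DIM('a)"
      unfolding J_kernel_def by (intro divide_right_mono) auto
    with 1 show ?thesis by simp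
  next
    case True
    then show ?thesis using Cp by (auto intro!: divide_nonneg_nonneg)
  qed
  ultimately show ?thesis by blast
qed

text \<open>The constant \<open>2 / (N |B\<^sub>1|)\<close> is \<open>\<Gamma>(N / 2) / \<pi> powr (N / 2)\<close>: two divided by the surface of the
unit sphere.\<close>

lemma J_kernel_lower:
  assumes "c < 2 / (real DIM('a) * unit_ball_vol (real DIM('a)))"
  shows "\<exists>\<delta>>0. \<forall>z::'a::euclidean_space. 0 < norm z \<and> norm z < \<delta> \<longrightarrow> c / norm z ^ DIM('a) \<le> J_kernel z"
proof -
  let ?n = "real DIM('a)"
  have "Gamma (?n / 2 + 1) = ?n / 2 * Gamma (?n / 2)" by (intro Gamma_plus1) auto
  then have e: "2 / (?n * unit_ball_vol ?n) = d_const DIM('a) * Gamma (?n/2)"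
    by (simp add: unit_ball_vol_def d_const_def powr_minus field_simps)
  have d: "d_const DIM('a) > 0" by (simp add: d_const_def)
  have "c / d_const DIM('a) < Gamma (?n / 2)" using assms d unfolding e by (simp add: field_simps)
  then obtain \<delta> where \<delta>: "\<delta> > 0" "\<And>r. 0 < r \<Longrightarrow> r < \<delta> \<Longrightarrow> c / d_const DIM('a) \<le> omega_fun DIM('a) r"
    using omega_fun_near_0[of "DIM('a)" "c / d_const DIM('a)"] by auto
  show ?thesis
  proof (intro exI[of _ \<delta>] conjI allI impI)
    fix z :: 'a assume "0 < norm z \<and> norm z < \<delta>"
    then have "c \<le> d_const DIM('a) * omega_fun DIM('a) (norm z)" using \<delta>(2)[of "norm z"] d by (simp add: field_simps)
    then show "c / norm z ^ DIM('a) \<le> J_kernel z" unfolding J_kernel_def by (intro divide_right_mono) auto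
  qed (rule \<delta>)
qed

text \<open>This is the Levy condition on the kernel: it makes Lipschitz functions of compact support
have finite energy.\<close>

lemma nn_integral_J_min:
  "(\<integral>\<^sup>+z. ennreal (min 1 ((norm z)\<^sup>2) * J_kernel z) \<partial>(lborel :: 'a::euclidean_space measure)) < \<infinity>"
proof -
  obtain C where C: "C > 0" "\<And>z::'a. J_kernel z \<le> C / norm z ^ DIM('a)" "\<And>z::'a. J_kernel z \<le> C / norm z ^ (DIM('a) + 1)"
    using J_kernel_upper by blast
  define f where "f r = (if r \<le> 1 then ennreal (C * r / r ^ (DIM('a) - 1)) else ennreal (C / r ^ (DIM('a) + 1)))" for r :: real
  define K where "K = real DIM('a) * unit_ball_vol (real DIM('a))"
  have K: "K \<ge> 0" unfolding K_def by (simp add: less_imp_le)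
  obtain m where m: "DIM('a) = Suc m" using DIM_positive[where 'a='a] gr0_implies_Suc by blast
  have "(\<integral>\<^sup>+z. ennreal (min 1 ((norm z)\<^sup>2) * J_kernel z) \<partial>(lborel :: 'a measure)) \<le> (\<integral>\<^sup>+z. f (norm (z::'a)) \<partial>lborel)"
  proof (intro nn_integral_mono)
    fix z :: 'a
    show "ennreal (min 1 ((norm z)\<^sup>2) * J_kernel z) \<le> f (norm z)"
    proof (cases "norm z \<le> 1")
      case True
      have "min 1 ((norm z)\<^sup>2) * J_kernel z \<le> (norm z)\<^sup>2 * (C / norm z ^ DIM('a))"
        by (intro mult_mono C) auto
      also have "\<dots> = C * norm z / norm z ^ (DIM('a) - 1)"
        unfolding m by (cases "z = 0") (auto simp: power2_eq_square)
      finally show ?thesis using True by (auto simp: f_def intro!: ennreal_leI)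
    next
      case False
      have "min 1 ((norm z)\<^sup>2) * J_kernel z \<le> 1 * (C / norm z ^ (DIM('a) + 1))"
        by (intro mult_mono C) auto
      then show ?thesis using False by (auto simp: f_def intro!: ennreal_leI)
    qed
  qed
  also have "\<dots> = (\<integral>\<^sup>+r. ennreal (K * r ^ (DIM('a) - 1)) * indicator {0..} r * f r \<partial>lborel)"
    unfolding K_def by (rule nn_integral_radial) (simp add: f_def)
  also have "\<dots> \<le> (\<integral>\<^sup>+r. ennreal (K * C * r) * indicator {0..1} r + ennreal (K * C / r\<^sup>2) * indicator {1..} r \<partial>lborel)"
  proof (intro nn_integral_mono)
    fix r :: real
    show "ennreal (K * r ^ (DIM('a) - 1)) * indicator {0..} r * f r
      \<le> ennreal (K * C * r) * indicator {0..1} r + ennreal (K * C / r\<^sup>2) * indicator {1..} r"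
    proof (cases "r \<le> 1")
      case True
      then show ?thesis using K C(1) unfolding m
        by (cases "r = 0") (auto simp: f_def m ennreal_mult'[symmetric] ennreal_mult''[symmetric] split: split_indicator)
    next
      case False
      then show ?thesis using K C(1) unfolding m
        by (auto simp: f_def m ennreal_mult'[symmetric] ennreal_mult''[symmetric] power2_eq_square split: split_indicator)
    qed
  qed
  also have "\<dots> = (\<integral>\<^sup>+r. ennreal (K * C * r) * indicator {0..1} r \<partial>lborel) + (\<integral>\<^sup>+r. ennreal (K * C / r\<^sup>2) * indicator {1..} r \<partial>lborel)"
    by (rule nn_integral_add) auto
  also have "(\<integral>\<^sup>+r. ennreal (K * C * r) * indicator {0..1} r \<partial>lborel) = ennreal (K * C * 1\<^sup>2 / 2 - K * C * 0\<^sup>2 / 2)"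
    using K C(1) by (intro nn_integral_FTC_Icc) (auto intro!: derivative_eq_intros)
  also have "(\<integral>\<^sup>+r. ennreal (K * C / r\<^sup>2) * indicator {1..} r \<partial>lborel) = ennreal (0 - (- (K * C) / 1))"
  proof (rule nn_integral_FTC_atLeast)
    show "((\<lambda>r. - (K * C) / r) \<longlongrightarrow> 0) at_top"
      by (intro tendsto_divide_0[OF tendsto_const] filterlim_at_top_imp_at_infinity filterlim_ident)
  qed (use K C(1) in \<open>auto intro!: derivative_eq_intros simp: power2_eq_square\<close>)
  also have "ennreal (K * C * 1\<^sup>2 / 2 - K * C * 0\<^sup>2 / 2) + ennreal (0 - (- (K * C) / 1)) < \<infinity>" by simp
  finally show ?thesis .
qed

lemma nn_integral_J_square:
  "\<exists>C>0. \<forall>\<rho>>0. (\<integral>\<^sup>+z. ennreal ((J_kernel z)\<^sup>2) * indicator {z. \<rho> \<le> norm z} z \<partial>(lborel :: 'a::euclidean_space measure)) \<le> ennreal (C / \<rho> ^ DIM('a))"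
proof -
  obtain C where C: "C > 0" "\<And>z::'a. J_kernel z \<le> C / norm z ^ DIM('a)"
    using J_kernel_upper by blast
  define V where "V = unit_ball_vol (real DIM('a))"
  have V: "V > 0" unfolding V_def by (simp)
  obtain m where m: "DIM('a) = Suc m" using DIM_positive[where 'a='a] gr0_implies_Suc by blast
  have "(\<integral>\<^sup>+z. ennreal ((J_kernel z)\<^sup>2) * indicator {z. \<rho> \<le> norm z} z \<partial>(lborel :: 'a measure)) \<le> ennreal (C\<^sup>2 * V / \<rho> ^ DIM('a))"
    if \<rho>: "\<rho> > 0" for \<rho>
  proof -
    have "(\<integral>\<^sup>+z. ennreal ((J_kernel z)\<^sup>2) * indicator {z. \<rho> \<le> norm z} z \<partial>(lborel :: 'a measure))
      \<le> (\<integral>\<^sup>+(z::'a). ennreal ((C / norm z ^ DIM('a))\<^sup>2) * indicator {\<rho>..} (norm z) \<partial>lborel)"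
      using C(2) by (intro nn_integral_mono) (auto split: split_indicator intro!: ennreal_leI power_mono)
    also have "\<dots> = (\<integral>\<^sup>+r. ennreal (real DIM('a) * V * r ^ (DIM('a) - 1)) * indicator {0..} r * (ennreal ((C / r ^ DIM('a))\<^sup>2) * indicator {\<rho>..} r) \<partial>lborel)"
      unfolding V_def by (rule nn_integral_radial) simp
    also have "\<dots> = (\<integral>\<^sup>+r. ennreal (C\<^sup>2 * V * real DIM('a) / r ^ (DIM('a) + 1)) * indicator {\<rho>..} r \<partial>lborel)"
    proof (intro nn_integral_cong)
      fix r :: real
      show "ennreal (real DIM('a) * V * r ^ (DIM('a) - 1)) * indicator {0..} r * (ennreal ((C / r ^ DIM('a))\<^sup>2) * indicator {\<rho>..} r)
        = ennreal (C\<^sup>2 * V * real DIM('a) / r ^ (DIM('a) + 1)) * indicator {\<rho>..} r"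
        using \<rho> V unfolding m
        by (auto split: split_indicator simp: ennreal_mult'[symmetric] ennreal_mult''[symmetric] power2_eq_square divide_simps
          intro!: arg_cong[where f=ennreal])
    qed
    also have "\<dots> = ennreal (0 - (- (C\<^sup>2 * V) / \<rho> ^ DIM('a)))"
    proof (rule nn_integral_FTC_atLeast)
      show "((\<lambda>r. - (C\<^sup>2 * V) / r ^ DIM('a)) \<longlongrightarrow> 0) at_top"
        by (intro tendsto_divide_0[OF tendsto_const] filterlim_at_top_imp_at_infinity filterlim_pow_at_top filterlim_ident) simp
      fix r assume "\<rho> \<le> r"
      then show "((\<lambda>r. - (C\<^sup>2 * V) / r ^ DIM('a)) has_real_derivative C\<^sup>2 * V * real DIM('a) / r ^ (DIM('a) + 1)) (at r)"
        using \<rho> unfolding m by (auto intro!: derivative_eq_intros simp: divide_simps power_Suc power2_eq_square) (cases m; simp add: algebra_simps)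
    qed (use \<rho> V in auto)
    finally show ?thesis by simp
  qed
  moreover have "C\<^sup>2 * V > 0" using C V by auto
  ultimately show ?thesis by blast
qed

lemma nn_integral_power_annulus:
  assumes c: "0 \<le> c" and r: "0 < \<rho>" "\<rho> \<le> \<delta>"
  shows "(\<integral>\<^sup>+(z::'a::euclidean_space). ennreal (c / norm z ^ DIM('a)) * indicator {\<rho>..<\<delta>} (norm z) \<partial>lborel)
    = ennreal (c * (real DIM('a) * unit_ball_vol (real DIM('a))) * ln (\<delta> / \<rho>))"
proof -
  define K where "K = real DIM('a) * unit_ball_vol (real DIM('a))"
  have K: "K > 0" unfolding K_def by (simp)
  obtain m where m: "DIM('a) = Suc m" using DIM_positive[where 'a='a] gr0_implies_Suc by blast
  have "ennreal (c * K * ln (\<delta> / \<rho>)) = ennreal (c * K * ln \<delta> - c * K * ln \<rho>)"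
    using r by (simp add: ln_div algebra_simps)
  also have "\<dots> = (\<integral>\<^sup>+r. ennreal (c * K / r) * indicator {\<rho>..\<delta>} r \<partial>lborel)"
    using r c K by (intro nn_integral_FTC_Icc[symmetric]) (auto intro!: derivative_eq_intros)
  also have "\<dots> = (\<integral>\<^sup>+r. ennreal (K * r ^ (DIM('a) - 1)) * indicator {0..} r * (ennreal (c / r ^ DIM('a)) * indicator {\<rho>..<\<delta>} r) \<partial>lborel)"
  proof (rule nn_integral_cong_AE, rule AE_mp[OF AE_lborel_singleton[of \<delta>]], rule AE_I2, rule impI)
    fix r :: real assume "r \<noteq> \<delta>"
    then show "ennreal (c * K / r) * indicator {\<rho>..\<delta>} r = ennreal (K * r ^ (DIM('a) - 1)) * indicator {0..} r * (ennreal (c / r ^ DIM('a)) * indicator {\<rho>..<\<delta>} r)"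
      using r(1) K c unfolding m by (auto split: split_indicator simp: ennreal_mult'[symmetric] ennreal_mult''[symmetric] mult.commute)
  qed
  also have "\<dots> = (\<integral>\<^sup>+(z::'a). ennreal (c / norm z ^ DIM('a)) * indicator {\<rho>..<\<delta>} (norm z) \<partial>lborel)"
    unfolding K_def by (rule nn_integral_radial[symmetric]) simp
  finally show ?thesis unfolding K_def by simp
qed

lemma nn_integral_J_annulus:
  assumes c: "0 \<le> c" and d: "\<And>z::'a::euclidean_space. 0 < norm z \<and> norm z < \<delta> \<longrightarrow> c / norm z ^ DIM('a) \<le> J_kernel z"
    and r: "0 < \<rho>" "\<rho> \<le> \<delta>"
  shows "ennreal (c * (real DIM('a) * unit_ball_vol (real DIM('a))) * ln (\<delta> / \<rho>))
    \<le> (\<integral>\<^sup>+z. ennreal (J_kernel z) * indicator {z. \<rho> \<le> norm z \<and> norm z < \<delta>} z \<partial>(lborel :: 'a measure))"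
  unfolding nn_integral_power_annulus[OF c r, where 'a='a, symmetric]
proof (intro nn_integral_mono)
  fix z :: 'a
  have "c / norm z ^ DIM('a) \<le> J_kernel z" if "\<rho> \<le> norm z" "norm z < \<delta>"
    using d[of z] r(1) that by linarith
  then show "ennreal (c / norm z ^ DIM('a)) * indicator {\<rho>..<\<delta>} (norm z) \<le> ennreal (J_kernel z) * indicator {z. \<rho> \<le> norm z \<and> norm z < \<delta>} z"
    by (auto split: split_indicator intro!: ennreal_leI)
qed

section \<open>The logarithmic Sobolev inequality\<close>

lemma nn_integral_pair:
  fixes f :: "'a::euclidean_space \<times> 'b::euclidean_space \<Rightarrow> ennreal"
  assumes "f \<in> borel_measurable (lborel \<Otimes>\<^sub>M lborel)"
  shows "(\<integral>\<^sup>+z. f z \<partial>(lborel \<Otimes>\<^sub>M lborel)) = (\<integral>\<^sup>+x. \<integral>\<^sup>+y. f (x, y) \<partial>lborel \<partial>lborel)"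
  using lborel.nn_integral_fst[OF assms] by simp

lemma nn_integral_pair_swap:
  fixes f :: "'a::euclidean_space \<times> 'a \<Rightarrow> ennreal"
  assumes [measurable]: "f \<in> borel_measurable (lborel \<Otimes>\<^sub>M lborel)"
  shows "(\<integral>\<^sup>+z. f (snd z, fst z) \<partial>(lborel \<Otimes>\<^sub>M lborel)) = (\<integral>\<^sup>+z. f z \<partial>(lborel \<Otimes>\<^sub>M lborel))"
proof -
  have "(\<integral>\<^sup>+z. f (snd z, fst z) \<partial>(lborel \<Otimes>\<^sub>M lborel)) = (\<integral>\<^sup>+x. \<integral>\<^sup>+y. f (y, x) \<partial>lborel \<partial>lborel)"
    by (subst nn_integral_pair) auto
  also have "\<dots> = (\<integral>\<^sup>+y. \<integral>\<^sup>+x. f (y, x) \<partial>lborel \<partial>lborel)"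
    by (rule lborel_pair.Fubini') simp
  also have "\<dots> = (\<integral>\<^sup>+z. f z \<partial>(lborel \<Otimes>\<^sub>M lborel))"
    by (subst nn_integral_pair) auto
  finally show ?thesis .
qed

lemma nn_integral_lborel_reflect:
  fixes f :: "'a::euclidean_space \<Rightarrow> ennreal"
  assumes [measurable]: "f \<in> borel_measurable borel"
  shows "(\<integral>\<^sup>+y. f (x - y) \<partial>lborel) = (\<integral>\<^sup>+z. f z \<partial>lborel)"
proof -
  have "lborel = distr lborel borel (\<lambda>y. x + (-1) *\<^sub>R y)"
    using lborel_affine[of "-1" x] by (simp add: density_1)
  then have "(\<integral>\<^sup>+z. f z \<partial>lborel) = (\<integral>\<^sup>+z. f z \<partial>(distr lborel borel (\<lambda>y. x + (-1) *\<^sub>R y)))"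
    by metis
  also have "\<dots> = (\<integral>\<^sup>+y. f (x + (-1) *\<^sub>R y) \<partial>lborel)" by (subst nn_integral_distr) auto
  finally show ?thesis by simp
qed

text \<open>The energy, without the factor one half and with values in \<open>[0, \<infinity>]\<close>, of the pairs whose
difference lies in \<open>D\<close>. Taking \<open>D\<close> to be a ball around \<open>0\<close> or its complement separates close from
distant pairs.\<close>

definition energy_on :: "'a::euclidean_space set \<Rightarrow> ('a \<Rightarrow> real) \<Rightarrow> ennreal" where
  "energy_on D u = (\<integral>\<^sup>+z. ennreal ((u (fst z) - u (snd z))\<^sup>2 * J_kernel (fst z - snd z)) * indicator D (fst z - snd z) \<partial>(lborel \<Otimes>\<^sub>M lborel))"

lemma energy_integrand_measurable [measurable]:
  fixes u :: "'a::euclidean_space \<Rightarrow> real"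
  assumes [measurable]: "u \<in> borel_measurable borel" and D: "D \<in> sets borel"
  shows "(\<lambda>z. ennreal ((u (fst z) - u (snd z))\<^sup>2 * J_kernel (fst z - snd z)) * indicator D (fst z - snd z)) \<in> borel_measurable (lborel \<Otimes>\<^sub>M lborel)"
proof -
  have [measurable]: "(\<lambda>z. indicator D (fst z - snd z) :: ennreal) \<in> borel_measurable (lborel \<Otimes>\<^sub>M lborel)"
    by (rule measurable_compose[OF _ borel_measurable_indicator[OF D]]) measurable
  show ?thesis by measurable
qed

text \<open>Expanding the square, \<open>(a - b)\<^sup>2 = a\<^sup>2 + b\<^sup>2 - 2 a b\<close>, on the pairs with \<open>|u(x)| > \<Lambda>\<close> and
\<open>\<rho> \<le> |x - y| < d\<close>, where \<open>\<rho> = |u(x)| powr (- 2 / N)\<close>, the diagonal terms give \<open>\<integral> u\<^sup>2 M(\<rho>)\<close> with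
\<open>M(\<rho>) = \<integral> J\<close> over \<open>\<rho> \<le> |z| < d\<close>. By the kernel asymptotics, \<open>M(\<rho>)\<close> is at least \<open>c' ln (d / \<rho>)\<close> for any
\<open>c' < 2\<close>, which is \<open>(c' / N) ln u\<^sup>2\<close> up to a constant. The mixed terms are only of size \<open>\<integral> u\<^sup>2\<close>: by
\<open>2 a b J \<le> a\<^sup>2 b\<^sup>2 + J\<^sup>2\<close> and \<open>\<integral> J\<^sup>2 \<le> C / \<rho> ^ N = C u(x)\<^sup>2\<close> over \<open>|z| \<ge> \<rho>\<close>. For large \<open>\<Lambda>\<close> the logarithm
beats this constant.\<close>

theorem log_sobolev:
  assumes k: "0 < \<kappa>" "\<kappa> < 4 / real DIM('a)" and \<delta>: "\<delta> > 0" and S: "S \<ge> 0"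
  shows "\<exists>\<Lambda>\<ge>1. \<forall>u \<in> borel_measurable borel. (\<integral>\<^sup>+(x::'a::euclidean_space). ennreal ((u x)\<^sup>2) \<partial>lborel) \<le> ennreal S \<longrightarrow>
     (\<integral>\<^sup>+x. ennreal (\<kappa> * ((u x)\<^sup>2 * max 0 (ln ((u x)\<^sup>2 / \<Lambda>\<^sup>2)))) \<partial>lborel) \<le> energy_on (ball 0 \<delta>) u"
proof -
  define n where "n = real DIM('a)"
  have n: "n > 0" by (simp add: n_def)
  define K where "K = n * unit_ball_vol n"
  have K: "K > 0" unfolding K_def using n by simp
  obtain c' where c': "n * \<kappa> / 2 < c'" "c' < 2" using dense[of "n * \<kappa> / 2" 2] k n by (auto simp: n_def field_simps)
  have c'0: "c' > 0" using c' k n by (smt (verit) divide_nonneg_nonneg mult_nonneg_nonneg)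
  define c where "c = c' / K"
  have c: "c > 0" "c < 2 / K" "c * K = c'" using c' c'0 K by (auto simp: c_def field_simps)
  obtain d0 where d0: "d0 > 0" "\<And>z::'a. 0 < norm z \<and> norm z < d0 \<longrightarrow> c / norm z ^ DIM('a) \<le> J_kernel z"
    using J_kernel_lower[of c] c unfolding K_def n_def by auto
  define d where "d = min d0 \<delta>"
  have d: "d > 0" "d \<le> \<delta>" "\<And>z::'a. 0 < norm z \<and> norm z < d \<longrightarrow> c / norm z ^ DIM('a) \<le> J_kernel z"
    using d0 \<delta> by (auto simp: d_def)
  obtain C where C: "C > 0" "\<And>\<rho>. \<rho> > 0 \<Longrightarrow> (\<integral>\<^sup>+z. ennreal ((J_kernel z)\<^sup>2) * indicator {z. \<rho> \<le> norm z} z \<partial>(lborel :: 'a measure)) \<le> ennreal (C / \<rho> ^ DIM('a))"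
    using nn_integral_J_square by blast
  \<comment> \<open>The constant in front of \<open>\<integral> u\<^sup>2\<close> in the bound for the mixed terms.\<close>
  define A where "A = S + C"
  have A: "A > 0" using S C(1) by (simp add: A_def)
  \<comment> \<open>The surplus in the coefficient of the logarithm; it is what pays for \<open>A\<close> once \<open>\<Lambda>\<close> is large.\<close>
  define q where "q = c' / n - \<kappa> / 2"
  have q: "q > 0" using c' n by (simp add: q_def field_simps)
  define L where "L = max 1 (max (d powr (- n / 2)) (exp ((A - c' * ln d) / (2 * q))))"
  have L1: "L \<ge> 1" by (simp add: L_def)
  define \<rho> where "\<rho> a = a powr (- 2 / n)" for a :: real
  have \<rho>: "0 < \<rho> a" "\<rho> a \<le> d" "\<rho> a ^ DIM('a) = 1 / a\<^sup>2" "A + \<kappa> / 2 * ln (a\<^sup>2) \<le> c' * ln (d / \<rho> a)" if "a > L" for a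
  proof -
    have a: "a > 1" "a > d powr (- n / 2)" "a > exp ((A - c' * ln d) / (2 * q))" using that by (auto simp: L_def)
    show "0 < \<rho> a" using a by (simp add: \<rho>_def)
    have "\<rho> a \<le> (d powr (- n / 2)) powr (- 2 / n)" unfolding \<rho>_def
      using a n d by (intro powr_mono2') auto
    then show "\<rho> a \<le> d" using n d by (simp add: powr_powr)
    have "\<rho> a ^ DIM('a) = \<rho> a powr n" using \<open>0 < \<rho> a\<close> by (simp add: n_def powr_realpow)
    also have "\<dots> = a powr (- 2)" unfolding \<rho>_def powr_powr using n by simp
    finally show "\<rho> a ^ DIM('a) = 1 / a\<^sup>2" using a by (simp add: powr_minus powr_numeral field_simps)
    have l2: "ln (a\<^sup>2) = 2 * ln a" using a by (simp add: ln_realpow)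
    have "ln (d / \<rho> a) = ln d + 2 / n * ln a" using a d by (simp add: ln_div \<rho>_def ln_powr)
    then have e: "c' * ln (d / \<rho> a) = c' * ln d + (2 * q + \<kappa>) * ln a" using n by (simp add: q_def algebra_simps)
    have "(A - c' * ln d) / (2 * q) \<le> ln a" using a by (subst ln_ge_iff) auto
    then have "A - c' * ln d \<le> 2 * q * ln a" using q by (simp add: field_simps)
    then show "A + \<kappa> / 2 * ln (a\<^sup>2) \<le> c' * ln (d / \<rho> a)" unfolding e l2 by (simp add: algebra_simps)
  qed
  show ?thesis
  proof (intro exI[of _ L] conjI ballI impI L1)
    fix u :: "'a \<Rightarrow> real" assume u[measurable]: "u \<in> borel_measurable borel" and uS: "(\<integral>\<^sup>+x. ennreal ((u x)\<^sup>2) \<partial>lborel) \<le> ennreal S"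
    define G where "G x y \<longleftrightarrow> \<bar>u x\<bar> > L \<and> \<rho> \<bar>u x\<bar> \<le> norm (x - y) \<and> norm (x - y) < d" for x y
    let ?P = "lborel \<Otimes>\<^sub>M lborel :: ('a \<times> 'a) measure"
    have Gm[measurable]: "Measurable.pred ?P (\<lambda>z. G (fst z) (snd z))" "Measurable.pred ?P (\<lambda>z. G (snd z) (fst z))"
      unfolding G_def \<rho>_def by measurable
    have Gm2[measurable]: "Measurable.pred lborel (\<lambda>y. G x y)" for x
      unfolding G_def by measurable
    define T where "T = (\<integral>\<^sup>+x. ennreal ((u x)\<^sup>2) * indicator {x. \<bar>u x\<bar> > L} x \<partial>lborel)"
    define W where "W = (\<integral>\<^sup>+x. ennreal ((u x)\<^sup>2 * (\<kappa> * ln ((u x)\<^sup>2))) * indicator {x. \<bar>u x\<bar> > L} x \<partial>lborel)"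
    define R where "R z = (if G (fst z) (snd z) then ennreal ((u (fst z))\<^sup>2 * J_kernel (fst z - snd z)) else 0)" for z
    define Q where "Q z = (if G (fst z) (snd z) then ennreal (\<bar>u (fst z)\<bar> * \<bar>u (snd z)\<bar> * J_kernel (fst z - snd z)) else 0)" for z
    have [measurable]: "R \<in> borel_measurable ?P" "Q \<in> borel_measurable ?P"
      unfolding R_def Q_def by measurable
    have [measurable]: "(\<lambda>z. R (snd z, fst z)) \<in> borel_measurable ?P" "(\<lambda>z. Q (snd z, fst z)) \<in> borel_measurable ?P"
      by measurable
    have [measurable]: "{x. \<bar>u x\<bar> > L} \<in> sets lborel" by measurable
    have Tfin: "T < \<infinity>"
    proof -
      have "T \<le> (\<integral>\<^sup>+x. ennreal ((u x)\<^sup>2) \<partial>lborel)" unfolding T_def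
        by (intro nn_integral_mono) (auto split: split_indicator)
      then show ?thesis using uS by (auto simp: less_top[symmetric] top_unique)
    qed
    \<comment> \<open>On the pairs where one of the two indicators is nonzero, \<open>a\<^sup>2 + b\<^sup>2 \<le> (a - b)\<^sup>2 + 2 |a b|\<close>.\<close>
    have pt: "R z + R (snd z, fst z) \<le> ennreal ((u (fst z) - u (snd z))\<^sup>2 * J_kernel (fst z - snd z)) * indicator (ball 0 \<delta>) (fst z - snd z)
       + (2 * Q z + 2 * Q (snd z, fst z))" for z
    proof -
      let ?a = "u (fst z)" and ?b = "u (snd z)" and ?J = "J_kernel (fst z - snd z)"
      have J: "J_kernel (snd z - fst z) = ?J" by (rule J_kernel_sym)
      show ?thesis
      proof (cases "G (fst z) (snd z) \<or> G (snd z) (fst z)")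
        case True
        then have "fst z - snd z \<in> ball 0 \<delta>" using d by (auto simp: G_def norm_minus_commute)
        then have i: "indicator (ball 0 \<delta>) (fst z - snd z) = (1::ennreal)" by simp
        have "?a\<^sup>2 + ?b\<^sup>2 \<le> (?a - ?b)\<^sup>2 + 2 * (\<bar>?a\<bar> * \<bar>?b\<bar>)"
          using abs_ge_self[of "?a * ?b"] by (simp add: power2_diff abs_mult)
        then have 0: "?a\<^sup>2 * ?J + ?b\<^sup>2 * ?J \<le> (?a - ?b)\<^sup>2 * ?J + 2 * (\<bar>?a\<bar> * \<bar>?b\<bar> * ?J)"
          using mult_right_mono[of "?a\<^sup>2 + ?b\<^sup>2" "(?a - ?b)\<^sup>2 + 2 * (\<bar>?a\<bar> * \<bar>?b\<bar>)" ?J] by (simp add: algebra_simps)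
        have "R z + R (snd z, fst z) \<le> ennreal (?a\<^sup>2 * ?J) + ennreal (?b\<^sup>2 * ?J)"
          unfolding R_def by (intro add_mono) (auto simp: J)
        also have "\<dots> \<le> ennreal ((?a - ?b)\<^sup>2 * ?J + 2 * (\<bar>?a\<bar> * \<bar>?b\<bar> * ?J))"
          using 0 by (subst ennreal_plus[symmetric]) (auto intro!: ennreal_leI simp del: ennreal_plus)
        also have "\<dots> = ennreal ((?a - ?b)\<^sup>2 * ?J) + 2 * ennreal (\<bar>?a\<bar> * \<bar>?b\<bar> * ?J)"
          by (subst ennreal_plus) (auto simp: ennreal_mult)
        also have "\<dots> \<le> ennreal ((?a - ?b)\<^sup>2 * ?J) + (2 * Q z + 2 * Q (snd z, fst z))"
          using True unfolding Q_def by (intro add_left_mono) (auto simp: J mult.commute mult.left_commute)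
        finally show ?thesis unfolding i by simp
      qed (auto simp: R_def)
    qed
    \<comment> \<open>The diagonal term, integrated in \<open>y\<close> first: this is where the logarithm appears.\<close>
    have R1: "(\<integral>\<^sup>+z. R z \<partial>?P) \<ge> ennreal A * T + W * ennreal (1/2)"
    proof -
      have "(\<integral>\<^sup>+z. R z \<partial>?P) = (\<integral>\<^sup>+x. \<integral>\<^sup>+y. R (x, y) \<partial>lborel \<partial>lborel)" by (rule nn_integral_pair) simp
      also have "\<dots> \<ge> (\<integral>\<^sup>+x. ennreal ((u x)\<^sup>2 * (A + \<kappa> / 2 * ln ((u x)\<^sup>2))) * indicator {x. \<bar>u x\<bar> > L} x \<partial>lborel)"
      proof (intro nn_integral_mono)
        fix x :: 'a
        show "ennreal ((u x)\<^sup>2 * (A + \<kappa> / 2 * ln ((u x)\<^sup>2))) * indicator {x. \<bar>u x\<bar> > L} x \<le> (\<integral>\<^sup>+y. R (x, y) \<partial>lborel)"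
        proof (cases "\<bar>u x\<bar> > L")
          case True
          let ?r = "\<rho> \<bar>u x\<bar>"
          note r = \<rho>[OF True]
          have "ennreal ((u x)\<^sup>2 * (A + \<kappa> / 2 * ln ((u x)\<^sup>2))) \<le> ennreal ((u x)\<^sup>2 * (c' * ln (d / ?r)))"
            using r(4) by (intro ennreal_leI mult_left_mono) auto
          also have "\<dots> = ennreal ((u x)\<^sup>2) * ennreal (c' * ln (d / ?r))" by (simp add: ennreal_mult')
          also have "\<dots> \<le> ennreal ((u x)\<^sup>2) * (\<integral>\<^sup>+z. ennreal (J_kernel z) * indicator {z. ?r \<le> norm z \<and> norm z < d} z \<partial>(lborel :: 'a measure))"
            using nn_integral_J_annulus[of c d ?r, where 'a='a] c d r unfolding K_def[symmetric] n_def[symmetric]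
            by (intro mult_left_mono) auto
          also have "\<dots> = ennreal ((u x)\<^sup>2) * (\<integral>\<^sup>+y. ennreal (J_kernel (x - y)) * indicator {z. ?r \<le> norm z \<and> norm z < d} (x - y) \<partial>lborel)"
            by (subst nn_integral_lborel_reflect) auto
          also have "\<dots> = (\<integral>\<^sup>+y. ennreal ((u x)\<^sup>2) * (ennreal (J_kernel (x - y)) * indicator {z. ?r \<le> norm z \<and> norm z < d} (x - y)) \<partial>lborel)"
            by (subst nn_integral_cmult) auto
          also have "\<dots> = (\<integral>\<^sup>+y. R (x, y) \<partial>lborel)"
            using True by (intro nn_integral_cong) (auto simp: R_def G_def ennreal_mult split: split_indicator)
          finally show ?thesis using True by simp
        qed simp
      qed
      also have "(\<integral>\<^sup>+x. ennreal ((u x)\<^sup>2 * (A + \<kappa> / 2 * ln ((u x)\<^sup>2))) * indicator {x. \<bar>u x\<bar> > L} x \<partial>lborel)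
         = (\<integral>\<^sup>+x. ennreal A * (ennreal ((u x)\<^sup>2) * indicator {x. \<bar>u x\<bar> > L} x) + ennreal ((u x)\<^sup>2 * (\<kappa> * ln ((u x)\<^sup>2))) * indicator {x. \<bar>u x\<bar> > L} x * ennreal (1/2) \<partial>lborel)"
      proof (intro nn_integral_cong)
        fix x
        show "ennreal ((u x)\<^sup>2 * (A + \<kappa> / 2 * ln ((u x)\<^sup>2))) * indicator {x. \<bar>u x\<bar> > L} x =
          ennreal A * (ennreal ((u x)\<^sup>2) * indicator {x. \<bar>u x\<bar> > L} x) + ennreal ((u x)\<^sup>2 * (\<kappa> * ln ((u x)\<^sup>2))) * indicator {x. \<bar>u x\<bar> > L} x * ennreal (1/2)"
        proof (cases "\<bar>u x\<bar> > L")
          case True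
          then have "1 \<le> (u x)\<^sup>2" using L1 by (intro abs_le_square_iff[of 1, simplified, THEN iffD1]) auto
          then have "ln ((u x)\<^sup>2) \<ge> 0" by simp
          then show ?thesis using True A k
            by (simp add: ennreal_mult'[symmetric] ennreal_mult''[symmetric] ennreal_plus[symmetric] algebra_simps del: ennreal_plus ennreal_half)
        qed simp
      qed
      also have "\<dots> = ennreal A * T + W * ennreal (1/2)"
        unfolding T_def W_def by (subst nn_integral_add) (auto simp: nn_integral_cmult nn_integral_multc simp del: ennreal_half)
finally show ?thesis .
    qed
    \<comment> \<open>The mixed term: \<open>\<rho>\<close> is chosen such that \<open>\<integral> J\<^sup>2\<close> over \<open>|z| \<ge> \<rho>\<close> is at most \<open>C u(x)\<^sup>2\<close>.\<close>
    have Q1: "2 * (\<integral>\<^sup>+z. Q z \<partial>?P) \<le> ennreal A * T"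
    proof -
      have "2 * (\<integral>\<^sup>+z. Q z \<partial>?P) = (\<integral>\<^sup>+z. 2 * Q z \<partial>?P)" by (subst nn_integral_cmult) auto
      also have "\<dots> = (\<integral>\<^sup>+x. \<integral>\<^sup>+y. 2 * Q (x, y) \<partial>lborel \<partial>lborel)" by (rule nn_integral_pair) simp
      also have "\<dots> \<le> (\<integral>\<^sup>+x. ennreal A * (ennreal ((u x)\<^sup>2) * indicator {x. \<bar>u x\<bar> > L} x) \<partial>lborel)"
      proof (intro nn_integral_mono)
        fix x :: 'a
        show "(\<integral>\<^sup>+y. 2 * Q (x, y) \<partial>lborel) \<le> ennreal A * (ennreal ((u x)\<^sup>2) * indicator {x. \<bar>u x\<bar> > L} x)"
        proof (cases "\<bar>u x\<bar> > L")
          case True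
          let ?r = "\<rho> \<bar>u x\<bar>"
          note r = \<rho>[OF True]
          have "(\<integral>\<^sup>+y. 2 * Q (x, y) \<partial>lborel) \<le> (\<integral>\<^sup>+y. ennreal ((u x)\<^sup>2) * ennreal ((u y)\<^sup>2) + ennreal ((J_kernel (x - y))\<^sup>2) * indicator {z. ?r \<le> norm z} (x - y) \<partial>lborel)"
          proof (intro nn_integral_mono)
            fix y :: 'a
            show "2 * Q (x, y) \<le> ennreal ((u x)\<^sup>2) * ennreal ((u y)\<^sup>2) + ennreal ((J_kernel (x - y))\<^sup>2) * indicator {z. ?r \<le> norm z} (x - y)"
            proof (cases "G x y")
              case True
              have "2 * (\<bar>u x\<bar> * \<bar>u y\<bar> * J_kernel (x - y)) \<le> (\<bar>u x\<bar> * \<bar>u y\<bar>)\<^sup>2 + (J_kernel (x - y))\<^sup>2"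
                using sum_squares_bound[of "\<bar>u x\<bar> * \<bar>u y\<bar>" "J_kernel (x - y)"] by (simp add: mult.assoc)
              then have "ennreal (2 * (\<bar>u x\<bar> * \<bar>u y\<bar> * J_kernel (x - y))) \<le> ennreal ((u x)\<^sup>2 * (u y)\<^sup>2 + (J_kernel (x - y))\<^sup>2)"
                by (intro ennreal_leI) (simp add: power_mult_distrib)
              then show ?thesis using True by (auto simp: Q_def G_def ennreal_mult)
            qed (simp add: Q_def)
          qed
          also have "\<dots> = ennreal ((u x)\<^sup>2) * (\<integral>\<^sup>+y. ennreal ((u y)\<^sup>2) \<partial>lborel) + (\<integral>\<^sup>+y. ennreal ((J_kernel (x - y))\<^sup>2) * indicator {z. ?r \<le> norm z} (x - y) \<partial>lborel)"
            by (subst nn_integral_add) (auto simp: nn_integral_cmult)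
          also have "(\<integral>\<^sup>+y. ennreal ((J_kernel (x - y))\<^sup>2) * indicator {z. ?r \<le> norm z} (x - y) \<partial>lborel) = (\<integral>\<^sup>+z. ennreal ((J_kernel z)\<^sup>2) * indicator {z. ?r \<le> norm z} z \<partial>(lborel :: 'a measure))"
            by (subst nn_integral_lborel_reflect) auto
          also have "ennreal ((u x)\<^sup>2) * (\<integral>\<^sup>+y. ennreal ((u y)\<^sup>2) \<partial>lborel) + \<dots> \<le> ennreal ((u x)\<^sup>2) * ennreal S + ennreal (C / ?r ^ DIM('a))"
            using r by (intro add_mono mult_left_mono uS C) auto
          also have "\<dots> = ennreal A * ennreal ((u x)\<^sup>2)"
            unfolding r(3) A_def using S C(1)
            by (simp add: ennreal_mult'[symmetric] ennreal_plus[symmetric] algebra_simps del: ennreal_plus)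
          finally show ?thesis using True by simp
        qed (simp add: Q_def G_def)
      qed
      also have "\<dots> = ennreal A * T" unfolding T_def by (subst nn_integral_cmult) auto
      finally show ?thesis .
    qed
    have R2: "(\<integral>\<^sup>+z. R (snd z, fst z) \<partial>?P) = (\<integral>\<^sup>+z. R z \<partial>?P)" and Q2: "(\<integral>\<^sup>+z. Q (snd z, fst z) \<partial>?P) = (\<integral>\<^sup>+z. Q z \<partial>?P)"
      by (auto intro!: nn_integral_pair_swap)
    have [measurable]: "(\<lambda>z. ennreal ((u (fst z) - u (snd z))\<^sup>2 * J_kernel (fst z - snd z)) * indicator (ball 0 \<delta>) (fst z - snd z)) \<in> borel_measurable ?P"
      by (intro energy_integrand_measurable) auto
    have "2 * (ennreal A * T) + W = (ennreal A * T + W * ennreal (1/2)) + (ennreal A * T + W * ennreal (1/2))"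
    proof -
      have "W * ennreal (1/2) + W * ennreal (1/2) = W * (ennreal (1/2) + ennreal (1/2))" by (simp only: distrib_left)
      also have "ennreal (1/2) + ennreal (1/2) = 1" by (subst ennreal_plus[symmetric]) auto
      finally have "W * ennreal (1/2) + W * ennreal (1/2) = W" by simp
      then show ?thesis by (metis (no_types, lifting) add.assoc add.left_commute mult_2)
    qed
    also have "\<dots> \<le> (\<integral>\<^sup>+z. R z \<partial>?P) + (\<integral>\<^sup>+z. R z \<partial>?P)" using R1 by (intro add_mono) auto
    also have "\<dots> = (\<integral>\<^sup>+z. R z + R (snd z, fst z) \<partial>?P)"
      by (subst nn_integral_add) (auto simp: R2)
    also have "\<dots> \<le> (\<integral>\<^sup>+z. ennreal ((u (fst z) - u (snd z))\<^sup>2 * J_kernel (fst z - snd z)) * indicator (ball 0 \<delta>) (fst z - snd z)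
       + (2 * Q z + 2 * Q (snd z, fst z)) \<partial>?P)" using pt by (intro nn_integral_mono) auto
    also have "\<dots> = energy_on (ball 0 \<delta>) u + (2 * (\<integral>\<^sup>+z. Q z \<partial>?P) + 2 * (\<integral>\<^sup>+z. Q z \<partial>?P))"
      unfolding energy_on_def by (subst nn_integral_add, simp, simp, subst nn_integral_add) (auto simp: nn_integral_cmult Q2)
    also have "\<dots> \<le> energy_on (ball 0 \<delta>) u + (ennreal A * T + ennreal A * T)"
      using Q1 by (intro add_left_mono add_mono) auto
    finally have "2 * (ennreal A * T) + W \<le> 2 * (ennreal A * T) + energy_on (ball 0 \<delta>) u"
      by (simp add: add.commute mult_2)
    \<comment> \<open>The term \<open>2 A T\<close> is finite and can be cancelled.\<close>
    then have W: "W \<le> energy_on (ball 0 \<delta>) u"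
      using Tfin by (subst (asm) ennreal_add_left_cancel_le) (auto simp: ennreal_mult_eq_top_iff)
    have "(\<integral>\<^sup>+x. ennreal (\<kappa> * ((u x)\<^sup>2 * max 0 (ln ((u x)\<^sup>2 / L\<^sup>2)))) \<partial>lborel) \<le> W"
      unfolding W_def
    proof (intro nn_integral_mono)
      fix x
      show "ennreal (\<kappa> * ((u x)\<^sup>2 * max 0 (ln ((u x)\<^sup>2 / L\<^sup>2)))) \<le> ennreal ((u x)\<^sup>2 * (\<kappa> * ln ((u x)\<^sup>2))) * indicator {x. \<bar>u x\<bar> > L} x"
      proof (cases "\<bar>u x\<bar> > L")
        case True
        then have ux: "u x \<noteq> 0" "\<bar>u x\<bar> \<ge> 1" using L1 by auto
        have l: "ln ((u x)\<^sup>2 / L\<^sup>2) = ln ((u x)\<^sup>2) - ln (L\<^sup>2)" using L1 ux by (subst ln_div) auto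
        have "1 \<le> (u x)\<^sup>2" using ux by (intro abs_le_square_iff[of 1, simplified, THEN iffD1]) auto
        then have "max 0 (ln ((u x)\<^sup>2 / L\<^sup>2)) \<le> ln ((u x)\<^sup>2)" unfolding l using L1 by (auto intro!: ln_ge_zero)
        then have "\<kappa> * ((u x)\<^sup>2 * max 0 (ln ((u x)\<^sup>2 / L\<^sup>2))) \<le> \<kappa> * ((u x)\<^sup>2 * ln ((u x)\<^sup>2))"
          using k by (intro mult_left_mono) auto
        then show ?thesis using True by (auto intro!: ennreal_leI simp: mult.left_commute)
      next
        case False
        then have "(u x)\<^sup>2 \<le> L\<^sup>2" using L1 by (intro abs_le_square_iff[THEN iffD1]) auto
        then have "ln ((u x)\<^sup>2 / L\<^sup>2) \<le> 0" using L1
          by (cases "u x = 0") (auto intro!: ln_le_zero_iff[THEN iffD2] divide_pos_pos)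
        then show ?thesis by (simp add: max_def)
      qed
    qed
    with W show "(\<integral>\<^sup>+x. ennreal (\<kappa> * ((u x)\<^sup>2 * max 0 (ln ((u x)\<^sup>2 / L\<^sup>2)))) \<partial>lborel) \<le> energy_on (ball 0 \<delta>) u" by simp
  qed
qed

section \<open>Compactness in \<open>L\<^sup>2\<close>\<close>

lemma nn_integral_square_add_le:
  fixes f g :: "'a \<Rightarrow> real"
  assumes [measurable]: "f \<in> borel_measurable M" "g \<in> borel_measurable M"
  shows "(\<integral>\<^sup>+x. ennreal ((f x + g x)\<^sup>2) \<partial>M) \<le> 2 * (\<integral>\<^sup>+x. ennreal ((f x)\<^sup>2) \<partial>M) + 2 * (\<integral>\<^sup>+x. ennreal ((g x)\<^sup>2) \<partial>M)"
proof -
  have "(\<integral>\<^sup>+x. ennreal ((f x + g x)\<^sup>2) \<partial>M) \<le> (\<integral>\<^sup>+x. 2 * ennreal ((f x)\<^sup>2) + 2 * ennreal ((g x)\<^sup>2) \<partial>M)"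
  proof (rule nn_integral_mono)
    fix x
    have "(f x + g x)\<^sup>2 \<le> 2 * (f x)\<^sup>2 + 2 * (g x)\<^sup>2"
      using sum_squares_bound[of "f x" "g x"] by (simp add: power2_sum)
    then have "ennreal ((f x + g x)\<^sup>2) \<le> ennreal (2 * (f x)\<^sup>2 + 2 * (g x)\<^sup>2)" by (rule ennreal_leI)
    then show "ennreal ((f x + g x)\<^sup>2) \<le> 2 * ennreal ((f x)\<^sup>2) + 2 * ennreal ((g x)\<^sup>2)"
      by (simp add: ennreal_mult)
  qed
  also have "\<dots> = 2 * (\<integral>\<^sup>+x. ennreal ((f x)\<^sup>2) \<partial>M) + 2 * (\<integral>\<^sup>+x. ennreal ((g x)\<^sup>2) \<partial>M)"
    by (subst nn_integral_add) (auto simp: nn_integral_cmult)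
  finally show ?thesis .
qed

text \<open>The Riesz-Fischer argument: along a fast subsequence the increments are almost everywhere
summable, and Fatou's lemma identifies the pointwise limit as the \<open>L\<^sup>2\<close> limit of the whole sequence.\<close>

lemma L2_Cauchy_limit:
  fixes u :: "nat \<Rightarrow> 'a \<Rightarrow> real"
  assumes [measurable]: "\<And>n. u n \<in> borel_measurable M"
    and cau: "\<And>e. e > 0 \<Longrightarrow> \<exists>N. \<forall>i\<ge>N. \<forall>j\<ge>N. (\<integral>\<^sup>+x. ennreal ((u i x - u j x)\<^sup>2) \<partial>M) \<le> ennreal e"
  shows "\<exists>r v. strict_mono r \<and> v \<in> borel_measurable M \<and> (AE x in M. (\<lambda>n. u (r n) x) \<longlonglongrightarrow> v x) \<and>
     (\<lambda>n. \<integral>\<^sup>+x. ennreal ((u n x - v x)\<^sup>2) \<partial>M) \<longlonglongrightarrow> 0"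
proof -
  \<comment> \<open>The rate \<open>16 ^ (- n)\<close> leaves room for the weight \<open>4 ^ n\<close>, which makes the increments of order \<open>2 ^ (- n)\<close>.\<close>
  have "\<exists>N. \<forall>n. (\<forall>i\<ge>N n. \<forall>j\<ge>N n. (\<integral>\<^sup>+x. ennreal ((u i x - u j x)\<^sup>2) \<partial>M) \<le> ennreal ((1/16)^n))"
    using cau by (intro choice allI) simp
  then obtain N where N: "\<And>n i j. i \<ge> N n \<Longrightarrow> j \<ge> N n \<Longrightarrow> (\<integral>\<^sup>+x. ennreal ((u i x - u j x)\<^sup>2) \<partial>M) \<le> ennreal ((1/16)^n)"
    by blast
  define r where "r = rec_nat (N 0) (\<lambda>n p. max (Suc p) (N (Suc n)))"
  have r1: "r (Suc n) > r n" for n by (simp add: r_def)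
  then have r: "strict_mono r" by (simp add: strict_mono_Suc_iff)
  have r2: "r n \<ge> N n" for n by (cases n) (auto simp: r_def)
  have r3: "r (Suc n) \<ge> N n" for n using r1[of n] r2[of n] by linarith
  define D where "D n x = u (r (Suc n)) x - u (r n) x" for n x
  have [measurable]: "D n \<in> borel_measurable M" for n unfolding D_def by measurable
  have "(\<integral>\<^sup>+x. (\<Sum>n. ennreal (4^n * (D n x)\<^sup>2)) \<partial>M) = (\<Sum>n. \<integral>\<^sup>+x. ennreal (4^n * (D n x)\<^sup>2) \<partial>M)"
    by (rule nn_integral_suminf) measurable
  also have "\<dots> \<le> (\<Sum>n. ennreal ((1/4)^n))"
  proof (intro suminf_le)
    fix n
    have "(\<integral>\<^sup>+x. ennreal (4^n * (D n x)\<^sup>2) \<partial>M) = ennreal (4^n) * (\<integral>\<^sup>+x. ennreal ((D n x)\<^sup>2) \<partial>M)"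
      by (subst nn_integral_cmult[symmetric]) (auto simp: ennreal_mult)
    also have "\<dots> \<le> ennreal (4^n) * ennreal ((1/16)^n)"
      unfolding D_def by (intro mult_left_mono N r2 r3) auto
    also have "\<dots> = ennreal ((1/4)^n)"
      by (subst ennreal_mult[symmetric]) (auto simp: power_mult_distrib[symmetric])
    finally show "(\<integral>\<^sup>+x. ennreal (4^n * (D n x)\<^sup>2) \<partial>M) \<le> ennreal ((1/4)^n)" .
  qed auto
  also have "\<dots> < \<infinity>"
  proof -
    have "(\<Sum>n. ennreal ((1/4)^n)) = ennreal (\<Sum>n. (1/4)^n)"
      by (intro suminf_ennreal2) (auto intro!: summable_geometric)
    then show ?thesis by simp
  qed
  finally have "AE x in M. (\<Sum>n. ennreal (4^n * (D n x)\<^sup>2)) \<noteq> \<infinity>"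
    by (intro nn_integral_noteq_infinite) auto
  then have ae: "AE x in M. convergent (\<lambda>n. u (r n) x)"
  proof eventually_elim
    case (elim x)
    define C where "C = enn2real (\<Sum>n. ennreal (4^n * (D n x)\<^sup>2))"
    have C: "C \<ge> 0" "(\<Sum>n. ennreal (4^n * (D n x)\<^sup>2)) = ennreal C"
      unfolding C_def using elim by (simp_all only: ennreal_enn2real enn2real_nonneg less_top infinity_ennreal_def)
    have "\<bar>D n x\<bar> \<le> sqrt C * (1/2)^n" for n
    proof -
      have "(\<Sum>i\<in>{n}. ennreal (4^i * (D i x)\<^sup>2)) \<le> (\<Sum>n. ennreal (4^n * (D n x)\<^sup>2))"
        by (rule sum_le_suminf) simp_all
      then have "ennreal (4^n * (D n x)\<^sup>2) \<le> ennreal C" by (simp only: C(2) sum.empty sum.insert finite.emptyI empty_iff add_0_right not_False_eq_True)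
      then have "4^n * (D n x)\<^sup>2 \<le> C" using C(1) by (simp only: ennreal_le_iff)
      moreover have "(1/4::real)^n * 4^n = 1" by (simp only: power_mult_distrib[symmetric]) simp
      ultimately have "(D n x)\<^sup>2 \<le> C * (1/4)^n"
        using mult_left_mono[of "4^n * (D n x)\<^sup>2" C "(1/4::real)^n"] by (simp only: mult.assoc[symmetric]) (simp add: mult.commute)
      also have "\<dots> = (sqrt C * (1/2)^n)\<^sup>2"
      proof -
        have "((1/2::real)^n)\<^sup>2 = ((1/2)\<^sup>2)^n" by (simp only: power_mult[symmetric] mult.commute)
        then have "((1/2::real)^n)\<^sup>2 = (1/4)^n" by (simp add: power2_eq_square)
        then show ?thesis using C by (simp only: power_mult_distrib real_sqrt_pow2)
      qed
      finally have "\<bar>D n x\<bar> \<le> \<bar>sqrt C * (1/2)^n\<bar>" by (simp only: abs_le_square_iff)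
      then show ?thesis using C by simp
    qed
    then have le: "norm (D n x) \<le> sqrt C * (1/2)^n" for n by simp
    have "summable (\<lambda>n. sqrt C * (1/2::real)^n)"
      by (intro summable_mult summable_geometric) simp
    then have "summable (\<lambda>n. D n x)"
      by (rule summable_comparison_test'[where N=0 and g="\<lambda>n. sqrt C * (1/2)^n"]) (rule le)
    then have "convergent (\<lambda>n. \<Sum>i<n. D i x)" by (simp add: summable_iff_convergent)
    also have "(\<lambda>n. \<Sum>i<n. D i x) = (\<lambda>n. u (r n) x - u (r 0) x)"
      unfolding D_def by (subst sum_lessThan_telescope) simp
    finally have "convergent (\<lambda>n. (u (r n) x - u (r 0) x) + u (r 0) x)"
      by (intro convergent_add convergent_const)
    then show ?case by simp
  qed
  define v where "v x = lim (\<lambda>n. u (r n) x)" for x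
  have [measurable]: "v \<in> borel_measurable M" unfolding v_def by measurable
  have lim: "AE x in M. (\<lambda>n. u (r n) x) \<longlonglongrightarrow> v x"
    using ae by eventually_elim (simp add: v_def convergent_LIMSEQ_iff)
  have "(\<lambda>n. \<integral>\<^sup>+x. ennreal ((u n x - v x)\<^sup>2) \<partial>M) \<longlonglongrightarrow> 0"
  proof (rule tendsto_0_if_Limsup_eq_0_ennreal)
    have "limsup (\<lambda>n. \<integral>\<^sup>+x. ennreal ((u n x - v x)\<^sup>2) \<partial>M) \<le> 0"
    proof (rule ennreal_le_epsilon)
      fix e :: real assume e: "e > 0"
      obtain K where K: "\<And>i j. i \<ge> K \<Longrightarrow> j \<ge> K \<Longrightarrow> (\<integral>\<^sup>+x. ennreal ((u i x - u j x)\<^sup>2) \<partial>M) \<le> ennreal e"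
        using cau[OF e] by blast
      have "limsup (\<lambda>n. \<integral>\<^sup>+x. ennreal ((u n x - v x)\<^sup>2) \<partial>M) \<le> ennreal e"
      proof (rule Limsup_bounded)
        show "\<forall>\<^sub>F n in sequentially. (\<integral>\<^sup>+x. ennreal ((u n x - v x)\<^sup>2) \<partial>M) \<le> ennreal e"
          using eventually_ge_at_top[of K]
        proof eventually_elim
          case (elim n)
          have "(\<integral>\<^sup>+x. ennreal ((u n x - v x)\<^sup>2) \<partial>M) = (\<integral>\<^sup>+x. liminf (\<lambda>k. ennreal ((u n x - u (r k) x)\<^sup>2)) \<partial>M)"
          proof (rule nn_integral_cong_AE, use lim in eventually_elim)
            case (elim x)
            then have "(\<lambda>k. ennreal ((u n x - u (r k) x)\<^sup>2)) \<longlonglongrightarrow> ennreal ((u n x - v x)\<^sup>2)"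
              by (intro tendsto_intros)
            then show ?case by (rule lim_imp_Liminf[OF sequentially_bot, symmetric])
          qed
          also have "\<dots> \<le> liminf (\<lambda>k. \<integral>\<^sup>+x. ennreal ((u n x - u (r k) x)\<^sup>2) \<partial>M)"
            by (rule nn_integral_liminf) measurable
          also have "\<dots> \<le> ennreal e"
          proof (rule Liminf_le)
            show "\<forall>\<^sub>F k in sequentially. (\<integral>\<^sup>+x. ennreal ((u n x - u (r k) x)\<^sup>2) \<partial>M) \<le> ennreal e"
              using eventually_ge_at_top[of K]
            proof eventually_elim
              case (elim k)
              have "r k \<ge> k" using r by (rule strict_mono_imp_increasing)
              then show ?case using elim \<open>K \<le> n\<close> by (intro K) auto
            qed
          qed simp
          finally show ?case .
        qed
      qed
      then show "limsup (\<lambda>n. \<integral>\<^sup>+x. ennreal ((u n x - v x)\<^sup>2) \<partial>M) \<le> 0 + ennreal e" by simp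
    qed
    then show "limsup (\<lambda>n. \<integral>\<^sup>+x. ennreal ((u n x - v x)\<^sup>2) \<partial>M) = 0" by simp
  qed
  then show ?thesis using r lim by (intro exI[of _ r] exI[of _ v]) auto
qed

text \<open>A continuous, compactly supported kernel that lies below \<open>J_kernel\<close> and whose mass grows like
\<open>ln (1 / \<delta>)\<close>.\<close>

definition mollifier :: "real \<Rightarrow> real \<Rightarrow> real \<Rightarrow> 'a::euclidean_space \<Rightarrow> real" where
  "mollifier c d \<delta> z = c * max 0 (1 - norm z / d) / (norm z + \<delta>) ^ DIM('a)"

lemma mollifier_continuous: "d > 0 \<Longrightarrow> \<delta> > 0 \<Longrightarrow> continuous_on S (mollifier c d \<delta>)"
  unfolding mollifier_def by (intro continuous_intros) (auto simp: add_nonneg_eq_0_iff)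

lemma mollifier_measurable [measurable]: "mollifier c d \<delta> \<in> borel_measurable borel"
  unfolding mollifier_def[abs_def] by measurable

lemma mollifier_bounds:
  fixes z :: "'a::euclidean_space"
  assumes "c > 0" "d > 0" "\<delta> > 0"
  shows "0 \<le> mollifier c d \<delta> z" "mollifier c d \<delta> z \<le> c / \<delta> ^ DIM('a) * indicator (ball 0 d) z"
    "z \<noteq> 0 \<Longrightarrow> norm z < d \<Longrightarrow> mollifier c d \<delta> z \<le> c / norm z ^ DIM('a)"
    "norm z \<ge> d \<Longrightarrow> mollifier c d \<delta> z = 0"
    "\<delta> \<le> norm z \<Longrightarrow> norm z < d / 2 \<Longrightarrow> c / 2 / 2 ^ DIM('a) / norm z ^ DIM('a) \<le> mollifier c d \<delta> z"
proof -
  have 1: "max 0 (1 - norm z / d) \<le> 1" using assms by (auto intro!: divide_nonneg_nonneg)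
  show "0 \<le> mollifier c d \<delta> z" unfolding mollifier_def using assms by (intro divide_nonneg_nonneg mult_nonneg_nonneg) auto
  show z: "norm z \<ge> d \<Longrightarrow> mollifier c d \<delta> z = 0" unfolding mollifier_def using assms by (auto simp: max_def field_simps)
  show "mollifier c d \<delta> z \<le> c / \<delta> ^ DIM('a) * indicator (ball 0 d) z"
  proof (cases "norm z < d")
    case True
    have "mollifier c d \<delta> z \<le> c * 1 / \<delta> ^ DIM('a)"
      unfolding mollifier_def using assms by (intro frac_le mult_left_mono 1 mult_nonneg_nonneg power_mono) auto
    then show ?thesis using True by simp
  qed (use z in auto)
  show "mollifier c d \<delta> z \<le> c / norm z ^ DIM('a)" if "z \<noteq> 0" 
  proof -
    have "mollifier c d \<delta> z \<le> c * 1 / norm z ^ DIM('a)"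
      unfolding mollifier_def using assms that by (intro frac_le mult_left_mono 1 mult_nonneg_nonneg power_mono) auto
    then show ?thesis by simp
  qed
  show "c / 2 / 2 ^ DIM('a) / norm z ^ DIM('a) \<le> mollifier c d \<delta> z" if "\<delta> \<le> norm z" "norm z < d / 2"
  proof -
    have "1 / 2 \<le> max 0 (1 - norm z / d)" using that assms by (auto simp: field_simps max_def)
    then have "c * (1 / 2) / (2 * norm z) ^ DIM('a) \<le> mollifier c d \<delta> z"
      unfolding mollifier_def using assms that by (intro frac_le mult_left_mono mult_nonneg_nonneg power_mono zero_less_power) auto
    then show ?thesis by (simp add: power_mult_distrib)
  qed
qed

lemma mollifier_integral_large:
  assumes "c > 0" "d > 0"
  shows "\<exists>\<delta>>0. ennreal B \<le> (\<integral>\<^sup>+z. ennreal (mollifier c d \<delta> z) \<partial>(lborel :: 'a::euclidean_space measure))"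
proof -
  define q where "q = c / 2 / 2 ^ DIM('a) * (real DIM('a) * unit_ball_vol (real DIM('a)))"
  have q: "q > 0" using assms by (auto simp: q_def intro!: mult_pos_pos divide_pos_pos)
  \<comment> \<open>With this choice \<open>q ln (d / (2 \<delta>)) = |B|\<close>.\<close>
  define \<delta> where "\<delta> = d / 2 * exp (- \<bar>B\<bar> / q)"
  have \<delta>: "\<delta> > 0" "\<delta> \<le> d / 2" using assms q by (auto simp: \<delta>_def)
  have "ln (d / 2 / \<delta>) = \<bar>B\<bar> / q" using assms by (simp add: \<delta>_def ln_div ln_mult)
  then have "ennreal B \<le> ennreal (q * ln (d / 2 / \<delta>))" using q by (intro ennreal_leI) auto
  also have "\<dots> = (\<integral>\<^sup>+(z::'a). ennreal (c / 2 / 2 ^ DIM('a) / norm z ^ DIM('a)) * indicator {\<delta>..<d/2} (norm z) \<partial>lborel)"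
    unfolding q_def using assms \<delta> by (intro nn_integral_power_annulus[symmetric]) auto
  also have "\<dots> \<le> (\<integral>\<^sup>+z. ennreal (mollifier c d \<delta> z) \<partial>(lborel :: 'a::euclidean_space measure))"
    using mollifier_bounds(5)[OF assms \<delta>(1)] by (intro nn_integral_mono) (auto split: split_indicator intro!: ennreal_leI)
  finally show ?thesis using \<delta> by blast
qed

lemma exists_mollifier:
  "\<exists>c d. c > 0 \<and> d > 0 \<and> (\<forall>\<delta>>0. \<forall>z::'a::euclidean_space. z \<noteq> 0 \<longrightarrow> mollifier c d \<delta> z \<le> J_kernel z)"
proof -
  define c where "c = 1 / (real DIM('a) * unit_ball_vol (real DIM('a)))"
  have "real DIM('a) * unit_ball_vol (real DIM('a)) > 0" by simp
  then have c: "c > 0" "c < 2 / (real DIM('a) * unit_ball_vol (real DIM('a)))"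
    unfolding c_def by (auto simp: divide_strict_right_mono simp del: mult_pos_pos)
  obtain d where d: "d > 0" "\<And>z::'a. 0 < norm z \<and> norm z < d \<longrightarrow> c / norm z ^ DIM('a) \<le> J_kernel z"
    using J_kernel_lower[OF c(2)] by blast
  have "mollifier c d \<delta> z \<le> J_kernel z" if "\<delta> > 0" "z \<noteq> 0" for \<delta> and z :: 'a
  proof (cases "norm z < d")
    case True
    then show ?thesis using mollifier_bounds(3)[OF c(1) d(1) that] d(2)[of z] that by auto
  next
    case False
    then show ?thesis using mollifier_bounds(4)[OF c(1) d(1) that(1), of z] by simp
  qed
  then show ?thesis using c d by blast
qed

text \<open>Averaging \<open>u\<close> with the probability density \<open>K / m\<close> changes it, by Jensen's inequality, by at most
\<open>1 / m \<integral>\<integral> (u(x) - u(y))\<^sup>2 K(x - y)\<close>, and \<open>K \<le> J_kernel\<close>. Since the energy is only of logarithmic order,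
the gain comes from the total mass \<open>m\<close> and not from a small support of \<open>K\<close>.\<close>

lemma smoothing_error:
  fixes u :: "'a::euclidean_space \<Rightarrow> real" and K :: "'a \<Rightarrow> real"
  assumes [measurable]: "u \<in> borel_measurable borel" "K \<in> borel_measurable borel"
    and K0: "\<And>z. 0 \<le> K z" and KJ: "\<And>z. z \<noteq> 0 \<Longrightarrow> K z \<le> J_kernel z"
    and m: "(\<integral>\<^sup>+z. ennreal (K z) \<partial>lborel) = ennreal m" "m > 0"
    and int: "\<And>x. integrable lborel (\<lambda>y. K (x - y) * u y)"
  shows "ennreal m * (\<integral>\<^sup>+x. ennreal ((u x - (\<integral>y. K (x - y) * u y \<partial>lborel) / m)\<^sup>2) \<partial>lborel) \<le> energy_on UNIV u"
proof -
  have mx: "(\<integral>\<^sup>+y. ennreal (K (x - y)) \<partial>lborel) = ennreal m" for x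
    using nn_integral_lborel_reflect[of "\<lambda>z. ennreal (K z)" x] m by simp
  then have Kint: "integrable lborel (\<lambda>y. K (x - y))" for x
    using K0 by (intro integrableI_nonneg) auto
  have Km: "(\<integral>y. K (x - y) \<partial>lborel) = m" for x
    using nn_integral_eq_integral[OF Kint, of x] mx[of x] K0 m(2) by simp
  have pt: "ennreal m * ennreal ((u x - (\<integral>y. K (x - y) * u y \<partial>lborel) / m)\<^sup>2)
     \<le> (\<integral>\<^sup>+y. ennreal ((u x - u y)\<^sup>2 * K (x - y)) \<partial>lborel)" for x
  proof -
    let ?F = "\<integral>y. K (x - y) * u y \<partial>lborel"
    have i: "integrable lborel (\<lambda>y. K (x - y) * (u x - u y))"
      using Kint[of x] int[of x] by (simp add: right_diff_distrib)
    have "m * u x - ?F = (\<integral>y. K (x - y) * (u x - u y) \<partial>lborel)"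
      using Kint[of x] int[of x] Km[of x] by (simp add: right_diff_distrib)
    then have "ennreal \<bar>m * u x - ?F\<bar> \<le> (\<integral>\<^sup>+y. ennreal (norm (K (x - y) * (u x - u y))) \<partial>lborel)"
      using integral_norm_bound_ennreal[OF i] by simp
    also have "\<dots> = (\<integral>\<^sup>+y. ennreal (sqrt (K (x - y))) * ennreal (sqrt (K (x - y)) * \<bar>u x - u y\<bar>) \<partial>lborel)"
      using K0 by (intro nn_integral_cong) (simp add: ennreal_mult[symmetric] abs_mult mult.assoc[symmetric])
    finally have "(ennreal \<bar>m * u x - ?F\<bar>)\<^sup>2 \<le> (\<integral>\<^sup>+y. ennreal (sqrt (K (x - y))) * ennreal (sqrt (K (x - y)) * \<bar>u x - u y\<bar>) \<partial>lborel)\<^sup>2"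
      by (intro power_mono) auto
    also have "\<dots> \<le> (\<integral>\<^sup>+y. (ennreal (sqrt (K (x - y))))\<^sup>2 \<partial>lborel) * (\<integral>\<^sup>+y. (ennreal (sqrt (K (x - y)) * \<bar>u x - u y\<bar>))\<^sup>2 \<partial>lborel)"
      by (rule Cauchy_Schwarz_nn_integral) measurable
    also have "(\<integral>\<^sup>+y. (ennreal (sqrt (K (x - y))))\<^sup>2 \<partial>lborel) = ennreal m"
      unfolding mx[of x, symmetric] using K0 by (intro nn_integral_cong) (simp add: ennreal_power)
    also have "(\<integral>\<^sup>+y. (ennreal (sqrt (K (x - y)) * \<bar>u x - u y\<bar>))\<^sup>2 \<partial>lborel) = (\<integral>\<^sup>+y. ennreal ((u x - u y)\<^sup>2 * K (x - y)) \<partial>lborel)"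
      using K0 by (intro nn_integral_cong) (simp add: ennreal_power power_mult_distrib mult.commute)
    also have "(ennreal \<bar>m * u x - ?F\<bar>)\<^sup>2 = ennreal ((m * u x - ?F)\<^sup>2)" by (simp add: ennreal_power)
    also have "(m * u x - ?F)\<^sup>2 = m * (m * (u x - ?F / m)\<^sup>2)" using m(2) by (simp add: power2_eq_square field_simps)
    also have "ennreal (m * (m * (u x - ?F / m)\<^sup>2)) = ennreal m * (ennreal m * ennreal ((u x - ?F / m)\<^sup>2))"
      using m(2) by (simp add: ennreal_mult)
    finally show ?thesis using m(2) by (subst (asm) ennreal_mult_le_mult_iff) auto
  qed
  have "ennreal m * (\<integral>\<^sup>+x. ennreal ((u x - (\<integral>y. K (x - y) * u y \<partial>lborel) / m)\<^sup>2) \<partial>lborel)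
    = (\<integral>\<^sup>+x. ennreal m * ennreal ((u x - (\<integral>y. K (x - y) * u y \<partial>lborel) / m)\<^sup>2) \<partial>lborel)"
    by (subst nn_integral_cmult) auto
  also have "\<dots> \<le> (\<integral>\<^sup>+x. (\<integral>\<^sup>+y. ennreal ((u x - u y)\<^sup>2 * K (x - y)) \<partial>lborel) \<partial>lborel)"
    by (intro nn_integral_mono pt)
  also have "\<dots> \<le> (\<integral>\<^sup>+x. (\<integral>\<^sup>+y. ennreal ((u x - u y)\<^sup>2 * J_kernel (x - y)) \<partial>lborel) \<partial>lborel)"
  proof (intro nn_integral_mono ennreal_leI)
    fix x y
    show "(u x - u y)\<^sup>2 * K (x - y) \<le> (u x - u y)\<^sup>2 * J_kernel (x - y)"
      using KJ[of "x - y"] by (cases "x = y") (auto intro!: mult_left_mono)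
  qed
  also have "\<dots> = energy_on UNIV u" unfolding energy_on_def by (subst nn_integral_pair) auto
  finally show ?thesis .
qed

lemma nn_integral_abs_le:
  fixes u :: "'a::euclidean_space \<Rightarrow> real"
  assumes [measurable]: "u \<in> borel_measurable borel" "\<Omega> \<in> sets borel" and out: "AE x in lborel. x \<notin> \<Omega> \<longrightarrow> u x = 0"
  shows "(\<integral>\<^sup>+x. ennreal \<bar>u x\<bar> \<partial>lborel) \<le> emeasure lborel \<Omega> + (\<integral>\<^sup>+x. ennreal ((u x)\<^sup>2) \<partial>lborel)"
proof -
  have "(\<integral>\<^sup>+x. ennreal \<bar>u x\<bar> \<partial>lborel) \<le> (\<integral>\<^sup>+x. indicator \<Omega> x + ennreal ((u x)\<^sup>2) \<partial>lborel)"
  proof (rule nn_integral_mono_AE, use out in eventually_elim)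
    case (elim x)
    have "\<bar>u x\<bar> \<le> 1 + (u x)\<^sup>2" 
      using zero_le_power2[of "\<bar>u x\<bar> - 1"] by (simp add: power2_diff)
    then have "ennreal \<bar>u x\<bar> \<le> ennreal 1 + ennreal ((u x)\<^sup>2)"
      by (subst ennreal_plus[symmetric]) (auto intro!: ennreal_leI simp del: ennreal_plus)
    then show ?case using elim by (cases "x \<in> \<Omega>") auto
  qed
  also have "\<dots> = emeasure lborel \<Omega> + (\<integral>\<^sup>+x. ennreal ((u x)\<^sup>2) \<partial>lborel)"
    by (subst nn_integral_add) auto
  finally show ?thesis .
qed

text \<open>A Rellich theorem for the logarithmic energy. Smoothing with a mollifier of large mass \<open>m\<close> is
uniformly close to the identity on energy-bounded sets; the smoothed functions are equicontinuous,
so that the Arzela-Ascoli theorem applies. For every \<open>e > 0\<close> this gives a subsequence that is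
Cauchy up to an error \<open>e\<close>, and a diagonal argument removes the error.\<close>

theorem energy_bounded_compact:
  fixes u :: "nat \<Rightarrow> 'a::euclidean_space \<Rightarrow> real"
  assumes [measurable]: "\<And>n. u n \<in> borel_measurable borel" and \<Omega>[measurable]: "\<Omega> \<in> sets borel" and bd: "bounded \<Omega>"
    and out: "\<And>n. AE x in lborel. x \<notin> \<Omega> \<longrightarrow> u n x = 0"
    and S: "S \<ge> 0" "\<And>n. (\<integral>\<^sup>+x. ennreal ((u n x)\<^sup>2) \<partial>lborel) \<le> ennreal S"
    and B: "\<And>n. energy_on UNIV (u n) \<le> ennreal B"
  shows "\<exists>r v. strict_mono r \<and> v \<in> borel_measurable borel \<and> (AE x in lborel. (\<lambda>n. u (r n) x) \<longlonglongrightarrow> v x) \<and>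
     (\<lambda>n. \<integral>\<^sup>+x. ennreal ((u (r n) x - v x)\<^sup>2) \<partial>lborel) \<longlonglongrightarrow> 0"
proof -
  obtain R where R: "R > 0" "\<Omega> \<subseteq> cball 0 R" using bd by (auto simp: bounded_pos subset_iff)
  have fin: "emeasure lborel \<Omega> < \<infinity>" using bd by (rule emeasure_bounded_finite)
  define V where "V = measure lborel \<Omega>"
  have V: "emeasure lborel \<Omega> = ennreal V" "V \<ge> 0" using fin by (auto simp: V_def emeasure_eq_ennreal_measure)
  define A where "A = V + S"
  have A0: "A \<ge> 0" using V S by (simp add: A_def)
  have L1: "(\<integral>\<^sup>+x. ennreal \<bar>u n x\<bar> \<partial>lborel) \<le> ennreal A" for n
    using nn_integral_abs_le[OF _ \<Omega> out, of n] S V unfolding A_def by (subst ennreal_plus) (auto intro: order_trans add_left_mono)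
  have int1: "integrable lborel (u n)" for n
    using L1[of n] by (intro integrableI_bounded) (auto intro: le_less_trans)
  have int1': "(\<integral>x. \<bar>u n x\<bar> \<partial>lborel) \<le> A" for n
    using L1[of n] nn_integral_eq_integral[OF integrable_abs[OF int1], of n] A0 by simp
  obtain c d where cd: "c > 0" "d > 0" "\<And>\<delta> z::'a. \<delta> > 0 \<Longrightarrow> z \<noteq> 0 \<Longrightarrow> mollifier c d \<delta> z \<le> J_kernel z"
    using exists_mollifier[where 'a='a] by blast
  have step: "\<exists>r::nat \<Rightarrow> nat. strict_mono r \<and> (\<exists>N. \<forall>i\<ge>N. \<forall>j\<ge>N. (\<integral>\<^sup>+x. ennreal ((u (s (r i)) x - u (s (r j)) x)\<^sup>2) \<partial>lborel) \<le> ennreal e)"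
    if e: "e > 0" for e :: real and s :: "nat \<Rightarrow> nat"
  proof -
    \<comment> \<open>A mass of this size makes the smoothing error at most \<open>e / 16\<close>.\<close>
    define M0 where "M0 = max 1 (16 * \<bar>B\<bar> / e)"
    obtain \<delta> where \<delta>: "\<delta> > 0" "ennreal M0 \<le> (\<integral>\<^sup>+z. ennreal (mollifier c d \<delta> z) \<partial>(lborel :: 'a measure))"
      using mollifier_integral_large[OF cd(1,2), of M0, where 'a='a] by blast
    define K where "K = (mollifier c d \<delta> :: 'a \<Rightarrow> real)"
    have [measurable]: "K \<in> borel_measurable borel" unfolding K_def by measurable
    note mb = mollifier_bounds[OF cd(1,2) \<delta>(1), where 'a='a, folded K_def]
    define Kb where "Kb = c / \<delta> ^ DIM('a)"
    have Kb: "Kb > 0" using cd \<delta> by (simp add: Kb_def)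
    have Kle: "K z \<le> Kb" for z using mb(2)[of z] Kb by (auto simp: Kb_def[symmetric] split: split_indicator_asm)
    have "(\<integral>\<^sup>+z. ennreal (K z) \<partial>lborel) \<le> (\<integral>\<^sup>+z. ennreal Kb * indicator (ball 0 d :: 'a set) z \<partial>lborel)"
    proof (intro nn_integral_mono)
      fix z :: 'a
      show "ennreal (K z) \<le> ennreal Kb * indicator (ball 0 d) z"
        using mb(2)[of z] unfolding Kb_def[symmetric] by (cases "z \<in> ball 0 d") (auto intro!: ennreal_leI simp: ennreal_neg)
    qed
    also have "\<dots> = ennreal Kb * emeasure lborel (ball 0 d :: 'a set)" by (rule nn_integral_cmult_indicator) simp
    also have "\<dots> < \<infinity>" 
      using emeasure_bounded_finite[OF bounded_ball[of "0::'a" d]] by (simp add: ennreal_mult_less_top)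
    finally obtain m where m: "(\<integral>\<^sup>+z. ennreal (K z) \<partial>lborel) = ennreal m" "m \<ge> 0"
      by (metis ennreal_cases infinity_ennreal_def less_irrefl)
    have "ennreal M0 \<le> ennreal m" using \<delta>(2) m by (simp add: K_def)
    then have mM: "M0 \<le> m" using m(2) by simp
    then have m0: "m \<ge> 1" "16 * \<bar>B\<bar> / e \<le> m" by (auto simp: M0_def)
    have intK: "integrable lborel (\<lambda>y. K (x - y) * u n y)" for x n
    proof (rule Bochner_Integration.integrable_bound[OF integrable_mult_right[OF int1[of n], of Kb]])
      show "AE y in lborel. norm (K (x - y) * u n y) \<le> norm (Kb * u n y)"
        using mb(1) Kle Kb by (intro AE_I2) (auto simp: abs_mult intro!: mult_right_mono)
    qed measurable
    define F where "F n x = (\<integral>y. K (x - y) * u n y \<partial>lborel)" for n x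
    have Fdiff: "\<bar>F n x - F n x'\<bar> \<le> q * A" if "q \<ge> 0" "\<And>y. y \<in> \<Omega> \<Longrightarrow> \<bar>K (x - y) - K (x' - y)\<bar> \<le> q" for n x x' q
    proof -
      have "F n x - F n x' = (\<integral>y. (K (x - y) - K (x' - y)) * u n y \<partial>lborel)"
        unfolding F_def using intK by (simp add: left_diff_distrib)
      also have "\<bar>\<dots>\<bar> \<le> (\<integral>y. q * \<bar>u n y\<bar> \<partial>lborel)"
      proof -
        have "\<bar>\<integral>y. (K (x - y) - K (x' - y)) * u n y \<partial>lborel\<bar> \<le> (\<integral>y. \<bar>(K (x - y) - K (x' - y)) * u n y\<bar> \<partial>lborel)"
          using integral_norm_bound[of lborel "\<lambda>y. (K (x - y) - K (x' - y)) * u n y"] by simp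
        also have "\<dots> \<le> (\<integral>y. q * \<bar>u n y\<bar> \<partial>lborel)"
        proof (rule integral_mono_AE)
          show "integrable lborel (\<lambda>y. \<bar>(K (x - y) - K (x' - y)) * u n y\<bar>)"
            using intK by (simp add: left_diff_distrib)
          show "integrable lborel (\<lambda>y. q * \<bar>u n y\<bar>)" using int1 by simp
          show "AE y in lborel. \<bar>(K (x - y) - K (x' - y)) * u n y\<bar> \<le> q * \<bar>u n y\<bar>"
            using out[of n] 
          proof eventually_elim
            case (elim y)
            show ?case
            proof (cases "y \<in> \<Omega>")
              case True
              then show ?thesis unfolding abs_mult by (intro mult_right_mono that(2)) auto
            qed (use elim in simp)
          qed
        qed
        finally show ?thesis .
      qed
      also have "\<dots> = q * (\<integral>y. \<bar>u n y\<bar> \<partial>lborel)" by simp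
      also have "\<dots> \<le> q * A" using int1' that by (intro mult_left_mono) auto
      finally show ?thesis .
    qed
    have Fbd: "\<bar>F n x\<bar> \<le> Kb * A" for n x
    proof -
      have "\<bar>F n x\<bar> \<le> (\<integral>y. \<bar>K (x - y) * u n y\<bar> \<partial>lborel)"
        unfolding F_def using integral_norm_bound[of lborel "\<lambda>y. K (x - y) * u n y"] by simp
      also have "\<dots> \<le> (\<integral>y. Kb * \<bar>u n y\<bar> \<partial>lborel)"
      proof (rule integral_mono)
        show "integrable lborel (\<lambda>y. \<bar>K (x - y) * u n y\<bar>)" by (rule integrable_abs[OF intK])
        show "integrable lborel (\<lambda>y. Kb * \<bar>u n y\<bar>)" using int1 by simp
        show "\<bar>K (x - y) * u n y\<bar> \<le> Kb * \<bar>u n y\<bar>" for y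
          unfolding abs_mult using mb(1) Kle by (intro mult_right_mono) auto
      qed
      also have "\<dots> = Kb * (\<integral>y. \<bar>u n y\<bar> \<partial>lborel)" by simp
      also have "\<dots> \<le> Kb * A" using int1' Kb by (intro mult_left_mono) auto
      finally show ?thesis .
    qed
    have "uniformly_continuous_on (cball 0 (2 * R) :: 'a set) K"
      unfolding K_def by (intro compact_uniformly_continuous mollifier_continuous cd \<delta>) auto
    note uc = this[unfolded uniformly_continuous_on_def, rule_format]
    obtain g k where gk: "strict_mono (k :: nat \<Rightarrow> nat)"
      "\<And>e. 0 < e \<Longrightarrow> \<exists>N. \<forall>n x. n \<ge> N \<and> x \<in> cball 0 R \<longrightarrow> norm (F (s (k n)) x - g x) < e"
    proof (rule Arzela_Ascoli[of "cball 0 R :: 'a set" "\<lambda>n. F (s n)" "Kb * A"])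
      show "norm (F (s n) x) \<le> Kb * A" for n x using Fbd by simp
      fix x :: 'a and e :: real assume x: "x \<in> cball 0 R" and e: "0 < e"
      define q where "q = e / (2 * (A + 1))"
      have q: "q > 0" using e A0 by (simp add: q_def)
      have qA: "q * A < e" using e A0 by (simp add: q_def field_simps add_nonneg_pos)
      obtain d' where d': "d' > 0" "\<And>z w. z \<in> cball 0 (2 * R) \<Longrightarrow> w \<in> cball 0 (2*R) \<Longrightarrow> dist w z < d' \<Longrightarrow> dist (K w) (K z) < q"
        using uc[OF q] by blast
      show "\<exists>d>0. \<forall>n y. y \<in> cball 0 R \<and> norm (x - y) < d \<longrightarrow> norm (F (s n) x - F (s n) y) < e"
      proof (intro exI[of _ d'] conjI allI impI d'(1))
        fix n y assume y: "y \<in> cball 0 R \<and> norm (x - y) < d'"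
        have "\<bar>K (x - z) - K (y - z)\<bar> \<le> q" if "z \<in> \<Omega>" for z
        proof -
          have "norm z \<le> R" using that R by auto
          then have "x - z \<in> cball 0 (2 * R)" "y - z \<in> cball 0 (2 * R)"
            using x y norm_triangle_ineq4[of x z] norm_triangle_ineq4[of y z] by auto
          moreover have "dist (x - z) (y - z) < d'" using y by (simp add: dist_norm)
          ultimately show ?thesis using d'(2)[of "y - z" "x - z"] by (simp add: dist_norm)
        qed
        then have "\<bar>F (s n) x - F (s n) y\<bar> \<le> q * A" using q by (intro Fdiff) auto
        then show "norm (F (s n) x - F (s n) y) < e" using qA by simp
      qed
    qed (auto)
    \<comment> \<open>Uniform closeness \<open>\<eta>\<close> on a set of measure \<open>V\<close> costs at most \<open>4 \<eta>\<^sup>2 V \<le> e / 4\<close> in the squared norm of a difference.\<close>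
    define \<eta> where "\<eta> = sqrt (e / (16 * (V + 1)))"
    have \<eta>: "\<eta> > 0" "\<eta>\<^sup>2 = e / (16 * (V + 1))" using e V by (auto simp: \<eta>_def)
    obtain N where N: "\<And>n x. n \<ge> N \<Longrightarrow> x \<in> cball 0 R \<Longrightarrow> norm (F (s (k n)) x - g x) < \<eta>" using gk(2)[OF \<eta>(1)] by blast
    have [measurable]: "F n \<in> borel_measurable borel" for n unfolding F_def by measurable
    have sm: "(\<integral>\<^sup>+x. ennreal ((u n x - F n x / m)\<^sup>2) \<partial>lborel) \<le> ennreal (e / 16)" for n
    proof -
      have "ennreal m * (\<integral>\<^sup>+x. ennreal ((u n x - F n x / m)\<^sup>2) \<partial>lborel) \<le> energy_on UNIV (u n)"
        unfolding F_def using mb(1) cd(3)[OF \<delta>(1)] m m0(1) intK by (intro smoothing_error) (auto simp: K_def)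
      also have "\<dots> \<le> ennreal B" by (rule B)
      also have "\<dots> \<le> ennreal (m * (e / 16))" using m0(2) e by (intro ennreal_leI) (auto simp: field_simps)
      also have "\<dots> = ennreal m * ennreal (e / 16)" using m0 e by (intro ennreal_mult) auto
      finally show ?thesis using m0(1) by (subst (asm) ennreal_mult_le_mult_iff) auto
    qed
    have "(\<integral>\<^sup>+x. ennreal ((u (s (k i)) x - u (s (k j)) x)\<^sup>2) \<partial>lborel) \<le> ennreal e" if ij: "i \<ge> N" "j \<ge> N" for i j
    proof -
      let ?i = "s (k i)" and ?j = "s (k j)"
      define G where "G x = (F ?i x / m - F ?j x / m) * indicator \<Omega> x" for x
      have [measurable]: "G \<in> borel_measurable borel" unfolding G_def by measurable
      have G: "(\<integral>\<^sup>+x. ennreal ((G x)\<^sup>2) \<partial>lborel) \<le> ennreal (e / 4)"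
      proof -
        have "(\<integral>\<^sup>+x. ennreal ((G x)\<^sup>2) \<partial>lborel) \<le> (\<integral>\<^sup>+x. ennreal ((2 * \<eta>)\<^sup>2) * indicator \<Omega> x \<partial>lborel)"
        proof (intro nn_integral_mono)
          fix x :: 'a
          have "\<bar>F ?i x / m - F ?j x / m\<bar> \<le> 2 * \<eta>" if "x \<in> \<Omega>"
          proof -
            have "\<bar>F ?i x - F ?j x\<bar> \<le> 2 * \<eta>" using N[OF ij(1), of x] N[OF ij(2), of x] that R by auto
            moreover have "\<bar>F ?i x / m - F ?j x / m\<bar> \<le> \<bar>F ?i x - F ?j x\<bar> / 1"
              unfolding diff_divide_distrib[symmetric] abs_divide using m0 by (intro divide_left_mono) auto
            ultimately show ?thesis by simp
          qed
          then show "ennreal ((G x)\<^sup>2) \<le> ennreal ((2 * \<eta>)\<^sup>2) * indicator \<Omega> x"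
            using \<eta>(1) power_mono[of "\<bar>F ?i x / m - F ?j x / m\<bar>" "2 * \<eta>" 2]
            by (cases "x \<in> \<Omega>") (auto simp: G_def intro!: ennreal_leI)
        qed
        also have "\<dots> = ennreal ((2 * \<eta>)\<^sup>2 * V)" by (subst nn_integral_cmult) (auto simp: V ennreal_mult)
        also have "\<dots> \<le> ennreal (e / 4)" using e V(2) by (intro ennreal_leI) (auto simp: power_mult_distrib \<eta>(2) field_simps)
        finally show ?thesis .
      qed
      have "(\<integral>\<^sup>+x. ennreal ((u ?i x - u ?j x)\<^sup>2) \<partial>lborel) \<le>
         (\<integral>\<^sup>+x. ennreal ((((u ?i x - F ?i x / m) + (F ?j x / m - u ?j x)) + G x)\<^sup>2) \<partial>lborel)"
        by (rule nn_integral_mono_AE, use out[of ?i] out[of ?j] in eventually_elim) (auto simp: G_def split: split_indicator)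
      also have "\<dots> \<le> 2 * (\<integral>\<^sup>+x. ennreal (((u ?i x - F ?i x / m) + (F ?j x / m - u ?j x))\<^sup>2) \<partial>lborel) + 2 * (\<integral>\<^sup>+x. ennreal ((G x)\<^sup>2) \<partial>lborel)"
        by (rule nn_integral_square_add_le) measurable
      also have "\<dots> \<le> 2 * (2 * (\<integral>\<^sup>+x. ennreal ((u ?i x - F ?i x / m)\<^sup>2) \<partial>lborel) + 2 * (\<integral>\<^sup>+x. ennreal ((F ?j x / m - u ?j x)\<^sup>2) \<partial>lborel)) + 2 * (\<integral>\<^sup>+x. ennreal ((G x)\<^sup>2) \<partial>lborel)"
        by (intro add_mono mult_left_mono nn_integral_square_add_le) auto
      also have "\<dots> \<le> 2 * (2 * ennreal (e / 16) + 2 * ennreal (e / 16)) + 2 * ennreal (e / 4)"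
        using sm[of ?i] sm[of ?j] G by (intro add_mono mult_left_mono) (auto simp: power2_commute)
      also have "\<dots> = ennreal (2 * (2 * (e / 16) + 2 * (e / 16)) + 2 * (e / 4))"
      proof -
        have "0 \<le> e / 16" "0 \<le> e / 4" "0 \<le> 2 * (e / 16)" "0 \<le> 2 * (e / 16) + 2 * (e / 16)"
           "0 \<le> 2 * (2 * (e / 16) + 2 * (e / 16))" "0 \<le> 2 * (e / 4)" "(0::real) \<le> 2"
          using e by auto
        then show ?thesis
          by (simp only: ennreal_mult ennreal_plus) simp
      qed
      also have "2 * (2 * (e / 16) + 2 * (e / 16)) + 2 * (e / 4) = e" by simp
      finally show ?thesis .
    qed
    note * = this
    show ?thesis
      by (intro exI[of _ k] conjI gk(1) exI[of _ N] allI impI *)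
  qed
  interpret subseqs "\<lambda>n s. \<exists>N. \<forall>i\<ge>N. \<forall>j\<ge>N. (\<integral>\<^sup>+x. ennreal ((u (s i) x - u (s j) x)\<^sup>2) \<partial>lborel) \<le> ennreal (inverse (real (Suc n)))"
    using step by unfold_locales (simp add: o_def del: of_nat_Suc)
  define r where "r = diagseq"
  have r: "strict_mono r" unfolding r_def by (rule subseq_diagseq)
  have hold: "\<exists>N. \<forall>i\<ge>N. \<forall>j\<ge>N. (\<integral>\<^sup>+x. ennreal ((u (r i) x - u (r j) x)\<^sup>2) \<partial>lborel) \<le> ennreal (inverse (real (Suc n)))" for n
  proof -
    have "\<exists>N. \<forall>i\<ge>N. \<forall>j\<ge>N. (\<integral>\<^sup>+x. ennreal ((u ((r \<circ> (+) (Suc n)) i) x - u ((r \<circ> (+) (Suc n)) j) x)\<^sup>2) \<partial>lborel) \<le> ennreal (inverse (real (Suc n)))"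
      unfolding r_def
    proof (rule diagseq_holds)
      fix q s :: "nat \<Rightarrow> nat" and n assume q: "strict_mono q" and "\<exists>N. \<forall>i\<ge>N. \<forall>j\<ge>N. (\<integral>\<^sup>+x. ennreal ((u (s i) x - u (s j) x)\<^sup>2) \<partial>lborel) \<le> ennreal (inverse (real (Suc n)))"
      then obtain N where N: "\<And>i j. i \<ge> N \<Longrightarrow> j \<ge> N \<Longrightarrow> (\<integral>\<^sup>+x. ennreal ((u (s i) x - u (s j) x)\<^sup>2) \<partial>lborel) \<le> ennreal (inverse (real (Suc n)))" by blast
      have "q i \<ge> N" if "i \<ge> N" for i using that strict_mono_imp_increasing[OF q, of i] by simp
      then show "\<exists>N. \<forall>i\<ge>N. \<forall>j\<ge>N. (\<integral>\<^sup>+x. ennreal ((u ((s \<circ> q) i) x - u ((s \<circ> q) j) x)\<^sup>2) \<partial>lborel) \<le> ennreal (inverse (real (Suc n)))"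
        using N by (intro exI[of _ N]) (simp del: of_nat_Suc)
    qed
    then obtain N where N: "\<And>i j. i \<ge> N \<Longrightarrow> j \<ge> N \<Longrightarrow> (\<integral>\<^sup>+x. ennreal ((u (r (Suc n + i)) x - u (r (Suc n + j)) x)\<^sup>2) \<partial>lborel) \<le> ennreal (inverse (real (Suc n)))"
      by (auto simp del: of_nat_Suc add_Suc)
    show ?thesis
    proof (intro exI[of _ "Suc n + N"] allI impI)
      fix i j assume ij: "Suc n + N \<le> i" "Suc n + N \<le> j"
      then show "(\<integral>\<^sup>+x. ennreal ((u (r i) x - u (r j) x)\<^sup>2) \<partial>lborel) \<le> ennreal (inverse (real (Suc n)))"
        using N[of "i - Suc n" "j - Suc n"] by simp
    qed
  qed
  have "\<exists>q v. strict_mono q \<and> v \<in> borel_measurable lborel \<and> (AE x in lborel. (\<lambda>n. u (r (q n)) x) \<longlonglongrightarrow> v x) \<and>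
     (\<lambda>n. \<integral>\<^sup>+x. ennreal ((u (r n) x - v x)\<^sup>2) \<partial>lborel) \<longlonglongrightarrow> 0"
  proof (rule L2_Cauchy_limit)
    fix e :: real assume "e > 0"
    then obtain n where n: "inverse (real (Suc n)) < e" using reals_Archimedean by blast
    then have le: "ennreal (inverse (real (Suc n))) \<le> ennreal e" by (intro ennreal_leI less_imp_le)
    obtain N where N: "\<And>i j. i \<ge> N \<Longrightarrow> j \<ge> N \<Longrightarrow> (\<integral>\<^sup>+x. ennreal ((u (r i) x - u (r j) x)\<^sup>2) \<partial>lborel) \<le> ennreal (inverse (real (Suc n)))"
      using hold[of n] by blast
    show "\<exists>N. \<forall>i\<ge>N. \<forall>j\<ge>N. (\<integral>\<^sup>+x. ennreal ((u (r i) x - u (r j) x)\<^sup>2) \<partial>lborel) \<le> ennreal e"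
      by (intro exI[of _ N] allI impI order_trans[OF N le])
  qed simp
  then obtain q v where qv: "strict_mono q" "v \<in> borel_measurable lborel" "AE x in lborel. (\<lambda>n. u (r (q n)) x) \<longlonglongrightarrow> v x"
    "(\<lambda>n. \<integral>\<^sup>+x. ennreal ((u (r n) x - v x)\<^sup>2) \<partial>lborel) \<longlonglongrightarrow> 0" by blast
  show ?thesis
    using strict_mono_o[OF r qv(1)] qv(2,3) LIMSEQ_subseq_LIMSEQ[OF qv(4,1)]
    by (intro exI[of _ "r \<circ> q"] exI[of _ v]) (auto simp: o_def)
qed

text \<open>A point at distance more than twice the radius from \<open>x \<in> \<Omega>\<close> lies outside \<open>\<Omega>\<close>, where \<open>u\<close> vanishes;
such pairs contribute \<open>u(x)\<^sup>2\<close> times the positive mass of the kernel far from the origin.\<close>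

theorem energy_poincare:
  fixes \<Omega> :: "'a::euclidean_space set"
  assumes bd: "bounded \<Omega>"
  shows "\<exists>a>0. \<forall>u \<in> borel_measurable borel. (AE x in lborel. x \<notin> \<Omega> \<longrightarrow> u x = 0) \<longrightarrow>
     ennreal a * (\<integral>\<^sup>+x. ennreal ((u x)\<^sup>2) \<partial>lborel) \<le> energy_on UNIV u"
proof -
  obtain R where R: "R > 0" "\<Omega> \<subseteq> cball 0 R" using bd by (auto simp: bounded_pos subset_iff)
  define D where "D = {z::'a. 2 * R < norm z}"
  have [measurable]: "D \<in> sets borel" unfolding D_def by measurable
  define a where "a = (\<integral>\<^sup>+z. ennreal (J_kernel z) * indicator D z \<partial>lborel)"
  have "a \<noteq> 0"
  proof
    assume "a = 0"
    then have "AE z in lborel. ennreal (J_kernel z) * indicator D z = 0"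
      unfolding a_def by (subst (asm) nn_integral_0_iff_AE) auto
    then have ae: "AE z in lborel. z \<notin> D"
    proof eventually_elim
      case (elim z)
      show ?case
      proof
        assume z: "z \<in> D"
        then have "z \<noteq> 0" using R(1) by (auto simp: D_def)
        then have "J_kernel z > 0" by (rule J_kernel_pos)
        then show False using elim z by simp
      qed
    qed
    obtain b :: 'a where b: "norm b = 2 * R + 2" using vector_choose_size[of "2 * R + 2"] R by auto
    have sub: "ball b 1 \<subseteq> D"
    proof
      fix z assume "z \<in> ball b 1"
      then have "norm (b - z) < 1" by (simp add: dist_norm)
      then have "norm z > 2 * R + 1" using norm_triangle_ineq2[of b z] b by linarith
      then show "z \<in> D" by (simp add: D_def)
    qed
    have "emeasure lborel D = 0" using ae by (subst (asm) AE_iff_measurable[of D]) auto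
    then have "emeasure lborel (ball b 1) = 0" using emeasure_mono[OF sub, of lborel] by simp
    then show False using unit_ball_vol_pos[of "real DIM('a)"] by (simp add: emeasure_ball)
  qed
  define a' where "a' = (if a = \<infinity> then 1 else enn2real a)"
  have a': "a' > 0" "ennreal a' \<le> a"
  proof -
    show "a' > 0" using \<open>a \<noteq> 0\<close> unfolding a'_def
      by (auto simp: enn2real_positive_iff less_top zero_less_iff_neq_zero)
    show "ennreal a' \<le> a" unfolding a'_def by (auto simp: less_top[symmetric])
  qed
  show ?thesis
  proof (intro exI[of _ a'] conjI ballI impI a'(1))
    fix u :: "'a \<Rightarrow> real" assume [measurable]: "u \<in> borel_measurable borel" and out: "AE x in lborel. x \<notin> \<Omega> \<longrightarrow> u x = 0"
    have "ennreal a' * (\<integral>\<^sup>+x. ennreal ((u x)\<^sup>2) \<partial>lborel) \<le> a * (\<integral>\<^sup>+x. ennreal ((u x)\<^sup>2) \<partial>lborel)"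
      by (intro mult_right_mono a') auto
    also have "\<dots> = (\<integral>\<^sup>+x. ennreal ((u x)\<^sup>2) * a \<partial>lborel)"
      by (subst nn_integral_multc) (auto simp: mult.commute)
    also have "\<dots> \<le> (\<integral>\<^sup>+x. (\<integral>\<^sup>+y. ennreal ((u x - u y)\<^sup>2 * J_kernel (x - y)) \<partial>lborel) \<partial>lborel)"
    proof (rule nn_integral_mono_AE, use out in eventually_elim)
      case (elim x)
      show ?case
      proof (cases "x \<in> \<Omega>")
        case True
        have "ennreal ((u x)\<^sup>2) * a = ennreal ((u x)\<^sup>2) * (\<integral>\<^sup>+y. ennreal (J_kernel (x - y)) * indicator D (x - y) \<partial>lborel)"
          unfolding a_def by (subst nn_integral_lborel_reflect[of _ x]) auto
        also have "\<dots> = (\<integral>\<^sup>+y. ennreal ((u x)\<^sup>2) * (ennreal (J_kernel (x - y)) * indicator D (x - y)) \<partial>lborel)"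
          by (subst nn_integral_cmult) (auto simp: D_def)
        also have "\<dots> \<le> (\<integral>\<^sup>+y. ennreal ((u x - u y)\<^sup>2 * J_kernel (x - y)) \<partial>lborel)"
        proof (rule nn_integral_mono_AE, use out in eventually_elim)
          case (elim y)
          have "y \<notin> \<Omega>" if "x - y \<in> D"
          proof
            assume "y \<in> \<Omega>"
            then have "norm x \<le> R" "norm y \<le> R" using True R by auto
            then show False using that norm_triangle_ineq4[of x y] by (auto simp: D_def)
          qed
          then show ?case using elim by (auto simp: ennreal_mult split: split_indicator)
        qed
        finally show ?thesis .
      qed (use elim in simp)
    qed
    also have "\<dots> = energy_on UNIV u" unfolding energy_on_def by (subst nn_integral_pair) auto
    finally show "ennreal a' * (\<integral>\<^sup>+x. ennreal ((u x)\<^sup>2) \<partial>lborel) \<le> energy_on UNIV u" .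
  qed
qed

section \<open>The energy form\<close>

lemma energy_on_eq_iterated:
  assumes [measurable]: "u \<in> borel_measurable borel" "D \<in> sets borel"
  shows "energy_on D u = (\<integral>\<^sup>+x. \<integral>\<^sup>+y. ennreal ((u x - u y)\<^sup>2 * J_kernel (x - y)) * indicator D (x - y) \<partial>lborel \<partial>lborel)"
  unfolding energy_on_def by (subst nn_integral_pair) auto

lemma energy_on_mono:
  assumes "\<And>x y. (v x - v y)\<^sup>2 \<le> (u x - u y)\<^sup>2"
  shows "energy_on D v \<le> energy_on D u"
  unfolding energy_on_def using assms
  by (intro nn_integral_mono) (auto split: split_indicator intro!: ennreal_leI mult_right_mono)

lemma energy_on_subset: "D \<subseteq> D' \<Longrightarrow> energy_on D u \<le> energy_on D' u"
  unfolding energy_on_def by (intro nn_integral_mono) (auto split: split_indicator)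

lemma energy_on_le_sum:
  assumes [measurable]: "u \<in> borel_measurable borel" "w \<in> borel_measurable borel" "D \<in> sets borel"
    and C: "C \<ge> 0" "\<And>x y. (v x - v y)\<^sup>2 \<le> C * ((u x - u y)\<^sup>2 + (w x - w y)\<^sup>2)"
  shows "energy_on D v \<le> ennreal C * (energy_on D u + energy_on D w)"
proof -
  have "energy_on D v \<le> (\<integral>\<^sup>+z. ennreal C * (ennreal ((u (fst z) - u (snd z))\<^sup>2 * J_kernel (fst z - snd z)) * indicator D (fst z - snd z)
       + ennreal ((w (fst z) - w (snd z))\<^sup>2 * J_kernel (fst z - snd z)) * indicator D (fst z - snd z)) \<partial>(lborel \<Otimes>\<^sub>M lborel))"
    unfolding energy_on_def
  proof (intro nn_integral_mono)
    fix z :: "'a \<times> 'a"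
    let ?J = "J_kernel (fst z - snd z)"
    have "(v (fst z) - v (snd z))\<^sup>2 * ?J \<le> C * ((u (fst z) - u (snd z))\<^sup>2 + (w (fst z) - w (snd z))\<^sup>2) * ?J"
      by (intro mult_right_mono C) auto
    also have "\<dots> = C * ((u (fst z) - u (snd z))\<^sup>2 * ?J + (w (fst z) - w (snd z))\<^sup>2 * ?J)" by (simp add: algebra_simps)
    finally have "ennreal ((v (fst z) - v (snd z))\<^sup>2 * ?J) \<le> ennreal \<dots>" by (rule ennreal_leI)
    also have "\<dots> = ennreal C * (ennreal ((u (fst z) - u (snd z))\<^sup>2 * ?J) + ennreal ((w (fst z) - w (snd z))\<^sup>2 * ?J))"
      using C(1) by (simp add: ennreal_mult)
    finally show "ennreal ((v (fst z) - v (snd z))\<^sup>2 * ?J) * indicator D (fst z - snd z) \<le> ennreal C * (ennreal ((u (fst z) - u (snd z))\<^sup>2 * ?J) * indicator D (fst z - snd z)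
       + ennreal ((w (fst z) - w (snd z))\<^sup>2 * ?J) * indicator D (fst z - snd z))"
      by (auto split: split_indicator)
  qed
  also have "\<dots> = ennreal C * (energy_on D u + energy_on D w)"
    unfolding energy_on_def by (subst nn_integral_cmult, simp, subst nn_integral_add) auto
  finally show ?thesis .
qed

lemma energy_on_split:
  assumes [measurable]: "u \<in> borel_measurable borel" "D \<in> sets borel"
  shows "energy_on UNIV u = energy_on D u + energy_on (- D) u"
proof -
  have [measurable]: "- D \<in> sets borel" by simp
  show ?thesis unfolding energy_on_def
    by (subst nn_integral_add[symmetric]) (auto intro!: nn_integral_cong split: split_indicator)
qed

text \<open>Fatou's lemma on the product space.\<close>

lemma energy_on_liminf:
  assumes [measurable]: "\<And>n. u n \<in> borel_measurable borel" "v \<in> borel_measurable borel" "D \<in> sets borel"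
    and lim: "AE x in lborel. (\<lambda>n. u n x) \<longlonglongrightarrow> v x"
  shows "energy_on D v \<le> liminf (\<lambda>n. energy_on D (u n))"
proof -
  let ?F = "\<lambda>w z. ennreal ((w (fst z) - w (snd z))\<^sup>2 * J_kernel (fst z - snd z)) * indicator D (fst z - snd z)"
  have "energy_on D v = (\<integral>\<^sup>+x. \<integral>\<^sup>+y. ?F v (x, y) \<partial>lborel \<partial>lborel)"
    by (simp add: energy_on_eq_iterated)
  also have "\<dots> = (\<integral>\<^sup>+x. \<integral>\<^sup>+y. liminf (\<lambda>n. ?F (u n) (x, y)) \<partial>lborel \<partial>lborel)"
  proof (rule nn_integral_cong_AE, use lim in eventually_elim, rule nn_integral_cong_AE, use lim in eventually_elim)
    fix x y assume "(\<lambda>n. u n x) \<longlonglongrightarrow> v x" "(\<lambda>n. u n y) \<longlonglongrightarrow> v y"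
    then have "(\<lambda>n. ennreal ((u n x - u n y)\<^sup>2 * J_kernel (x - y))) \<longlonglongrightarrow> ennreal ((v x - v y)\<^sup>2 * J_kernel (x - y))"
      by (intro tendsto_intros)
    then have "(\<lambda>n. ?F (u n) (x, y)) \<longlonglongrightarrow> ?F v (x, y)"
      by (cases "x - y \<in> D") auto
    then show "?F v (x, y) = liminf (\<lambda>n. ?F (u n) (x, y))"
      by (rule lim_imp_Liminf[OF sequentially_bot, symmetric])
  qed
  also have "\<dots> = (\<integral>\<^sup>+z. liminf (\<lambda>n. ?F (u n) z) \<partial>(lborel \<Otimes>\<^sub>M lborel))"
    by (rule nn_integral_pair[symmetric]) (intro borel_measurable_liminf energy_integrand_measurable assms)
  also have "\<dots> \<le> liminf (\<lambda>n. \<integral>\<^sup>+z. ?F (u n) z \<partial>(lborel \<Otimes>\<^sub>M lborel))"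
    by (rule nn_integral_liminf) (intro energy_integrand_measurable assms)
  finally show ?thesis unfolding energy_on_def .
qed

text \<open>Monotone convergence; the diagonal, which no complement of a ball reaches, contributes nothing
because the integrand vanishes there.\<close>

lemma energy_far_tendsto:
  assumes [measurable]: "u \<in> borel_measurable borel"
  shows "(\<lambda>n. energy_on (- ball 0 (inverse (real (Suc n)))) u) \<longlonglongrightarrow> energy_on UNIV u"
  unfolding energy_on_def
proof (rule nn_integral_LIMSEQ)
  let ?F = "\<lambda>D z. ennreal ((u (fst z) - u (snd z))\<^sup>2 * J_kernel (fst z - snd z)) * indicator D (fst z - snd z)"
  show "incseq (\<lambda>n. ?F (- ball 0 (inverse (real (Suc n)))))"
  proof (intro incseq_SucI le_funI mult_left_mono)
    fix n and z :: "'a \<times> 'a"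
    have "inverse (real (Suc (Suc n))) \<le> inverse (real (Suc n))" by (intro le_imp_inverse_le) auto
    then show "(indicator (- ball 0 (inverse (real (Suc n)))) (fst z - snd z) :: ennreal) \<le> indicator (- ball 0 (inverse (real (Suc (Suc n))))) (fst z - snd z)"
      by (auto simp: indicator_def simp del: of_nat_Suc inverse_le_iff_le)
  qed simp
  show "?F (- ball 0 (inverse (real (Suc n)))) \<in> borel_measurable (lborel \<Otimes>\<^sub>M lborel)" for n
    by (intro energy_integrand_measurable assms) auto
  fix z :: "'a \<times> 'a"
  show "(\<lambda>n. ?F (- ball 0 (inverse (real (Suc n)))) z) \<longlonglongrightarrow> ?F UNIV z"
  proof (cases "fst z = snd z")
    case False
    then obtain n where n: "inverse (real (Suc n)) < norm (fst z - snd z)" using reals_Archimedean[of "norm (fst z - snd z)"] by auto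
    have "\<forall>\<^sub>F m in sequentially. ?F (- ball 0 (inverse (real (Suc m)))) z = ?F UNIV z"
      using eventually_ge_at_top[of n]
    proof eventually_elim
      case (elim m)
      have "inverse (real (Suc m)) \<le> inverse (real (Suc n))" using elim by (intro le_imp_inverse_le) auto
      then have "inverse (real (Suc m)) \<le> norm (fst z - snd z)" using n by linarith
      then show ?case by (simp add: indicator_def del: of_nat_Suc)
    qed
    then show ?thesis by (rule tendsto_eventually)
  qed simp
qed

lemma energy_near_small:
  assumes [measurable]: "u \<in> borel_measurable borel" and fin: "energy_on UNIV u < \<infinity>" and e: "e > 0"
  shows "\<exists>\<delta>>0. energy_on (ball 0 \<delta>) u \<le> ennreal e"
proof -
  define a where "a = enn2real (energy_on UNIV u)"
  have a: "energy_on UNIV u = ennreal a" "a \<ge> 0" using fin by (auto simp: a_def less_top)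
  have "\<exists>n. ennreal (a - e) \<le> energy_on (- ball 0 (inverse (real (Suc n)))) u"
  proof (cases "a - e \<ge> 0")
    case True
    have "\<forall>\<^sub>F n in sequentially. ennreal (a - e) < energy_on (- ball 0 (inverse (real (Suc n)))) u"
      using e True a by (intro order_tendstoD(1)[OF energy_far_tendsto]) (auto simp: ennreal_less_iff)
    then show ?thesis using eventually_happens'[OF sequentially_bot] less_imp_le by blast
  qed (auto simp: ennreal_neg)
  then obtain n where n: "ennreal (a - e) \<le> energy_on (- ball 0 (inverse (real (Suc n)))) u" by blast
  let ?B = "ball 0 (inverse (real (Suc n)))"
  have sp: "ennreal a = energy_on ?B u + energy_on (- ?B) u" unfolding a(1)[symmetric] by (rule energy_on_split) auto
  have "energy_on ?B u \<le> ennreal a" "energy_on (- ?B) u \<le> ennreal a" unfolding sp by simp_all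
  then obtain b f where bf: "energy_on ?B u = ennreal b" "b \<ge> 0" "energy_on (- ?B) u = ennreal f" "f \<ge> 0"
    by (metis ennreal_cases ennreal_less_top leD)
  have "a = b + f" using sp bf a by (simp add: ennreal_plus[symmetric] del: ennreal_plus)
  moreover have "a - e \<le> f" using n bf by simp
  ultimately have "b \<le> e" by simp
  then show ?thesis using bf by (intro exI[of _ "inverse (real (Suc n))"]) (auto simp del: of_nat_Suc)
qed

lemma energy_on_E_integrand:
  "energy_on UNIV u = (\<integral>\<^sup>+z. ennreal (E_integrand u u z) \<partial>(lborel \<Otimes>\<^sub>M lborel))"
  unfolding energy_on_def E_integrand_def by (intro nn_integral_cong) (auto simp: power2_eq_square)

lemma E_integrand_measurable [measurable]:
  assumes [measurable]: "u \<in> borel_measurable borel" "v \<in> borel_measurable borel"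
  shows "E_integrand u v \<in> borel_measurable (lborel \<Otimes>\<^sub>M lborel)"
  unfolding E_integrand_def by measurable

lemma E_integrand_nonneg: "0 \<le> E_integrand u u z"
  by (auto simp: E_integrand_def split: prod.split)

lemma H_ln_iff:
  "u \<in> H_ln \<longleftrightarrow> u \<in> borel_measurable borel \<and> (\<integral>\<^sup>+x. ennreal ((u x)\<^sup>2) \<partial>lborel) < \<infinity> \<and> energy_on UNIV u < \<infinity>"
proof -
  have "integrable lborel (\<lambda>x. (u x)\<^sup>2) \<longleftrightarrow> (\<integral>\<^sup>+x. ennreal ((u x)\<^sup>2) \<partial>lborel) < \<infinity>"
    if [measurable]: "u \<in> borel_measurable borel"
    by (subst integrable_iff_bounded) auto
  moreover have "integrable (lborel \<Otimes>\<^sub>M lborel) (E_integrand u u) \<longleftrightarrow> energy_on UNIV u < \<infinity>"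
    if [measurable]: "u \<in> borel_measurable borel"
    unfolding energy_on_E_integrand by (subst integrable_iff_bounded) (simp add: abs_of_nonneg[OF E_integrand_nonneg])
  ultimately show ?thesis unfolding H_ln_def by auto
qed

lemma energy_eq_E_omega:
  assumes "u \<in> H_ln" shows "energy_on UNIV u = ennreal (2 * E_omega u u)" "E_omega u u \<ge> 0"
proof -
  have "integrable (lborel \<Otimes>\<^sub>M lborel) (E_integrand u u)" using assms by (simp add: H_ln_def)
  then show "energy_on UNIV u = ennreal (2 * E_omega u u)" 
    unfolding energy_on_E_integrand E_omega_def by (subst nn_integral_eq_integral) (auto simp: E_integrand_nonneg)
  show "E_omega u u \<ge> 0" unfolding E_omega_def by (simp add: E_integrand_nonneg)
qed

definition nsq :: "('a::euclidean_space \<Rightarrow> real) \<Rightarrow> real" where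
  "nsq u = (\<integral>x. (u x)\<^sup>2 \<partial>lborel)"

definition sqln :: "real \<Rightarrow> real" where "sqln s = s\<^sup>2 * ln (s\<^sup>2)"

definition ent :: "('a::euclidean_space \<Rightarrow> real) \<Rightarrow> real" where
  "ent u = (\<integral>x. sqln (u x) \<partial>lborel)"

lemma sqln_measurable [measurable]: "sqln \<in> borel_measurable borel"
  unfolding sqln_def[abs_def] by measurable

lemma sqln_0 [simp]: "sqln 0 = 0" and sqln_minus [simp]: "sqln (- s) = sqln s" and sqln_abs [simp]: "sqln \<bar>s\<bar> = sqln s"
  by (auto simp: sqln_def)

lemma nsq_nonneg [simp]: "nsq u \<ge> 0" by (simp add: nsq_def)

lemma integral_Cauchy_Schwarz:
  fixes f g :: "'a \<Rightarrow> real"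
  assumes [measurable]: "f \<in> borel_measurable M" "g \<in> borel_measurable M"
    and i: "integrable M (\<lambda>x. (f x)\<^sup>2)" "integrable M (\<lambda>x. (g x)\<^sup>2)"
  shows "integrable M (\<lambda>x. f x * g x)" "(\<integral>x. \<bar>f x * g x\<bar> \<partial>M) \<le> sqrt (\<integral>x. (f x)\<^sup>2 \<partial>M) * sqrt (\<integral>x. (g x)\<^sup>2 \<partial>M)"
    "\<bar>\<integral>x. f x * g x \<partial>M\<bar> \<le> sqrt (\<integral>x. (f x)\<^sup>2 \<partial>M) * sqrt (\<integral>x. (g x)\<^sup>2 \<partial>M)"
proof -
  show int: "integrable M (\<lambda>x. f x * g x)"
  proof (rule Bochner_Integration.integrable_bound[OF Bochner_Integration.integrable_add[OF i]])
    show "AE x in M. norm (f x * g x) \<le> norm ((f x)\<^sup>2 + (g x)\<^sup>2)"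
    proof (rule AE_I2)
      fix x
      have "2 * \<bar>f x * g x\<bar> \<le> (f x)\<^sup>2 + (g x)\<^sup>2"
        using sum_squares_bound[of "\<bar>f x\<bar>" "\<bar>g x\<bar>"] by (simp add: abs_mult)
      then show "norm (f x * g x) \<le> norm ((f x)\<^sup>2 + (g x)\<^sup>2)" by simp
    qed
  qed measurable
  have "(\<integral>\<^sup>+x. ennreal \<bar>f x\<bar> * ennreal \<bar>g x\<bar> \<partial>M)\<^sup>2 \<le> (\<integral>\<^sup>+x. ennreal \<bar>f x\<bar> ^ 2 \<partial>M) * (\<integral>\<^sup>+x. ennreal \<bar>g x\<bar> ^ 2 \<partial>M)"
    by (rule Cauchy_Schwarz_nn_integral) auto
  also have "(\<integral>\<^sup>+x. ennreal \<bar>f x\<bar> ^ 2 \<partial>M) = ennreal (\<integral>x. (f x)\<^sup>2 \<partial>M)"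
    using i by (subst nn_integral_eq_integral[symmetric]) (auto simp: ennreal_power)
  also have "(\<integral>\<^sup>+x. ennreal \<bar>g x\<bar> ^ 2 \<partial>M) = ennreal (\<integral>x. (g x)\<^sup>2 \<partial>M)"
    using i by (subst nn_integral_eq_integral[symmetric]) (auto simp: ennreal_power)
  also have "(\<integral>\<^sup>+x. ennreal \<bar>f x\<bar> * ennreal \<bar>g x\<bar> \<partial>M) = ennreal (\<integral>x. \<bar>f x * g x\<bar> \<partial>M)"
    using integrable_abs[OF int] by (subst nn_integral_eq_integral[symmetric]) (auto simp: ennreal_mult[symmetric] abs_mult)
  finally have "(\<integral>x. \<bar>f x * g x\<bar> \<partial>M)\<^sup>2 \<le> (\<integral>x. (f x)\<^sup>2 \<partial>M) * (\<integral>x. (g x)\<^sup>2 \<partial>M)"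
    by (simp add: ennreal_power ennreal_mult[symmetric])
  then have "\<bar>\<integral>x. \<bar>f x * g x\<bar> \<partial>M\<bar> \<le> sqrt ((\<integral>x. (f x)\<^sup>2 \<partial>M) * (\<integral>x. (g x)\<^sup>2 \<partial>M))"
    using real_sqrt_le_mono by fastforce
  then show *: "(\<integral>x. \<bar>f x * g x\<bar> \<partial>M) \<le> sqrt (\<integral>x. (f x)\<^sup>2 \<partial>M) * sqrt (\<integral>x. (g x)\<^sup>2 \<partial>M)"
    by (simp add: real_sqrt_mult)
  show "\<bar>\<integral>x. f x * g x \<partial>M\<bar> \<le> sqrt (\<integral>x. (f x)\<^sup>2 \<partial>M) * sqrt (\<integral>x. (g x)\<^sup>2 \<partial>M)"
    by (rule order_trans[OF integral_abs_bound *])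
qed

text \<open>The quadratic mean is, up to a factor, the Euclidean norm of a pair of reals; this is the reverse
triangle inequality for that norm. It makes the energy convex as a function of \<open>u\<^sup>2\<close>.\<close>

lemma quadratic_mean_bound: "\<bar>sqrt ((a\<^sup>2 + b\<^sup>2) / 2) - sqrt ((c\<^sup>2 + d\<^sup>2) / 2)\<bar> \<le> sqrt (((a - c)\<^sup>2 + (b - d)\<^sup>2) / 2)"
proof -
  have "\<bar>norm (a, b) - norm (c, d)\<bar> \<le> norm ((a, b) - (c, d))" by (rule norm_triangle_ineq3)
  then have "\<bar>sqrt (a\<^sup>2 + b\<^sup>2) - sqrt (c\<^sup>2 + d\<^sup>2)\<bar> \<le> sqrt ((a - c)\<^sup>2 + (b - d)\<^sup>2)"
    by (simp add: norm_Pair)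
  then have "\<bar>sqrt (a\<^sup>2 + b\<^sup>2) - sqrt (c\<^sup>2 + d\<^sup>2)\<bar> / sqrt 2 \<le> sqrt ((a - c)\<^sup>2 + (b - d)\<^sup>2) / sqrt 2"
    by (intro divide_right_mono) auto
  then show ?thesis by (simp add: real_sqrt_divide diff_divide_distrib[symmetric] abs_divide)
qed

lemma E_omega_cmult: "E_omega (\<lambda>x. c * u x) (\<lambda>x. c * u x) = c\<^sup>2 * E_omega u u"
proof -
  have "E_integrand (\<lambda>x. c * u x) (\<lambda>x. c * u x) = (\<lambda>z. c\<^sup>2 * E_integrand u u z)"
    by (auto simp: E_integrand_def fun_eq_iff algebra_simps power2_eq_square)
  then show ?thesis by (simp add: E_omega_def)
qed

lemma nsq_cmult: "nsq (\<lambda>x. c * u x) = c\<^sup>2 * nsq u"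
  by (simp add: nsq_def power_mult_distrib)

section \<open>The energy space of a bounded domain\<close>

locale bounded_domain =
  fixes \<Omega> :: "'a::euclidean_space set"
  assumes open_dom: "open \<Omega>" and bounded_dom: "bounded \<Omega>" and nonempty_dom: "\<Omega> \<noteq> {}"
begin

lemma dom_sets [measurable]: "\<Omega> \<in> sets borel" using open_dom by simp

lemma dom_finite: "emeasure lborel \<Omega> < \<infinity>" by (rule emeasure_bounded_finite[OF bounded_dom])

lemma integrable_dom: "integrable lborel (indicator \<Omega> :: 'a \<Rightarrow> real)"
  using dom_finite by (simp add: integrable_indicator_iff)

lemma H0_D:
  assumes "u \<in> H0_ln \<Omega>"
  shows "u \<in> H_ln" "u \<in> borel_measurable borel" "integrable lborel (\<lambda>x. (u x)\<^sup>2)" "AE x in lborel. x \<notin> \<Omega> \<longrightarrow> u x = 0"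
    "integrable (lborel \<Otimes>\<^sub>M lborel) (E_integrand u u)" "energy_on UNIV u < \<infinity>" "E_omega u u \<ge> 0"
    "(\<integral>\<^sup>+x. ennreal ((u x)\<^sup>2) \<partial>lborel) = ennreal (nsq u)" "energy_on UNIV u = ennreal (2 * E_omega u u)"
proof -
  show u: "u \<in> H_ln" using assms by (simp add: H0_ln_def)
  then show "energy_on UNIV u < \<infinity>" by (simp add: H_ln_iff)
  show "u \<in> borel_measurable borel" "integrable (lborel \<Otimes>\<^sub>M lborel) (E_integrand u u)" using u by (auto simp: H_ln_def)
  show i: "integrable lborel (\<lambda>x. (u x)\<^sup>2)" using u by (auto simp: H_ln_def)
  show "AE x in lborel. x \<notin> \<Omega> \<longrightarrow> u x = 0" using assms by (simp add: H0_ln_def)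
  show "E_omega u u \<ge> 0" "energy_on UNIV u = ennreal (2 * E_omega u u)" using energy_eq_E_omega[OF u] by auto
  show "(\<integral>\<^sup>+x. ennreal ((u x)\<^sup>2) \<partial>lborel) = ennreal (nsq u)"
    unfolding nsq_def using i by (intro nn_integral_eq_integral) auto
qed

lemma H0_I:
  assumes "u \<in> borel_measurable borel" "(\<integral>\<^sup>+x. ennreal ((u x)\<^sup>2) \<partial>lborel) < \<infinity>" "energy_on UNIV u < \<infinity>" "AE x in lborel. x \<notin> \<Omega> \<longrightarrow> u x = 0"
  shows "u \<in> H0_ln \<Omega>"
  using assms by (simp add: H0_ln_def H_ln_iff)

text \<open>The space is stable under every operation that is dominated in size and in increments by two of
its elements; linear combinations, absolute values and quadratic means are instances.\<close>

lemma H0_dominated: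
  assumes u: "u \<in> H0_ln \<Omega>" and w: "w \<in> H0_ln \<Omega>" and [measurable]: "v \<in> borel_measurable borel" and C: "C \<ge> 0"
    and 1: "\<And>x. \<bar>v x\<bar> \<le> C * (\<bar>u x\<bar> + \<bar>w x\<bar>)" and 2: "\<And>x y. \<bar>v x - v y\<bar> \<le> C * (\<bar>u x - u y\<bar> + \<bar>w x - w y\<bar>)"
  shows "v \<in> H0_ln \<Omega>"
proof (rule H0_I)
  note [measurable] = H0_D(2)[OF u] H0_D(2)[OF w]
  have sq: "a\<^sup>2 \<le> (2 * C\<^sup>2) * (b\<^sup>2 + c\<^sup>2)" if "\<bar>a\<bar> \<le> C * (\<bar>b\<bar> + \<bar>c\<bar>)" for a b c :: real
  proof -
    have "a\<^sup>2 = \<bar>a\<bar>\<^sup>2" by simp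
    also have "\<dots> \<le> (C * (\<bar>b\<bar> + \<bar>c\<bar>))\<^sup>2" using that by (intro power_mono) auto
    also have "\<dots> = C\<^sup>2 * (\<bar>b\<bar> + \<bar>c\<bar>)\<^sup>2" by (simp add: power_mult_distrib)
    also have "\<dots> \<le> C\<^sup>2 * (2 * (b\<^sup>2 + c\<^sup>2))" 
      using sum_squares_bound[of "\<bar>b\<bar>" "\<bar>c\<bar>"] by (intro mult_left_mono) (auto simp: power2_sum)
    finally show ?thesis by (simp add: algebra_simps)
  qed
  have "(\<integral>\<^sup>+x. ennreal ((v x)\<^sup>2) \<partial>lborel) \<le> (\<integral>\<^sup>+x. ennreal (2 * C\<^sup>2) * (ennreal ((u x)\<^sup>2) + ennreal ((w x)\<^sup>2)) \<partial>lborel)"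
    using sq[OF 1] by (intro nn_integral_mono) (simp add: ennreal_mult[symmetric] ennreal_plus[symmetric] del: ennreal_plus)
  also have "\<dots> = ennreal (2 * C\<^sup>2) * (ennreal (nsq u) + ennreal (nsq w))"
    using H0_D(8)[OF u] H0_D(8)[OF w] by (subst nn_integral_cmult, simp, subst nn_integral_add) auto
  also have "\<dots> < \<infinity>" by (simp add: ennreal_mult_less_top)
  finally show "(\<integral>\<^sup>+x. ennreal ((v x)\<^sup>2) \<partial>lborel) < \<infinity>" .
  have "energy_on UNIV v \<le> ennreal (2 * C\<^sup>2) * (energy_on UNIV u + energy_on UNIV w)"
    using sq[OF 2] by (intro energy_on_le_sum) auto
  also have "\<dots> < \<infinity>" using H0_D(6)[OF u] H0_D(6)[OF w] by (simp add: ennreal_mult_less_top)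
  finally show "energy_on UNIV v < \<infinity>" .
  show "AE x in lborel. x \<notin> \<Omega> \<longrightarrow> v x = 0"
    using H0_D(4)[OF u] H0_D(4)[OF w]
  proof eventually_elim
    case (elim x)
    then show ?case using 1[of x] by auto
  qed
qed simp

lemma H0_cmult: assumes "u \<in> H0_ln \<Omega>" shows "(\<lambda>x. c * u x) \<in> H0_ln \<Omega>"
  using H0_D(2)[OF assms]
  by (intro H0_dominated[OF assms assms, of _ "\<bar>c\<bar>"]) (auto simp: abs_mult right_diff_distrib[symmetric] intro!: mult_left_mono)

lemma H0_add: assumes "u \<in> H0_ln \<Omega>" "w \<in> H0_ln \<Omega>" shows "(\<lambda>x. u x + w x) \<in> H0_ln \<Omega>"
  using H0_D(2)[OF assms(1)] H0_D(2)[OF assms(2)]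
  by (intro H0_dominated[OF assms, of _ 1]) auto

lemma H0_diff: assumes "u \<in> H0_ln \<Omega>" "w \<in> H0_ln \<Omega>" shows "(\<lambda>x. u x - w x) \<in> H0_ln \<Omega>"
  using H0_D(2)[OF assms(1)] H0_D(2)[OF assms(2)]
  by (intro H0_dominated[OF assms, of _ 1]) auto

lemma H0_abs: assumes "u \<in> H0_ln \<Omega>" shows "(\<lambda>x. \<bar>u x\<bar>) \<in> H0_ln \<Omega>"
  using H0_D(2)[OF assms]
  by (intro H0_dominated[OF assms assms, of _ 1]) (auto intro: order_trans[OF abs_triangle_ineq3])

lemma H0_abs_add: assumes "u \<in> H0_ln \<Omega>" "w \<in> H0_ln \<Omega>" shows "(\<lambda>x. \<bar>u x\<bar> + \<bar>w x\<bar>) \<in> H0_ln \<Omega>"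
  by (intro H0_add H0_abs assms)

lemma H0_quadratic_mean:
  assumes "u \<in> H0_ln \<Omega>" "w \<in> H0_ln \<Omega>" shows "(\<lambda>x. sqrt (((u x)\<^sup>2 + (w x)\<^sup>2) / 2)) \<in> H0_ln \<Omega>"
proof -
  note [measurable] = H0_D(2)[OF assms(1)] H0_D(2)[OF assms(2)]
  have le: "sqrt ((a\<^sup>2 + b\<^sup>2) / 2) \<le> \<bar>a\<bar> + \<bar>b\<bar>" for a b :: real
  proof (rule real_le_lsqrt)
    have "a\<^sup>2 + b\<^sup>2 \<le> (\<bar>a\<bar> + \<bar>b\<bar>)\<^sup>2" by (simp add: power2_sum)
    moreover have "(a\<^sup>2 + b\<^sup>2) / 2 \<le> a\<^sup>2 + b\<^sup>2" by simp
    ultimately show "(a\<^sup>2 + b\<^sup>2) / 2 \<le> (\<bar>a\<bar> + \<bar>b\<bar>)\<^sup>2" by (rule order_trans[rotated])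
  qed auto
  show ?thesis
    by (rule H0_dominated[OF assms, of _ 1]) (use le in \<open>auto intro: order_trans[OF quadratic_mean_bound]\<close>)
qed

text \<open>The energy integrand of \<open>u\<close> and \<open>v\<close> is a product of two square integrable functions on the product
space, one depending on \<open>u\<close> and one on \<open>v\<close>.\<close>

lemma E_integrable:
  assumes u: "u \<in> H0_ln \<Omega>" and v: "v \<in> H0_ln \<Omega>"
  shows "integrable (lborel \<Otimes>\<^sub>M lborel) (E_integrand u v)"
    "\<bar>E_omega u v\<bar> \<le> sqrt (E_omega u u) * sqrt (E_omega v v)"
proof -
  note [measurable] = H0_D(2)[OF u] H0_D(2)[OF v]
  let ?P = "lborel \<Otimes>\<^sub>M lborel :: ('a \<times> 'a) measure"
  define f where "f w z = (w (fst z) - w (snd z)) * sqrt (J_kernel (fst z - snd z))" for w and z :: "'a \<times> 'a"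
  have f: "f w z * f w' z = E_integrand w w' z" for w w' z
    by (auto simp: f_def E_integrand_def split: prod.split) 
  have f2: "(f w z)\<^sup>2 = E_integrand w w z" for w z using f[of w z w] by (simp add: power2_eq_square)
  have [measurable]: "f u \<in> borel_measurable ?P" "f v \<in> borel_measurable ?P"
    unfolding f_def by measurable
  note cs = integral_Cauchy_Schwarz[of "f u" ?P "f v", unfolded f f2, OF _ _ H0_D(5)[OF u] H0_D(5)[OF v]]
  show "integrable (lborel \<Otimes>\<^sub>M lborel) (E_integrand u v)" using cs(1) by simp
  have s: "sqrt (1/2 * a) = sqrt (1/2) * sqrt a" for a :: real by (simp only: real_sqrt_mult)
  have "\<bar>E_omega u v\<bar> = 1/2 * \<bar>\<integral>z. E_integrand u v z \<partial>?P\<bar>" by (simp add: E_omega_def abs_mult)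
  also have "\<dots> \<le> 1/2 * (sqrt (\<integral>z. E_integrand u u z \<partial>?P) * sqrt (\<integral>z. E_integrand v v z \<partial>?P))"
    using cs(3) by (intro mult_left_mono) auto
  also have "\<dots> = (sqrt (1/2) * sqrt (1/2)) * (sqrt (\<integral>z. E_integrand u u z \<partial>?P) * sqrt (\<integral>z. E_integrand v v z \<partial>?P))" by simp
  also have "\<dots> = sqrt (E_omega u u) * sqrt (E_omega v v)"
    unfolding E_omega_def s by (simp only: mult_ac)
  finally show "\<bar>E_omega u v\<bar> \<le> sqrt (E_omega u u) * sqrt (E_omega v v)" .
qed

lemma E_omega_add_cmult:
  assumes u: "u \<in> H0_ln \<Omega>" and v: "v \<in> H0_ln \<Omega>"
  shows "E_omega (\<lambda>x. u x + t * v x) (\<lambda>x. u x + t * v x) = E_omega u u + 2 * t * E_omega u v + t\<^sup>2 * E_omega v v"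
proof -
  note i = E_integrable(1)[OF u u] E_integrable(1)[OF u v] E_integrable(1)[OF v v]
  have "E_integrand (\<lambda>x. u x + t * v x) (\<lambda>x. u x + t * v x) = (\<lambda>z. E_integrand u u z + 2 * t * E_integrand u v z + t\<^sup>2 * E_integrand v v z)"
    by (auto simp: E_integrand_def fun_eq_iff algebra_simps power2_eq_square)
  then show ?thesis using i by (simp add: E_omega_def algebra_simps)
qed

lemma integrable_prod: 
  assumes u: "u \<in> H0_ln \<Omega>" and v: "v \<in> H0_ln \<Omega>" shows "integrable lborel (\<lambda>x. u x * v x)"
  using H0_D[OF u] H0_D[OF v] by (intro integral_Cauchy_Schwarz) auto

lemma nsq_add_cmult:
  assumes u: "u \<in> H0_ln \<Omega>" and v: "v \<in> H0_ln \<Omega>"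
  shows "nsq (\<lambda>x. u x + t * v x) = nsq u + 2 * t * (\<integral>x. u x * v x \<partial>lborel) + t\<^sup>2 * nsq v"
proof -
  have e: "(\<lambda>x. (u x + t * v x)\<^sup>2) = (\<lambda>x. (u x)\<^sup>2 + 2 * t * (u x * v x) + t\<^sup>2 * (v x)\<^sup>2)"
    by (auto simp: algebra_simps power2_eq_square)
  show ?thesis unfolding nsq_def e
    using integrable_prod[OF u v] H0_D(3)[OF u] H0_D(3)[OF v] by simp
qed

lemma ae_zero_iff_nsq: assumes "u \<in> H0_ln \<Omega>" shows "ae_zero u \<longleftrightarrow> nsq u = 0"
  using integral_nonneg_eq_0_iff_AE[OF H0_D(3)[OF assms]] by (simp add: nsq_def ae_zero_def)

lemma nsq_pos: "u \<in> H0_ln \<Omega> \<Longrightarrow> \<not> ae_zero u \<Longrightarrow> nsq u > 0"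
  using ae_zero_iff_nsq nsq_nonneg[of u] by (auto simp: less_le simp del: nsq_nonneg)

lemma nsq_poincare: "\<exists>C>0. \<forall>u\<in>H0_ln \<Omega>. nsq u \<le> C * E_omega u u"
proof -
  obtain a where a: "a > 0" "\<And>u. u \<in> borel_measurable borel \<Longrightarrow> (AE x in lborel. x \<notin> \<Omega> \<longrightarrow> u x = 0) \<Longrightarrow>
     ennreal a * (\<integral>\<^sup>+x. ennreal ((u x)\<^sup>2) \<partial>lborel) \<le> energy_on UNIV u"
    using energy_poincare[OF bounded_dom] by blast
  have "nsq u \<le> 2 / a * E_omega u u" if u: "u \<in> H0_ln \<Omega>" for u
  proof -
    have "ennreal a * ennreal (nsq u) \<le> ennreal (2 * E_omega u u)" using a(2)[OF H0_D(2,4)[OF u]] H0_D(8,9)[OF u] by simp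
    then have "a * nsq u \<le> 2 * E_omega u u" using a(1) H0_D(7)[OF u] by (simp add: ennreal_mult[symmetric])
    then show ?thesis using a(1) by (simp add: field_simps)
  qed
  then show ?thesis using a(1) by (intro exI[of _ "2 / a"]) auto
qed

lemma set_integral_dom:
  assumes [measurable]: "(f :: 'a \<Rightarrow> real) \<in> borel_measurable borel" and "AE x in lborel. x \<notin> \<Omega> \<longrightarrow> f x = 0"
  shows "(LINT x:\<Omega>|lborel. f x) = (\<integral>x. f x \<partial>lborel)"
  unfolding set_lebesgue_integral_def
proof (rule integral_cong_AE)
  show "AE x in lborel. indicator \<Omega> x *\<^sub>R f x = f x" using assms(2) by eventually_elim (auto simp: indicator_def)
qed measurable

lemma J_ln_eq:
  assumes u: "u \<in> H0_ln \<Omega>"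
  shows "J_ln \<Omega> l k u = 1/2 * E_omega u u - l/2 * nsq u + k/4 * nsq u - k/4 * ent u"
proof -
  note [measurable] = H0_D(2)[OF u]
  have "(LINT x:\<Omega>|lborel. (u x)\<^sup>2) = nsq u" unfolding nsq_def
    by (rule set_integral_dom, measurable, use H0_D(4)[OF u] in eventually_elim) simp
  moreover have "(LINT x:\<Omega>|lborel. (u x)\<^sup>2 * ln ((u x)\<^sup>2)) = ent u" unfolding ent_def sqln_def
    by (rule set_integral_dom, measurable, use H0_D(4)[OF u] in eventually_elim) simp
  ultimately show ?thesis unfolding J_ln_def by simp
qed

lemma nehari_iff:
  "u \<in> nehari \<Omega> l k \<longleftrightarrow> u \<in> H0_ln \<Omega> \<and> \<not> ae_zero u \<and> E_omega u u = l * nsq u + k / 2 * ent u"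
proof -
  have "(LINT x:\<Omega>|lborel. (u x)\<^sup>2) = nsq u" "(LINT x:\<Omega>|lborel. (u x)\<^sup>2 * ln \<bar>u x\<bar>) = ent u / 2" if u: "u \<in> H0_ln \<Omega>"
  proof -
    note [measurable] = H0_D(2)[OF u]
    show "(LINT x:\<Omega>|lborel. (u x)\<^sup>2) = nsq u" unfolding nsq_def
      by (rule set_integral_dom, measurable, use H0_D(4)[OF u] in eventually_elim) simp
    have s: "(t::real)\<^sup>2 * ln \<bar>t\<bar> = sqln t / 2" for t
    proof (cases "t = 0")
      case False
      then have "ln (t\<^sup>2) = 2 * ln \<bar>t\<bar>" using ln_realpow[of "\<bar>t\<bar>" 2] by simp
      then show ?thesis by (simp add: sqln_def)
    qed simp
    have "(LINT x:\<Omega>|lborel. sqln (u x) / 2) = (\<integral>x. sqln (u x) / 2 \<partial>lborel)"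
      by (rule set_integral_dom, measurable, use H0_D(4)[OF u] in eventually_elim) simp
    then show "(LINT x:\<Omega>|lborel. (u x)\<^sup>2 * ln \<bar>u x\<bar>) = ent u / 2" unfolding s ent_def by simp
  qed
  then show ?thesis unfolding nehari_def by auto
qed

end

section \<open>The entropy\<close>

text \<open>The function \<open>s\<^sup>2 ln s\<^sup>2\<close> is split at the level \<open>L\<close> into \<open>sqln_trunc\<close>, which has quadratic growth and is
therefore continuous along \<open>L\<^sup>2\<close> convergence, and the nonnegative \<open>sqln_tail\<close>, which carries the
critical growth and is controlled by \<open>log_sobolev\<close>.\<close>

definition sqln_tail :: "real \<Rightarrow> real \<Rightarrow> real" where "sqln_tail L s = s\<^sup>2 * max 0 (ln (s\<^sup>2 / L\<^sup>2))"
definition sqln_trunc :: "real \<Rightarrow> real \<Rightarrow> real" where "sqln_trunc L s = s\<^sup>2 * ln (min (s\<^sup>2) (L\<^sup>2))"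

lemma sqln_tail_measurable [measurable]: "sqln_tail L \<in> borel_measurable borel"
  unfolding sqln_tail_def[abs_def] by measurable
lemma sqln_trunc_measurable [measurable]: "sqln_trunc L \<in> borel_measurable borel"
  unfolding sqln_trunc_def[abs_def] by measurable

lemma sqln_tail_nonneg: "0 \<le> sqln_tail L s" by (simp add: sqln_tail_def)

lemma sqln_split: assumes "L > 0" shows "sqln s = sqln_trunc L s + sqln_tail L s"
proof (cases "s = 0")
  case False
  show ?thesis
  proof (cases "s\<^sup>2 \<le> L\<^sup>2")
    case True
    then have "ln (s\<^sup>2 / L\<^sup>2) \<le> 0" using False assms by (intro ln_le_zero_iff[THEN iffD2]) auto
    then show ?thesis using True by (simp add: sqln_def sqln_trunc_def sqln_tail_def min_def max_def)
  next
    case F: False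
    then have l: "ln (s\<^sup>2 / L\<^sup>2) = ln (s\<^sup>2) - ln (L\<^sup>2)" using False assms by (subst ln_div) auto
    have "ln (L\<^sup>2) \<le> ln (s\<^sup>2)" using F assms by (intro ln_mono) auto
    then have mx: "max 0 (ln (s\<^sup>2 / L\<^sup>2)) = ln (s\<^sup>2) - ln (L\<^sup>2)" using l by simp
    have mn: "min (s\<^sup>2) (L\<^sup>2) = L\<^sup>2" using F by simp
    show ?thesis by (simp add: sqln_def sqln_trunc_def sqln_tail_def mx mn right_diff_distrib)
  qed
qed (simp add: sqln_def sqln_trunc_def sqln_tail_def)

text \<open>For \<open>a \<le> 1\<close> the product \<open>a |ln a|\<close> is at most \<open>1\<close>; for \<open>a \<ge> 1\<close> the logarithm lies between \<open>0\<close> and its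
value at the truncation level.\<close>

lemma abs_mult_ln_min_le:
  fixes a L :: real
  assumes a: "0 \<le> a" and L: "L \<ge> 1"
  shows "a * \<bar>ln (min (a\<^sup>2) (L\<^sup>2))\<bar> \<le> 2 + a * ln (L\<^sup>2)"
proof -
  have lL: "ln (L\<^sup>2) \<ge> 0" using L by (intro ln_ge_zero) auto
  consider "a = 0" | "0 < a" "a \<le> 1" | "a > 1" using a by linarith
  then show ?thesis
  proof cases
    case 2
    have "a\<^sup>2 \<le> 1" using 2 by (simp add: power_le_one)
    moreover have "1 \<le> L\<^sup>2" using L by simp
    ultimately have m: "min (a\<^sup>2) (L\<^sup>2) = a\<^sup>2" by simp
    have l: "ln (a\<^sup>2) = 2 * ln a" using 2 by (simp add: ln_realpow)
    have "ln (1 / a) \<le> 1 / a - 1" using 2 by (intro ln_le_minus_one) auto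
    then have "- ln a \<le> 1 / a - 1" using 2 by (simp add: ln_div)
    then have "a * (- ln a) \<le> a * (1 / a - 1)" using 2 by (intro mult_left_mono) auto
    then have "a * (- ln a) \<le> 1" using 2 by (simp add: algebra_simps)
    moreover have "ln a \<le> 0" using 2 by simp
    ultimately have "a * \<bar>ln (a\<^sup>2)\<bar> \<le> 2" unfolding l by (simp add: abs_mult abs_of_nonpos)
    moreover have "0 \<le> a * ln (L\<^sup>2)" using a lL by simp
    ultimately show ?thesis unfolding m by linarith
  next
    case 3
    have "1 \<le> min (a\<^sup>2) (L\<^sup>2)" using 3 L by simp
    then have "0 \<le> ln (min (a\<^sup>2) (L\<^sup>2))" by (rule ln_ge_zero)
    moreover have "ln (min (a\<^sup>2) (L\<^sup>2)) \<le> ln (L\<^sup>2)" using 3 L by (intro ln_mono) auto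
    ultimately have "a * \<bar>ln (min (a\<^sup>2) (L\<^sup>2))\<bar> \<le> a * ln (L\<^sup>2)" using a by (intro mult_left_mono) auto
    then show ?thesis by linarith
  qed simp
qed

text \<open>With \<open>m\<close> and \<open>n\<close> the truncated squares of \<open>a \<ge> b \<ge> 0\<close>, the difference is
\<open>(a\<^sup>2 - b\<^sup>2) ln m + b\<^sup>2 (ln m - ln n)\<close>. The singularity of the logarithm at \<open>0\<close> is absorbed in the first term
by the factor \<open>a + b \<le> 2 a\<close>, and in the second one by \<open>b\<^sup>2\<close>, because \<open>ln (m / n) \<le> m / n - 1\<close>.\<close>

lemma sqln_trunc_lipschitz:
  assumes L: "L \<ge> 1"
  shows "\<bar>sqln_trunc L s - sqln_trunc L t\<bar> \<le> (4 + 2 * ln (L\<^sup>2)) * (\<bar>s - t\<bar> * (1 + \<bar>s\<bar> + \<bar>t\<bar>))"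
proof -
  have lL: "ln (L\<^sup>2) \<ge> 0" using L by (intro ln_ge_zero) auto
  have *: "\<bar>sqln_trunc L a - sqln_trunc L b\<bar> \<le> (a - b) * (4 + 2 * (a * ln (L\<^sup>2)) + 2 * a)" if ab: "0 \<le> b" "b \<le> a" for a b
  proof -
    have a: "0 \<le> a" using ab by simp
    define m where "m = min (a\<^sup>2) (L\<^sup>2)"
    define n where "n = min (b\<^sup>2) (L\<^sup>2)"
    have e: "sqln_trunc L a - sqln_trunc L b = (a - b) * ((a + b) * ln m) + b\<^sup>2 * (ln m - ln n)"
      by (simp add: sqln_trunc_def m_def n_def algebra_simps power2_eq_square)
    have 1: "\<bar>(a - b) * ((a + b) * ln m)\<bar> \<le> (a - b) * (2 * (2 + a * ln (L\<^sup>2)))"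
    proof -
      have "(a + b) * \<bar>ln m\<bar> \<le> (2 * a) * \<bar>ln m\<bar>" using ab by (intro mult_right_mono) auto
      also have "\<dots> \<le> 2 * (2 + a * ln (L\<^sup>2))" using abs_mult_ln_min_le[OF a L] by (simp add: m_def)
      finally have "(a + b) * \<bar>ln m\<bar> \<le> 2 * (2 + a * ln (L\<^sup>2))" .
      then show ?thesis using ab by (auto simp: abs_mult intro!: mult_left_mono)
    qed
    have 2: "\<bar>b\<^sup>2 * (ln m - ln n)\<bar> \<le> (a - b) * (2 * a)"
    proof (cases "b = 0")
      case False
      then have b: "b > 0" using ab by simp
      have n0: "n > 0" using b L by (simp add: n_def)
      have b2: "b\<^sup>2 \<le> a\<^sup>2" using ab by (intro power_mono) auto
      have mn: "n \<le> m" using b2 unfolding m_def n_def by (intro min.mono) auto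
      have nn: "0 \<le> ln m - ln n" using mn n0 by simp
      have "b\<^sup>2 * (ln m - ln n) \<le> a\<^sup>2 - b\<^sup>2"
      proof (cases "b\<^sup>2 \<le> L\<^sup>2")
        case True
        then have nb: "n = b\<^sup>2" by (simp add: n_def)
        have "ln m - ln n = ln (m / n)" using n0 mn by (simp add: ln_div)
        also have "\<dots> \<le> m / n - 1" using n0 mn by (intro ln_le_minus_one) auto
        finally have "b\<^sup>2 * (ln m - ln n) \<le> b\<^sup>2 * (m / n - 1)" by (intro mult_left_mono) auto
        also have "\<dots> = m - b\<^sup>2" using b by (simp add: nb field_simps)
        also have "\<dots> \<le> a\<^sup>2 - b\<^sup>2" by (simp add: m_def)
        finally show ?thesis .
      next
        case False
        then have "m = n" using b2 by (auto simp: m_def n_def min_def)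
        then show ?thesis using b2 by simp
      qed
      also have "\<dots> = (a - b) * (a + b)" by (simp add: algebra_simps power2_eq_square)
      also have "\<dots> \<le> (a - b) * (2 * a)" using ab by (intro mult_left_mono) auto
      finally show ?thesis using nn by simp
    qed (use ab in simp)
    show ?thesis unfolding e using 1 2 by (simp add: algebra_simps abs_if split: if_splits)
  qed
  have **: "\<bar>sqln_trunc L a - sqln_trunc L b\<bar> \<le> (4 + 2 * ln (L\<^sup>2)) * ((a - b) * (1 + a + b))" if "0 \<le> b" "b \<le> a" for a b
  proof -
    have "\<bar>sqln_trunc L a - sqln_trunc L b\<bar> \<le> (a - b) * (4 + 2 * (a * ln (L\<^sup>2)) + 2 * a)" using * that by blast
    also have "\<dots> \<le> (a - b) * ((4 + 2 * ln (L\<^sup>2)) * (1 + a + b))"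
    proof (rule mult_left_mono)
      have "0 \<le> a * ln (L\<^sup>2)" "0 \<le> b * ln (L\<^sup>2)" using that lL by auto
      then show "4 + 2 * (a * ln (L\<^sup>2)) + 2 * a \<le> (4 + 2 * ln (L\<^sup>2)) * (1 + a + b)"
        using that lL by (simp add: distrib_left distrib_right)
    qed (use that in simp)
    finally show ?thesis by (simp add: mult.left_commute)
  qed
  have t: "sqln_trunc L \<bar>s\<bar> = sqln_trunc L s" for s by (simp add: sqln_trunc_def)
  have "\<bar>sqln_trunc L s - sqln_trunc L t\<bar> \<le> (4 + 2 * ln (L\<^sup>2)) * (\<bar>\<bar>s\<bar> - \<bar>t\<bar>\<bar> * (1 + \<bar>s\<bar> + \<bar>t\<bar>))"
  proof (cases "\<bar>t\<bar> \<le> \<bar>s\<bar>")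
    case True
    then show ?thesis using **[of "\<bar>t\<bar>" "\<bar>s\<bar>"] by (simp add: t)
  next
    case False
    then show ?thesis using **[of "\<bar>s\<bar>" "\<bar>t\<bar>"] by (simp add: t abs_minus_commute add_ac)
  qed
  also have "\<dots> \<le> (4 + 2 * ln (L\<^sup>2)) * (\<bar>s - t\<bar> * (1 + \<bar>s\<bar> + \<bar>t\<bar>))"
    using lL by (intro mult_left_mono mult_right_mono abs_triangle_ineq3) auto
  finally show ?thesis .
qed

text \<open>At the origin the difference quotient is \<open>h ln h\<^sup>2\<close>, which tends to zero because it is
bounded by a multiple of \<open>sqrt |h|\<close>.\<close>

lemma DERIV_sqln: "DERIV sqln s :> 2 * s * ln (s\<^sup>2) + 2 * s"
proof (cases "s = 0")
  case False
  show ?thesis unfolding sqln_def[abs_def] using False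
    by (auto intro!: derivative_eq_intros simp: field_simps power2_eq_square zero_less_mult_iff neq_iff)
next
  case True
  have b: "\<bar>h * ln (h\<^sup>2)\<bar> \<le> 4 * sqrt \<bar>h\<bar>" if "\<bar>h\<bar> < 1" for h :: real
  proof (cases "h = 0")
    case False
    define q where "q = sqrt \<bar>h\<bar>"
    have q: "q > 0" "q < 1" using False that by (auto simp: q_def)
    have hq: "\<bar>h\<bar> = q\<^sup>2" by (simp add: q_def)
    have "h\<^sup>2 = q ^ 4" using hq power2_abs[of h] by simp
    then have l: "ln (h\<^sup>2) = 4 * ln q" using q by (simp add: ln_realpow)
    have "ln (1 / q) \<le> 1 / q - 1" using q by (intro ln_le_minus_one) auto
    then have "- ln q \<le> 1 / q" using q by (simp add: ln_div)
    then have "q\<^sup>2 * (- ln q) \<le> q\<^sup>2 * (1 / q)" by (intro mult_left_mono) auto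
    also have "q\<^sup>2 * (1 / q) = q" using q by (simp add: power2_eq_square)
    finally have "4 * (q\<^sup>2 * (- ln q)) \<le> 4 * q" by linarith
    moreover have e: "\<bar>ln q\<bar> = - ln q" using q by simp
    have "4 * (q\<^sup>2 * (- ln q)) = q\<^sup>2 * (4 * \<bar>ln q\<bar>)" unfolding e by (rule mult.left_commute)
    ultimately have "q\<^sup>2 * (4 * \<bar>ln q\<bar>) \<le> 4 * q" by (simp only:)
    moreover have "\<bar>h * ln (h\<^sup>2)\<bar> = q\<^sup>2 * (4 * \<bar>ln q\<bar>)" by (simp only: abs_mult hq l abs_numeral)
    ultimately show ?thesis by (simp only: q_def)
  qed simp
  have "((\<lambda>h. h * ln (h\<^sup>2)) \<longlongrightarrow> 0) (at (0::real))"
  proof (rule tendsto_0_le[where K=1])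
    have "((\<lambda>h. 4 * sqrt \<bar>h\<bar>) \<longlongrightarrow> 4 * sqrt \<bar>0::real\<bar>) (at 0)"
      by (rule isContD) (intro continuous_intros)
    then show "((\<lambda>h. 4 * sqrt \<bar>h\<bar>) \<longlongrightarrow> 0) (at (0::real))" by simp
    have "\<forall>\<^sub>F h in at (0::real). \<bar>h\<bar> < 1" unfolding eventually_at by (intro exI[of _ 1]) (auto simp: dist_real_def)
    then show "\<forall>\<^sub>F h in at (0::real). norm (h * ln (h\<^sup>2)) \<le> norm (4 * sqrt \<bar>h\<bar>) * 1"
      by eventually_elim (use b in simp)
  qed
  then have "((\<lambda>h. (sqln (0 + h) - sqln 0) / h) \<longlongrightarrow> 0) (at 0)"
    by (rule Lim_transform_eventually) (auto simp: sqln_def power2_eq_square eventually_at_filter)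
  then show ?thesis using True by (simp add: DERIV_def)
qed

lemma sqln_diff_bound:
  assumes "\<bar>s\<bar> \<le> w" "\<bar>t\<bar> \<le> w"
  shows "\<bar>sqln s - sqln t\<bar> \<le> \<bar>s - t\<bar> * (4 + 2 * (w * max 0 (ln (w\<^sup>2))) + 2 * w)"
proof -
  have w: "w \<ge> 0" using assms by linarith
  have d: "\<bar>2 * x * ln (x\<^sup>2) + 2 * x\<bar> \<le> 4 + 2 * (w * max 0 (ln (w\<^sup>2))) + 2 * w" if x: "\<bar>x\<bar> \<le> w" for x
  proof -
    have "\<bar>x\<bar> * \<bar>ln (x\<^sup>2)\<bar> \<le> 2 + w * max 0 (ln (w\<^sup>2))"
    proof -
      define L where "L = max 1 w"
      have L: "L \<ge> 1" by (simp add: L_def)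
      have "\<bar>x\<bar> \<le> \<bar>L\<bar>" using x L by (simp add: L_def)
      then have "x\<^sup>2 \<le> L\<^sup>2" by (simp only: abs_le_square_iff)
      then have m: "min (\<bar>x\<bar>\<^sup>2) (L\<^sup>2) = x\<^sup>2" by simp
      have "\<bar>x\<bar> * \<bar>ln (x\<^sup>2)\<bar> \<le> 2 + \<bar>x\<bar> * ln (L\<^sup>2)"
        using abs_mult_ln_min_le[of "\<bar>x\<bar>" L] L unfolding m by simp
      also have "ln (L\<^sup>2) = max 0 (ln (w\<^sup>2))"
      proof (cases "w \<le> 1")
        case True
        then have "w\<^sup>2 \<le> 1" using w by (simp add: power_le_one)
        then have "ln (w\<^sup>2) \<le> 0" using w by (cases "w = 0") auto
        then show ?thesis using True by (simp add: L_def max_def)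
      next
        case False
        then have "ln (w\<^sup>2) \<ge> 0" by (intro ln_ge_zero) auto
        then show ?thesis using False by (simp add: L_def)
      qed
      also have "2 + \<bar>x\<bar> * max 0 (ln (w\<^sup>2)) \<le> 2 + w * max 0 (ln (w\<^sup>2))" using x by (intro add_left_mono mult_right_mono) auto
      finally show ?thesis .
    qed
    moreover have "\<bar>2 * x * ln (x\<^sup>2) + 2 * x\<bar> \<le> 2 * (\<bar>x\<bar> * \<bar>ln (x\<^sup>2)\<bar>) + 2 * \<bar>x\<bar>"
      by (rule order_trans[OF abs_triangle_ineq]) (simp add: abs_mult)
    ultimately show ?thesis using x by linarith
  qed
  have mvt: "\<bar>sqln b - sqln a\<bar> \<le> \<bar>b - a\<bar> * (4 + 2 * (w * max 0 (ln (w\<^sup>2))) + 2 * w)" if ab: "a < b" "\<bar>a\<bar> \<le> w" "\<bar>b\<bar> \<le> w" for a b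
  proof -
    obtain z where z: "a < z" "z < b" "sqln b - sqln a = (b - a) * (2 * z * ln (z\<^sup>2) + 2 * z)"
      using MVT2[of a b sqln, OF ab(1) DERIV_sqln] by blast
    have "\<bar>z\<bar> \<le> w" using z ab by linarith
    then show ?thesis unfolding z(3) abs_mult by (intro mult_left_mono d) auto
  qed
  consider "s < t" | "t < s" | "s = t" by linarith
  then show ?thesis
  proof cases
    case 1 then show ?thesis using mvt[of s t] assms by (simp add: abs_minus_commute)
  next
    case 2 then show ?thesis using mvt[of t s] assms by simp
  qed simp
qed

context bounded_domain
begin

lemma integrable_H0: assumes u: "u \<in> H0_ln \<Omega>" shows "integrable lborel u"
proof (rule Bochner_Integration.integrable_bound[OF Bochner_Integration.integrable_add[OF integrable_dom H0_D(3)[OF u]]])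
  show "AE x in lborel. norm (u x) \<le> norm (indicator \<Omega> x + (u x)\<^sup>2)"
    using H0_D(4)[OF u]
  proof eventually_elim
    case (elim x)
    have "\<bar>u x\<bar> \<le> 1 + (u x)\<^sup>2" using zero_le_power2[of "\<bar>u x\<bar> - 1"] by (simp add: power2_diff)
    then show ?case using elim by (cases "x \<in> \<Omega>") auto
  qed
qed (use H0_D(2)[OF u] in simp)

definition dom_vol :: real where "dom_vol = measure lborel \<Omega>"

lemma weight_integrable:
  assumes u: "u \<in> H0_ln \<Omega>" and v: "v \<in> H0_ln \<Omega>"
  defines "g \<equiv> \<lambda>x. indicator \<Omega> x + \<bar>u x\<bar> + \<bar>v x\<bar>"
  shows "g \<in> borel_measurable borel" "integrable lborel (\<lambda>x. (g x)\<^sup>2)" "(\<integral>x. (g x)\<^sup>2 \<partial>lborel) \<le> 3 * (dom_vol + nsq u + nsq v)"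
proof -
  note [measurable] = H0_D(2)[OF u] H0_D(2)[OF v]
  show g[measurable]: "g \<in> borel_measurable borel" unfolding g_def by measurable
  have le: "(g x)\<^sup>2 \<le> 3 * (indicator \<Omega> x + (u x)\<^sup>2 + (v x)\<^sup>2)" for x
  proof -
    have "(a + b + c)\<^sup>2 \<le> 3 * (a\<^sup>2 + b\<^sup>2 + c\<^sup>2)" for a b c :: real
      using sum_squares_bound[of a b] sum_squares_bound[of b c] sum_squares_bound[of a c]
      by (simp add: power2_eq_square algebra_simps)
    from this[of "indicator \<Omega> x" "\<bar>u x\<bar>" "\<bar>v x\<bar>"] show ?thesis by (cases "x \<in> \<Omega>") (auto simp: g_def)
  qed
  have i: "integrable lborel (\<lambda>x. 3 * (indicator \<Omega> x + (u x)\<^sup>2 + (v x)\<^sup>2))"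
    using integrable_dom H0_D(3)[OF u] H0_D(3)[OF v] by simp
  show gi: "integrable lborel (\<lambda>x. (g x)\<^sup>2)"
    by (rule Bochner_Integration.integrable_bound[OF i]) (use le in \<open>auto intro!: AE_I2 order_trans[OF _ abs_ge_self]\<close>)
  have "(\<integral>x. (g x)\<^sup>2 \<partial>lborel) \<le> (\<integral>x. 3 * (indicator \<Omega> x + (u x)\<^sup>2 + (v x)\<^sup>2) \<partial>lborel)"
    by (rule integral_mono[OF gi i]) (rule le)
  also have "\<dots> = 3 * (dom_vol + nsq u + nsq v)"
    using integrable_dom H0_D(3)[OF u] H0_D(3)[OF v] by (simp add: dom_vol_def nsq_def)
  finally show "(\<integral>x. (g x)\<^sup>2 \<partial>lborel) \<le> 3 * (dom_vol + nsq u + nsq v)" .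
qed

lemma trunc_diff:
  assumes L: "L \<ge> 1" and u: "u \<in> H0_ln \<Omega>" and v: "v \<in> H0_ln \<Omega>"
  shows "integrable lborel (\<lambda>x. sqln_trunc L (u x) - sqln_trunc L (v x))"
    "\<bar>\<integral>x. sqln_trunc L (u x) - sqln_trunc L (v x) \<partial>lborel\<bar> \<le> (4 + 2 * ln (L\<^sup>2)) * (sqrt (nsq (\<lambda>x. u x - v x)) * sqrt (3 * (dom_vol + nsq u + nsq v)))"
proof -
  note [measurable] = H0_D(2)[OF u] H0_D(2)[OF v]
  have lL: "ln (L\<^sup>2) \<ge> 0" using L by (intro ln_ge_zero) auto
  define g where "g x = indicator \<Omega> x + \<bar>u x\<bar> + \<bar>v x\<bar>" for x
  note g = weight_integrable[OF u v, folded g_def]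
  note [measurable] = g(1)
  note cs = integral_Cauchy_Schwarz[of "\<lambda>x. u x - v x" lborel g, simplified, OF H0_D(3)[OF H0_diff[OF u v]] g(2)]
  let ?C = "4 + 2 * ln (L\<^sup>2)"
  have ae: "AE x in lborel. \<bar>sqln_trunc L (u x) - sqln_trunc L (v x)\<bar> \<le> ?C * \<bar>(u x - v x) * g x\<bar>"
    using H0_D(4)[OF u] H0_D(4)[OF v]
  proof eventually_elim
    case (elim x)
    have g0: "g x \<ge> 0" by (simp add: g_def)
    show ?case
    proof (cases "x \<in> \<Omega>")
      case True
      then have "1 + \<bar>u x\<bar> + \<bar>v x\<bar> = g x" by (simp add: g_def)
      then show ?thesis using sqln_trunc_lipschitz[OF L, of "u x" "v x"] g0 by (simp add: abs_mult)
    next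
      case False
      then show ?thesis using elim by simp
    qed
  qed
  have i: "integrable lborel (\<lambda>x. ?C * \<bar>(u x - v x) * g x\<bar>)" using integrable_abs[OF cs(1)] by simp
  show ti: "integrable lborel (\<lambda>x. sqln_trunc L (u x) - sqln_trunc L (v x))"
    by (rule Bochner_Integration.integrable_bound[OF i]) (measurable, use ae in eventually_elim, use lL in simp)
  have "\<bar>\<integral>x. sqln_trunc L (u x) - sqln_trunc L (v x) \<partial>lborel\<bar> \<le> (\<integral>x. \<bar>sqln_trunc L (u x) - sqln_trunc L (v x)\<bar> \<partial>lborel)"
    by (rule integral_abs_bound)
  also have "\<dots> \<le> (\<integral>x. ?C * \<bar>(u x - v x) * g x\<bar> \<partial>lborel)"
    by (rule integral_mono_AE[OF integrable_abs[OF ti] i ae])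
  also have "\<dots> = ?C * (\<integral>x. \<bar>(u x - v x) * g x\<bar> \<partial>lborel)" by simp
  also have "\<dots> \<le> ?C * (sqrt (nsq (\<lambda>x. u x - v x)) * sqrt (\<integral>x. (g x)\<^sup>2 \<partial>lborel))"
    using cs(2) lL unfolding nsq_def by (intro mult_left_mono) auto
  also have "\<dots> \<le> ?C * (sqrt (nsq (\<lambda>x. u x - v x)) * sqrt (3 * (dom_vol + nsq u + nsq v)))"
    using g(3) lL by (intro mult_left_mono) auto
  finally show "\<bar>\<integral>x. sqln_trunc L (u x) - sqln_trunc L (v x) \<partial>lborel\<bar> \<le> ?C * (sqrt (nsq (\<lambda>x. u x - v x)) * sqrt (3 * (dom_vol + nsq u + nsq v)))" .
qed

lemma H0_zero: "(\<lambda>x. 0) \<in> H0_ln \<Omega>"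
  by (rule H0_I) (auto simp: energy_on_def)

lemma trunc_integrable: assumes "L \<ge> 1" "u \<in> H0_ln \<Omega>" shows "integrable lborel (\<lambda>x. sqln_trunc L (u x))"
  using trunc_diff(1)[OF assms H0_zero] by (simp add: sqln_trunc_def)

lemma tail_le_energy:
  assumes k: "0 < \<kappa>" "\<kappa> < 4 / real DIM('a)" and \<delta>: "\<delta> > 0" and S: "S \<ge> 0"
  shows "\<exists>L\<ge>1. \<forall>u\<in>H0_ln \<Omega>. nsq u \<le> S \<longrightarrow> integrable lborel (\<lambda>x. sqln_tail L (u x)) \<and>
     ennreal (\<kappa> * (\<integral>x. sqln_tail L (u x) \<partial>lborel)) \<le> energy_on (ball 0 \<delta>) u"
proof -
  obtain L where L: "L \<ge> 1" and *: "\<And>u::'a \<Rightarrow> real. u \<in> borel_measurable borel \<Longrightarrow> (\<integral>\<^sup>+x. ennreal ((u x)\<^sup>2) \<partial>lborel) \<le> ennreal S \<Longrightarrow>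
     (\<integral>\<^sup>+x. ennreal (\<kappa> * ((u x)\<^sup>2 * max 0 (ln ((u x)\<^sup>2 / L\<^sup>2)))) \<partial>lborel) \<le> energy_on (ball 0 \<delta>) u"
    using log_sobolev[OF k \<delta> S] by blast
  have "integrable lborel (\<lambda>x. sqln_tail L (u x)) \<and> ennreal (\<kappa> * (\<integral>x. sqln_tail L (u x) \<partial>lborel)) \<le> energy_on (ball 0 \<delta>) u"
    if u: "u \<in> H0_ln \<Omega>" and S': "nsq u \<le> S" for u
  proof -
    note [measurable] = H0_D(2)[OF u]
    have le: "(\<integral>\<^sup>+x. ennreal (\<kappa> * sqln_tail L (u x)) \<partial>lborel) \<le> energy_on (ball 0 \<delta>) u"
      unfolding sqln_tail_def using S' by (intro * ) (auto simp: H0_D(8)[OF u] ennreal_leI)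
    also have le2: "\<dots> \<le> energy_on UNIV u" by (rule energy_on_subset) simp
    also have "\<dots> < \<infinity>" by (rule H0_D(6)[OF u])
    finally have i: "integrable lborel (\<lambda>x. \<kappa> * sqln_tail L (u x))"
      using k sqln_tail_nonneg by (intro integrableI_nonneg) auto
    then have i2: "integrable lborel (\<lambda>x. sqln_tail L (u x))" using k by simp
    have "ennreal (\<kappa> * (\<integral>x. sqln_tail L (u x) \<partial>lborel)) = (\<integral>\<^sup>+x. ennreal (\<kappa> * sqln_tail L (u x)) \<partial>lborel)"
      using i k sqln_tail_nonneg by (subst nn_integral_eq_integral) auto
    then show ?thesis using le i2 by simp
  qed
  then show ?thesis using L by blast
qed

lemma sqln_integrable: assumes u: "u \<in> H0_ln \<Omega>" shows "integrable lborel (\<lambda>x. sqln (u x))"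
proof -
  have "(2::real) / real DIM('a) < 4 / real DIM('a)" by (intro divide_strict_right_mono) auto
  then obtain L where L: "L \<ge> 1" "integrable lborel (\<lambda>x. sqln_tail L (u x))"
    using tail_le_energy[of "2 / real DIM('a)" 1 "nsq u"] u by auto
  then have "integrable lborel (\<lambda>x. sqln_trunc L (u x) + sqln_tail L (u x))"
    using trunc_integrable[OF L(1) u] by simp
  then show ?thesis using sqln_split[of L] L by simp
qed

lemma tail_integrable: assumes L: "L \<ge> 1" and u: "u \<in> H0_ln \<Omega>" shows "integrable lborel (\<lambda>x. sqln_tail L (u x))"
proof -
  have "(\<lambda>x. sqln_tail L (u x)) = (\<lambda>x. sqln (u x) - sqln_trunc L (u x))" using sqln_split[of L] L by auto
  then show ?thesis using sqln_integrable[OF u] trunc_integrable[OF L u] by simp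
qed

lemma ent_split: assumes L: "L \<ge> 1" and u: "u \<in> H0_ln \<Omega>"
  shows "ent u = (\<integral>x. sqln_trunc L (u x) \<partial>lborel) + (\<integral>x. sqln_tail L (u x) \<partial>lborel)"
  unfolding ent_def using sqln_split[of L] L trunc_integrable[OF L u] tail_integrable[OF L u] by simp

lemma ent_cmult: assumes u: "u \<in> H0_ln \<Omega>" and c: "c \<noteq> 0"
  shows "ent (\<lambda>x. c * u x) = c\<^sup>2 * ent u + c\<^sup>2 * ln (c\<^sup>2) * nsq u"
proof -
  have "sqln (c * s) = c\<^sup>2 * sqln s + c\<^sup>2 * ln (c\<^sup>2) * s\<^sup>2" for s
    using c by (cases "s = 0") (auto simp: sqln_def power_mult_distrib ln_mult algebra_simps)
  then show ?thesis unfolding ent_def nsq_def using sqln_integrable[OF u] H0_D(3)[OF u] by simp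
qed

lemma nsq_diff_tendsto:
  assumes v: "\<And>n. v n \<in> H0_ln \<Omega>" and w: "w \<in> H0_ln \<Omega>" and lim: "(\<lambda>n. nsq (\<lambda>x. v n x - w x)) \<longlonglongrightarrow> 0"
  shows "(\<lambda>n. nsq (v n)) \<longlonglongrightarrow> nsq w"
proof -
  let ?d = "\<lambda>n x. v n x - w x"
  have "nsq (v n) - nsq w = nsq (?d n) + 2 * (\<integral>x. w x * ?d n x \<partial>lborel)" for n
    using nsq_add_cmult[OF w H0_diff[OF v[of n] w], of 1] by simp
  then have le: "norm (nsq (v n) - nsq w) \<le> nsq (?d n) + 2 * (sqrt (nsq w) * sqrt (nsq (?d n)))" for n
    using integral_Cauchy_Schwarz(3)[of w lborel "?d n"] H0_D[OF w] H0_D[OF H0_diff[OF v[of n] w]]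
    by (auto simp: nsq_def[symmetric] intro!: order_trans[OF abs_triangle_ineq])
  have "(\<lambda>n. nsq (?d n) + 2 * (sqrt (nsq w) * sqrt (nsq (?d n)))) \<longlonglongrightarrow> 0 + 2 * (sqrt (nsq w) * sqrt 0)"
    by (intro tendsto_intros lim)
  then have "(\<lambda>n. nsq (v n) - nsq w) \<longlonglongrightarrow> 0"
    by (intro Lim_null_comparison[OF always_eventually[OF allI[OF le]]]) simp
  then show ?thesis by (rule LIM_zero_cancel)
qed

lemma trunc_tendsto:
  assumes L: "L \<ge> 1" and v: "\<And>n. v n \<in> H0_ln \<Omega>" and w: "w \<in> H0_ln \<Omega>" and lim: "(\<lambda>n. nsq (\<lambda>x. v n x - w x)) \<longlonglongrightarrow> 0"
  shows "(\<lambda>n. \<integral>x. sqln_trunc L (v n x) \<partial>lborel) \<longlonglongrightarrow> (\<integral>x. sqln_trunc L (w x) \<partial>lborel)"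
proof -
  let ?b = "\<lambda>n. (4 + 2 * ln (L\<^sup>2)) * (sqrt (nsq (\<lambda>x. v n x - w x)) * sqrt (3 * (dom_vol + nsq (v n) + nsq w)))"
  have le: "norm ((\<integral>x. sqln_trunc L (v n x) \<partial>lborel) - (\<integral>x. sqln_trunc L (w x) \<partial>lborel)) \<le> ?b n" for n
    using trunc_diff(2)[OF L v[of n] w] trunc_integrable[OF L v[of n]] trunc_integrable[OF L w] by simp
  have "?b \<longlonglongrightarrow> (4 + 2 * ln (L\<^sup>2)) * (sqrt 0 * sqrt (3 * (dom_vol + nsq w + nsq w)))"
    by (intro tendsto_intros lim nsq_diff_tendsto v w)
  then have "(\<lambda>n. (\<integral>x. sqln_trunc L (v n x) \<partial>lborel) - (\<integral>x. sqln_trunc L (w x) \<partial>lborel)) \<longlonglongrightarrow> 0"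
    by (intro Lim_null_comparison[OF always_eventually[OF allI[OF le]]]) simp
  then show ?thesis by (rule LIM_zero_cancel)
qed

text \<open>Convergence in energy implies convergence of the entropy: the truncated part converges by \<open>L\<^sup>2\<close>
convergence, and the tail is bounded by the energy of close pairs, which is small for the limit and
hence uniformly small along the sequence.\<close>

lemma energy_tendsto:
  assumes v: "\<And>n. v n \<in> H0_ln \<Omega>" and w: "w \<in> H0_ln \<Omega>" and lim: "(\<lambda>n. E_omega (\<lambda>x. v n x - w x) (\<lambda>x. v n x - w x)) \<longlonglongrightarrow> 0"
  shows "(\<lambda>n. nsq (\<lambda>x. v n x - w x)) \<longlonglongrightarrow> 0" "(\<lambda>n. E_omega (v n) (v n)) \<longlonglongrightarrow> E_omega w w" "(\<lambda>n. ent (v n)) \<longlonglongrightarrow> ent w"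
proof -
  let ?d = "\<lambda>n x. v n x - w x"
  note d = H0_diff[OF v w]
  obtain C where C: "C > 0" "\<And>u. u \<in> H0_ln \<Omega> \<Longrightarrow> nsq u \<le> C * E_omega u u" using nsq_poincare by blast
  show n0: "(\<lambda>n. nsq (?d n)) \<longlonglongrightarrow> 0"
  proof (rule Lim_null_comparison)
    show "\<forall>\<^sub>F n in sequentially. norm (nsq (?d n)) \<le> C * E_omega (?d n) (?d n)"
      using C(2)[OF d] by simp
    show "(\<lambda>n. C * E_omega (?d n) (?d n)) \<longlonglongrightarrow> 0" using tendsto_mult_left[OF lim, of C] by simp
  qed
  have "E_omega (v n) (v n) - E_omega w w = E_omega (?d n) (?d n) + 2 * E_omega w (?d n)" for n
    using E_omega_add_cmult[OF w d[of n], of 1] by simp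
  then have le: "norm (E_omega (v n) (v n) - E_omega w w) \<le> E_omega (?d n) (?d n) + 2 * (sqrt (E_omega w w) * sqrt (E_omega (?d n) (?d n)))" for n
    using E_integrable(2)[OF w d[of n]] H0_D(7)[OF d[of n]] by (auto intro!: order_trans[OF abs_triangle_ineq])
  have "(\<lambda>n. E_omega (?d n) (?d n) + 2 * (sqrt (E_omega w w) * sqrt (E_omega (?d n) (?d n)))) \<longlonglongrightarrow> 0 + 2 * (sqrt (E_omega w w) * sqrt 0)"
    by (intro tendsto_intros lim)
  then have "(\<lambda>n. E_omega (v n) (v n) - E_omega w w) \<longlonglongrightarrow> 0"
    by (intro Lim_null_comparison[OF always_eventually[OF allI[OF le]]]) simp
  then show "(\<lambda>n. E_omega (v n) (v n)) \<longlonglongrightarrow> E_omega w w" by (rule LIM_zero_cancel)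
  have nv: "(\<lambda>n. nsq (v n)) \<longlonglongrightarrow> nsq w" by (rule nsq_diff_tendsto[OF v w n0])
  define \<kappa> where "\<kappa> = 2 / real DIM('a)"
  have k: "0 < \<kappa>" "\<kappa> < 4 / real DIM('a)" by (auto simp: \<kappa>_def intro!: divide_strict_right_mono)
  show "(\<lambda>n. ent (v n)) \<longlonglongrightarrow> ent w"
  proof (rule LIMSEQ_I)
    fix e :: real assume e: "e > 0"
    \<comment> \<open>Energy at most \<open>e1\<close> of close pairs for the limit leaves at most \<open>6 e1\<close> for the sequence, hence tails below \<open>e / 16 + 6 e / 16\<close>.\<close>
    define e1 where "e1 = \<kappa> * e / 16"
    have e1: "e1 > 0" using e k by (simp add: e1_def)
    obtain \<delta> where \<delta>: "\<delta> > 0" "energy_on (ball 0 \<delta>) w \<le> ennreal e1"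
      using energy_near_small[OF H0_D(2)[OF w] H0_D(6)[OF w] e1] by blast
    obtain L where L: "L \<ge> 1" and tl: "\<And>u. u \<in> H0_ln \<Omega> \<Longrightarrow> nsq u \<le> nsq w + 1 \<Longrightarrow> ennreal (\<kappa> * (\<integral>x. sqln_tail L (u x) \<partial>lborel)) \<le> energy_on (ball 0 \<delta>) u"
      using tail_le_energy[OF k \<delta>(1), of "nsq w + 1"] by auto
    have tw: "(\<integral>x. sqln_tail L (w x) \<partial>lborel) \<le> e / 16"
    proof -
      have "ennreal (\<kappa> * (\<integral>x. sqln_tail L (w x) \<partial>lborel)) \<le> ennreal e1" using order_trans[OF tl[OF w] \<delta>(2)] by simp
      then show ?thesis using k e1 by (simp add: e1_def)
    qed
    have 1: "\<forall>\<^sub>F n in sequentially. nsq (v n) < nsq w + 1" using nv by (rule order_tendstoD) simp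
    have 2: "\<forall>\<^sub>F n in sequentially. E_omega (?d n) (?d n) < e1" using lim e1 by (rule order_tendstoD)
    have 3: "\<forall>\<^sub>F n in sequentially. \<bar>(\<integral>x. sqln_trunc L (v n x) \<partial>lborel) - (\<integral>x. sqln_trunc L (w x) \<partial>lborel)\<bar> < e / 4"
      using tendstoD[OF trunc_tendsto[OF L v w n0], of "e/4"] e by (simp add: dist_real_def)
    have "\<forall>\<^sub>F n in sequentially. norm (ent (v n) - ent w) < e"
      using 1 2 3
    proof eventually_elim
      case (elim n)
      have "energy_on (ball 0 \<delta>) (v n) \<le> ennreal 2 * (energy_on (ball 0 \<delta>) w + energy_on (ball 0 \<delta>) (?d n))"
      proof (rule energy_on_le_sum)
        fix x y
        have "v n x - v n y = (w x - w y) + (?d n x - ?d n y)" by simp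
        then show "(v n x - v n y)\<^sup>2 \<le> 2 * ((w x - w y)\<^sup>2 + (?d n x - ?d n y)\<^sup>2)"
          using sum_squares_bound[of "w x - w y" "?d n x - ?d n y"] by (simp only: power2_sum) simp
      qed (use H0_D(2)[OF w] H0_D(2)[OF d] in auto)
      also have "\<dots> \<le> ennreal 2 * (ennreal e1 + ennreal (2 * e1))"
      proof (intro mult_left_mono add_mono \<delta>(2))
        have "energy_on (ball 0 \<delta>) (?d n) \<le> energy_on UNIV (?d n)" by (rule energy_on_subset) simp
        also have "\<dots> \<le> ennreal (2 * e1)" using elim(2) by (simp add: H0_D(9)[OF d] ennreal_leI)
        finally show "energy_on (ball 0 \<delta>) (?d n) \<le> ennreal (2 * e1)" .
      qed simp
      also have "\<dots> = ennreal (2 * (e1 + 2 * e1))" using e1 by (simp only: ennreal_mult ennreal_plus less_imp_le mult_nonneg_nonneg add_nonneg_nonneg zero_le_numeral)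
      finally have "ennreal (\<kappa> * (\<integral>x. sqln_tail L (v n x) \<partial>lborel)) \<le> ennreal (2 * (e1 + 2 * e1))"
        using tl[OF v[of n]] elim(1) by auto
      then have "\<kappa> * (\<integral>x. sqln_tail L (v n x) \<partial>lborel) \<le> 6 * e1" using e1 by simp
      then have "(\<integral>x. sqln_tail L (v n x) \<partial>lborel) \<le> 6 * e / 16" using k by (simp add: e1_def field_simps)
      moreover have "0 \<le> (\<integral>x. sqln_tail L (v n x) \<partial>lborel)" "0 \<le> (\<integral>x. sqln_tail L (w x) \<partial>lborel)"
        by (auto intro!: integral_nonneg_AE AE_I2 sqln_tail_nonneg)
      ultimately show ?case using elim(3) tw e unfolding ent_split[OF L v] ent_split[OF L w] by (simp add: abs_if split: if_splits)
    qed
    then show "\<exists>N. \<forall>n\<ge>N. norm (ent (v n) - ent w) < e" by (simp add: eventually_sequentially)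
  qed
qed

text \<open>Dominated convergence. With \<open>w = |u| + |p|\<close>, the mean value theorem bounds the difference
quotients by a combination of \<open>w\<close>, \<open>w\<^sup>2\<close> and \<open>w\<^sup>2 ln w\<^sup>2\<close> on \<open>{w > 1}\<close>, which is integrable because
\<open>w\<close> lies in the energy space.\<close>

lemma ent_directional_derivative:
  assumes u: "u \<in> H0_ln \<Omega>" and p: "p \<in> H0_ln \<Omega>"
  shows "integrable lborel (\<lambda>x. u x * p x * ln ((u x)\<^sup>2))"
    "(\<lambda>n. (ent (\<lambda>x. u x + inverse (real (Suc n)) * p x) - ent u) / inverse (real (Suc n)))
       \<longlonglongrightarrow> 2 * (\<integral>x. u x * p x * ln ((u x)\<^sup>2) \<partial>lborel) + 2 * (\<integral>x. u x * p x \<partial>lborel)"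
proof -
  note [measurable] = H0_D(2)[OF u] H0_D(2)[OF p]
  let ?\<tau> = "\<lambda>n. inverse (real (Suc n))"
  let ?s = "\<lambda>n x. (sqln (u x + ?\<tau> n * p x) - sqln (u x)) / ?\<tau> n"
  let ?f = "\<lambda>x. (2 * u x * ln ((u x)\<^sup>2) + 2 * u x) * p x"
  define w where "w x = \<bar>u x\<bar> + \<bar>p x\<bar>" for x
  have w: "w \<in> H0_ln \<Omega>" unfolding w_def by (rule H0_abs_add[OF u p])
  note [measurable] = H0_D(2)[OF w]
  define g where "g x = 4 * w x + 2 * sqln_tail 1 (w x) + 2 * (w x)\<^sup>2" for x
  have gi: "integrable lborel g"
    unfolding g_def using integrable_H0[OF w] tail_integrable[OF _ w, of 1] H0_D(3)[OF w] by simp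
  have w0: "w x \<ge> 0" for x by (simp add: w_def)
  have \<tau>: "?\<tau> n > 0" "?\<tau> n \<le> 1" for n by (auto simp: inverse_le_1_iff)
  have bound: "norm (?s n x) \<le> g x" for n x
  proof -
    have "\<bar>?\<tau> n * p x\<bar> \<le> \<bar>p x\<bar>" using \<tau>[of n] by (auto simp: abs_mult intro!: mult_left_le_one_le)
    then have "\<bar>u x + ?\<tau> n * p x\<bar> \<le> w x" "\<bar>u x\<bar> \<le> w x" by (auto simp: w_def)
    then have "\<bar>sqln (u x + ?\<tau> n * p x) - sqln (u x)\<bar> \<le> \<bar>?\<tau> n * p x\<bar> * (4 + 2 * (w x * max 0 (ln ((w x)\<^sup>2))) + 2 * w x)"
      using sqln_diff_bound[of "u x + ?\<tau> n * p x" "w x" "u x"] by simp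
    also have "\<dots> = ?\<tau> n * (\<bar>p x\<bar> * (4 + 2 * (w x * max 0 (ln ((w x)\<^sup>2))) + 2 * w x))"
      using \<tau>[of n] by (simp add: abs_mult)
    finally have "norm (?s n x) \<le> \<bar>p x\<bar> * (4 + 2 * (w x * max 0 (ln ((w x)\<^sup>2))) + 2 * w x)"
      using \<tau>(1)[of n] by (simp only: real_norm_def abs_divide abs_of_pos pos_divide_le_eq mult.commute)
    also have "\<dots> \<le> w x * (4 + 2 * (w x * max 0 (ln ((w x)\<^sup>2))) + 2 * w x)"
      using w0[of x] by (intro mult_right_mono) (auto simp: w_def)
    also have "\<dots> = g x" by (simp add: g_def sqln_tail_def algebra_simps power2_eq_square)
    finally show ?thesis .
  qed
  have lim: "(\<lambda>n. ?s n x) \<longlonglongrightarrow> ?f x" for x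
  proof -
    have "DERIV (\<lambda>t. sqln (u x + t * p x)) 0 :> (2 * (u x + 0 * p x) * ln ((u x + 0 * p x)\<^sup>2) + 2 * (u x + 0 * p x)) * p x"
      by (rule DERIV_chain2[OF DERIV_sqln]) (auto intro!: derivative_eq_intros)
    then have "((\<lambda>h. (sqln (u x + h * p x) - sqln (u x)) / h) \<longlongrightarrow> ?f x) (at 0)"
      by (simp add: DERIV_def)
    moreover have "filterlim ?\<tau> (at 0) sequentially"
      by (rule filterlim_atI[OF LIMSEQ_inverse_real_of_nat]) simp
    ultimately show ?thesis by (rule filterlim_compose)
  qed
  have fm: "?f \<in> borel_measurable lborel" by measurable
  have sm: "?s n \<in> borel_measurable lborel" for n by measurable
  have fi: "integrable lborel ?f"
    by (rule integrable_dominated_convergence[OF fm sm gi AE_I2[OF lim] AE_I2[OF bound]])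
  have conv: "(\<lambda>n. \<integral>x. ?s n x \<partial>lborel) \<longlonglongrightarrow> (\<integral>x. ?f x \<partial>lborel)"
    by (rule integral_dominated_convergence[OF fm sm gi AE_I2[OF lim] AE_I2[OF bound]])
  have pi: "integrable lborel (\<lambda>x. u x * p x)" by (rule integrable_prod[OF u p])
  have "integrable lborel (\<lambda>x. (?f x - 2 * (u x * p x)) / 2)" using fi pi by simp
  moreover have e: "(\<lambda>x. (?f x - 2 * (u x * p x)) / 2) = (\<lambda>x. u x * p x * ln ((u x)\<^sup>2))" by (auto simp: algebra_simps)
  ultimately show i: "integrable lborel (\<lambda>x. u x * p x * ln ((u x)\<^sup>2))" by simp
  have "?f = (\<lambda>x. 2 * (u x * p x * ln ((u x)\<^sup>2)) + 2 * (u x * p x))" by (auto simp: algebra_simps)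
  then have If: "(\<integral>x. ?f x \<partial>lborel) = 2 * (\<integral>x. u x * p x * ln ((u x)\<^sup>2) \<partial>lborel) + 2 * (\<integral>x. u x * p x \<partial>lborel)"
    using i pi by simp
  have "(\<integral>x. ?s n x \<partial>lborel) = (ent (\<lambda>x. u x + ?\<tau> n * p x) - ent u) / ?\<tau> n" for n
    unfolding ent_def using sqln_integrable[OF u] sqln_integrable[OF H0_add[OF u H0_cmult[OF p, of "?\<tau> n"]]]
    by (simp only: integral_divide_zero Bochner_Integration.integral_diff)
  then show "(\<lambda>n. (ent (\<lambda>x. u x + ?\<tau> n * p x) - ent u) / ?\<tau> n)
       \<longlonglongrightarrow> 2 * (\<integral>x. u x * p x * ln ((u x)\<^sup>2) \<partial>lborel) + 2 * (\<integral>x. u x * p x \<partial>lborel)"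
    using conv unfolding If by simp
qed

text \<open>A Lipschitz bump on a ball contained in the domain. Its energy density is bounded by a multiple
of \<open>min 1 (|z|\<^sup>2) J(z)\<close>, and only pairs with a point in the ball contribute.\<close>

lemma H0_nontrivial: "\<exists>u\<in>H0_ln \<Omega>. nsq u > 0"
proof -
  obtain p where "p \<in> \<Omega>" using nonempty_dom by auto
  then obtain r where r: "r > 0" "ball p r \<subseteq> \<Omega>" using open_dom open_contains_ball by metis
  define B where "B = ball p r"
  have [measurable]: "B \<in> sets borel" by (simp add: B_def)
  have Bfin: "emeasure lborel B < \<infinity>" unfolding B_def by (rule emeasure_bounded_finite) simp
  define u where "u x = max 0 (r - norm (x - p))" for x
  have [measurable]: "u \<in> borel_measurable borel" unfolding u_def by measurable
  have out: "u x = 0" if "x \<notin> B" for x using that by (simp add: u_def B_def dist_norm norm_minus_commute)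
  have u0: "0 \<le> u x" "u x \<le> r" for x using r by (auto simp: u_def)
  have lip: "\<bar>u x - u y\<bar> \<le> norm (x - y)" for x y
  proof -
    have "\<bar>u x - u y\<bar> \<le> \<bar>norm (x - p) - norm (y - p)\<bar>" by (auto simp: u_def max_def)
    also have "\<dots> \<le> norm (x - y)" using norm_triangle_ineq3[of "x - p" "y - p"] by simp
    finally show ?thesis .
  qed
  define C where "C = max 1 (r\<^sup>2)"
  have C: "C > 0" by (simp add: C_def less_max_iff_disj)
  have le: "(u x - u y)\<^sup>2 \<le> C * min 1 ((norm (x - y))\<^sup>2)" for x y
  proof -
    have 1: "(u x - u y)\<^sup>2 \<le> (norm (x - y))\<^sup>2" using lip[of x y] power_mono[OF lip[of x y], of 2] by simp
    have "\<bar>u x - u y\<bar> \<le> r" using u0[of x] u0[of y] by linarith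
    then have 2: "(u x - u y)\<^sup>2 \<le> r\<^sup>2" using power_mono[of "\<bar>u x - u y\<bar>" r 2] by simp
    show ?thesis
    proof (cases "1 \<le> (norm (x - y))\<^sup>2")
      case True
      then show ?thesis using 2 by (simp add: C_def)
    next
      case False
      have "1 * (norm (x - y))\<^sup>2 \<le> C * (norm (x - y))\<^sup>2" by (intro mult_right_mono) (auto simp: C_def)
      then show ?thesis using 1 False by (simp add: min_def)
    qed
  qed
  define j where "j z = ennreal (C * (min 1 ((norm z)\<^sup>2) * J_kernel z))" for z :: 'a
  have [measurable]: "j \<in> borel_measurable borel" unfolding j_def by measurable
  define I where "I = (\<integral>\<^sup>+z. j z \<partial>lborel)"
  have I: "I < \<infinity>"
  proof -
    have "I = ennreal C * (\<integral>\<^sup>+z. ennreal (min 1 ((norm z)\<^sup>2) * J_kernel z) \<partial>(lborel :: 'a measure))"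
      unfolding I_def j_def using C by (subst nn_integral_cmult[symmetric]) (auto simp: ennreal_mult' intro!: nn_integral_cong)
    then show ?thesis using nn_integral_J_min[where 'a='a] by (simp add: ennreal_mult_less_top)
  qed
  have Bi: "(\<integral>\<^sup>+z. indicator B (fst z) * j (fst z - snd z) \<partial>(lborel \<Otimes>\<^sub>M lborel)) = emeasure lborel B * I"
  proof -
    have "(\<integral>\<^sup>+z. indicator B (fst z) * j (fst z - snd z) \<partial>(lborel \<Otimes>\<^sub>M lborel)) = (\<integral>\<^sup>+x. \<integral>\<^sup>+y. indicator B x * j (x - y) \<partial>lborel \<partial>lborel)"
      by (subst nn_integral_pair) auto
    also have "\<dots> = (\<integral>\<^sup>+x. I * indicator B x \<partial>lborel)"
      unfolding I_def by (intro nn_integral_cong) (subst nn_integral_cmult, auto simp: nn_integral_lborel_reflect mult.commute)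
    also have "\<dots> = I * emeasure lborel B" by (rule nn_integral_cmult_indicator) simp
    finally show ?thesis by (simp add: mult.commute)
  qed
  have Bi2: "(\<integral>\<^sup>+z. indicator B (snd z) * j (snd z - fst z) \<partial>(lborel \<Otimes>\<^sub>M lborel)) = emeasure lborel B * I"
    unfolding Bi[symmetric] using nn_integral_pair_swap[of "\<lambda>z. indicator B (fst z) * j (fst z - snd z)"] by simp
  have "energy_on UNIV u \<le> (\<integral>\<^sup>+z. indicator B (fst z) * j (fst z - snd z) + indicator B (snd z) * j (snd z - fst z) \<partial>(lborel \<Otimes>\<^sub>M lborel))"
    unfolding energy_on_def
  proof (intro nn_integral_mono)
    fix z :: "'a \<times> 'a"
    have js: "j (snd z - fst z) = j (fst z - snd z)" by (simp add: j_def norm_minus_commute J_kernel_sym)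
    show "ennreal ((u (fst z) - u (snd z))\<^sup>2 * J_kernel (fst z - snd z)) * indicator UNIV (fst z - snd z)
      \<le> indicator B (fst z) * j (fst z - snd z) + indicator B (snd z) * j (snd z - fst z)"
    proof (cases "fst z \<in> B \<or> snd z \<in> B")
      case True
      have "ennreal ((u (fst z) - u (snd z))\<^sup>2 * J_kernel (fst z - snd z)) \<le> j (fst z - snd z)"
        unfolding j_def mult.assoc[symmetric] by (intro ennreal_leI mult_right_mono le) auto
      then show ?thesis using True unfolding js by (auto simp: indicator_def intro: order_trans)
    qed (auto simp: out)
  qed
  also have "\<dots> = emeasure lborel B * I + emeasure lborel B * I"
    by (subst nn_integral_add) (auto simp: Bi Bi2)
  also have "\<dots> < \<infinity>" using I Bfin by (simp add: ennreal_mult_less_top)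
  finally have efin: "energy_on UNIV u < \<infinity>" .
  have "(\<integral>\<^sup>+x. ennreal ((u x)\<^sup>2) \<partial>lborel) \<le> (\<integral>\<^sup>+x. ennreal (r\<^sup>2) * indicator B x \<partial>lborel)"
    using u0 out by (intro nn_integral_mono) (auto split: split_indicator intro!: ennreal_leI power_mono)
  also have "\<dots> = ennreal (r\<^sup>2) * emeasure lborel B" by (rule nn_integral_cmult_indicator) simp
  also have "\<dots> < \<infinity>" using Bfin by (simp add: ennreal_mult_less_top)
  finally have u: "u \<in> H0_ln \<Omega>" 
  proof (intro H0_I efin AE_I2 impI)
    show "u x = 0" if "x \<notin> \<Omega>" for x using that r(2) by (intro out) (auto simp: B_def)
  qed auto
  have "\<not> ae_zero u"
  proof
    assume "ae_zero u"
    then have "AE x in lborel. x \<notin> B" unfolding ae_zero_def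
      by eventually_elim (use r in \<open>auto simp: u_def B_def dist_norm norm_minus_commute\<close>)
    then have "emeasure lborel B = 0" by (subst (asm) AE_iff_measurable[of B]) auto
    then show False using r unit_ball_vol_pos[of "real DIM('a)"] by (simp add: B_def emeasure_ball)
  qed
  then show ?thesis using u nsq_pos by blast
qed

section \<open>Signs of minimisers and the Euler-Lagrange equation\<close>

text \<open>The energy difference between \<open>u\<close> and \<open>|u|\<close> is the integral of
\<open>(|u(x) u(y)| - u(x) u(y)) J(x - y)\<close>, whose integrand is positive on the product of \<open>{u > 0}\<close> and
\<open>{u < 0}\<close>. So this product is a null set, and one of its factors is.\<close>

lemma no_sign_change_if_abs_energy:
  assumes u: "u \<in> H0_ln \<Omega>" and le: "E_omega u u \<le> E_omega (\<lambda>x. \<bar>u x\<bar>) (\<lambda>x. \<bar>u x\<bar>)"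
  shows "no_sign_change \<Omega> u"
proof -
  note [measurable] = H0_D(2)[OF u]
  note ua = H0_abs[OF u]
  let ?P = "lborel \<Otimes>\<^sub>M lborel :: ('a \<times> 'a) measure"
  let ?d = "\<lambda>z. E_integrand u u z - E_integrand (\<lambda>x. \<bar>u x\<bar>) (\<lambda>x. \<bar>u x\<bar>) z"
  have d: "?d z = 2 * (\<bar>u (fst z) * u (snd z)\<bar> - u (fst z) * u (snd z)) * J_kernel (fst z - snd z)" for z
    by (auto simp: E_integrand_def algebra_simps abs_mult split: prod.split)
  have d0: "?d z \<ge> 0" for z unfolding d by (intro mult_nonneg_nonneg) auto
  have i: "integrable ?P ?d" using H0_D(5)[OF u] H0_D(5)[OF ua] by simp
  have "(\<integral>z. ?d z \<partial>?P) = 2 * (E_omega u u - E_omega (\<lambda>x. \<bar>u x\<bar>) (\<lambda>x. \<bar>u x\<bar>))"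
    unfolding E_omega_def using H0_D(5)[OF u] H0_D(5)[OF ua] by simp
  then have "(\<integral>z. ?d z \<partial>?P) = 0" using le integral_nonneg_AE[of ?d ?P] d0 by simp
  then have ae: "AE z in ?P. ?d z = 0" using integral_nonneg_eq_0_iff_AE[OF i] d0 by simp
  define A where "A = {x. u x > 0}"
  define B where "B = {x. u x < 0}"
  have AB[measurable]: "A \<in> sets lborel" "B \<in> sets lborel" unfolding A_def B_def by measurable
  have "AE z in ?P. z \<notin> A \<times> B"
    using ae
  proof eventually_elim
    case (elim z)
    show ?case
    proof
      assume z: "z \<in> A \<times> B"
      then have ab: "u (fst z) > 0" "u (snd z) < 0" by (auto simp: A_def B_def)
      then have "fst z \<noteq> snd z" by auto
      then have "J_kernel (fst z - snd z) > 0" by (intro J_kernel_pos) simp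
      moreover have "u (fst z) * u (snd z) < 0" using ab by (rule mult_pos_neg)
      ultimately have "0 < ?d z" unfolding d by (intro mult_pos_pos) auto
      then show False using elim by simp
    qed
  qed
  moreover have "A \<times> B \<in> sets ?P" by (rule pair_measureI) measurable
  ultimately have "emeasure ?P (A \<times> B) = 0"
    using AE_iff_measurable[of "A \<times> B" ?P "\<lambda>z. z \<notin> A \<times> B"] by (simp add: space_pair_measure)
  then have "emeasure lborel A * emeasure lborel B = 0"
    using lborel.emeasure_pair_measure_Times[OF AB] by simp
  then consider "emeasure lborel A = 0" | "emeasure lborel B = 0" by auto
  then show ?thesis
  proof cases
    case 1
    then have "AE x in lborel. x \<notin> A" using AB by (subst AE_iff_measurable[of A]) auto
    then have "AE x in lborel. x \<in> \<Omega> \<longrightarrow> u x \<le> 0" by eventually_elim (auto simp: A_def)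
    then show ?thesis by (simp add: no_sign_change_def)
  next
    case 2
    then have "AE x in lborel. x \<notin> B" using AB by (subst AE_iff_measurable[of B]) auto
    then have "AE x in lborel. x \<in> \<Omega> \<longrightarrow> u x \<ge> 0" by eventually_elim (auto simp: B_def)
    then show ?thesis by (simp add: no_sign_change_def)
  qed
qed

lemma E_omega_abs_le: assumes u: "u \<in> H0_ln \<Omega>" shows "E_omega (\<lambda>x. \<bar>u x\<bar>) (\<lambda>x. \<bar>u x\<bar>) \<le> E_omega u u"
proof -
  have "energy_on UNIV (\<lambda>x. \<bar>u x\<bar>) \<le> energy_on UNIV u"
    by (rule energy_on_mono) (simp add: abs_le_square_iff[symmetric] abs_triangle_ineq3)
  then show ?thesis using H0_D(7,9)[OF u] H0_D(7,9)[OF H0_abs[OF u]] by simp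
qed

lemma J_ln_abs_le: assumes u: "u \<in> H0_ln \<Omega>" shows "J_ln \<Omega> l k (\<lambda>x. \<bar>u x\<bar>) \<le> J_ln \<Omega> l k u"
    "nsq (\<lambda>x. \<bar>u x\<bar>) = nsq u"
proof -
  show n: "nsq (\<lambda>x. \<bar>u x\<bar>) = nsq u" by (simp add: nsq_def)
  have "ent (\<lambda>x. \<bar>u x\<bar>) = ent u" by (simp add: ent_def)
  then show "J_ln \<Omega> l k (\<lambda>x. \<bar>u x\<bar>) \<le> J_ln \<Omega> l k u"
    using E_omega_abs_le[OF u] by (simp add: J_ln_eq[OF u] J_ln_eq[OF H0_abs[OF u]] n)
qed

lemma minimal_no_sign_change:
  assumes u: "u \<in> H0_ln \<Omega>" and le: "J_ln \<Omega> l k u \<le> J_ln \<Omega> l k (\<lambda>x. \<bar>u x\<bar>)"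
  shows "no_sign_change \<Omega> u"
proof (rule no_sign_change_if_abs_energy[OF u])
  have "ent (\<lambda>x. \<bar>u x\<bar>) = ent u" by (simp add: ent_def)
  then show "E_omega u u \<le> E_omega (\<lambda>x. \<bar>u x\<bar>) (\<lambda>x. \<bar>u x\<bar>)"
    using le by (simp add: J_ln_eq[OF u] J_ln_eq[OF H0_abs[OF u]] J_ln_abs_le(2)[OF u])
qed

text \<open>The function \<open>J_ln - h(\<parallel>\<cdot>\<parallel>\<^sup>2)\<close> is minimal at \<open>u\<close>, and the \<open>h\<close>-part is stationary there; so the
directional derivatives of \<open>J_ln\<close> are nonnegative, and by linearity zero. A constant \<open>h\<close> covers global
minimisers, a nonconstant one replaces a Lagrange multiplier for the constraint.\<close>

theorem euler_lagrange:
  assumes u: "u \<in> H0_ln \<Omega>" and low: "\<And>v. v \<in> H0_ln \<Omega> \<Longrightarrow> h (nsq v) \<le> J_ln \<Omega> l k v"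
    and eq: "J_ln \<Omega> l k u = h (nsq u)" and h: "DERIV h (nsq u) :> 0"
  shows "weak_solution \<Omega> l k u"
proof -
  define D where "D p = E_omega u p - l * (\<integral>x. u x * p x \<partial>lborel) - k / 2 * (\<integral>x. u x * p x * ln ((u x)\<^sup>2) \<partial>lborel)" for p
  have D0: "D p \<ge> 0" if p: "p \<in> H0_ln \<Omega>" for p
  proof -
    let ?\<tau> = "\<lambda>n. inverse (real (Suc n))"
    define a where "a n = (J_ln \<Omega> l k (\<lambda>x. u x + ?\<tau> n * p x) - J_ln \<Omega> l k u) / ?\<tau> n" for n
    define b where "b n = (h (nsq (\<lambda>x. u x + ?\<tau> n * p x)) - h (nsq u)) / ?\<tau> n" for n
    have \<tau>0: "?\<tau> n > 0" for n by simp
    have tn: "?\<tau> \<longlonglongrightarrow> 0" by (rule LIMSEQ_inverse_real_of_nat)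
    have v: "(\<lambda>x. u x + ?\<tau> n * p x) \<in> H0_ln \<Omega>" for n by (intro H0_add H0_cmult u p)
    have ba: "b n \<le> a n" for n unfolding a_def b_def
      using low[OF v[of n]] eq by (intro divide_right_mono) auto
    have "b \<longlonglongrightarrow> 0"
    proof -
      let ?q = "\<lambda>t. nsq u + 2 * t * (\<integral>x. u x * p x \<partial>lborel) + t\<^sup>2 * nsq p"
      have "DERIV (\<lambda>t. h (?q t)) 0 :> 0 * (2 * (\<integral>x. u x * p x \<partial>lborel))"
        by (rule DERIV_chain2) (use h in \<open>auto intro!: derivative_eq_intros\<close>)
      then have "((\<lambda>t. (h (?q t) - h (nsq u)) / t) \<longlongrightarrow> 0) (at 0)" by (simp add: DERIV_def)
      moreover have "filterlim ?\<tau> (at 0) sequentially"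
        by (rule filterlim_atI[OF LIMSEQ_inverse_real_of_nat]) simp
      ultimately have "(\<lambda>n. (h (?q (?\<tau> n)) - h (nsq u)) / ?\<tau> n) \<longlonglongrightarrow> 0" by (rule filterlim_compose)
      then show ?thesis unfolding b_def nsq_add_cmult[OF u p] .
    qed
    moreover have "a \<longlonglongrightarrow> D p"
    proof -
      let ?e = "\<lambda>n. (ent (\<lambda>x. u x + ?\<tau> n * p x) - ent u) / ?\<tau> n"
      have an: "a n = E_omega u p + ?\<tau> n / 2 * E_omega p p + (k/4 - l/2) * (2 * (\<integral>x. u x * p x \<partial>lborel) + ?\<tau> n * nsq p) - k/4 * ?e n" for n
      proof -
        have "J_ln \<Omega> l k (\<lambda>x. u x + t * p x) - J_ln \<Omega> l k u = t * (E_omega u p + t / 2 * E_omega p p + (k/4 - l/2) * (2 * (\<integral>x. u x * p x \<partial>lborel) + t * nsq p))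
           - k/4 * (ent (\<lambda>x. u x + t * p x) - ent u)" for t
          unfolding J_ln_eq[OF u] J_ln_eq[OF H0_add[OF u H0_cmult[OF p]]] nsq_add_cmult[OF u p] E_omega_add_cmult[OF u p]
          by (simp add: algebra_simps power2_eq_square)
        note dJ = this[of "?\<tau> n"]
        have "(t * X - k / 4 * e) / t = X - k / 4 * (e / t)" if "t > 0" for t X e :: real
          using that by (simp add: field_simps)
        from this[OF \<tau>0[of n]] show ?thesis unfolding a_def dJ .
      qed
      have "(\<lambda>n. E_omega u p + ?\<tau> n / 2 * E_omega p p + (k/4 - l/2) * (2 * (\<integral>x. u x * p x \<partial>lborel) + ?\<tau> n * nsq p) - k/4 * ?e n)
        \<longlonglongrightarrow> E_omega u p + 0 / 2 * E_omega p p + (k/4 - l/2) * (2 * (\<integral>x. u x * p x \<partial>lborel) + 0 * nsq p)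
           - k/4 * (2 * (\<integral>x. u x * p x * ln ((u x)\<^sup>2) \<partial>lborel) + 2 * (\<integral>x. u x * p x \<partial>lborel))"
        by (intro tendsto_intros tn ent_directional_derivative(2)[OF u p]) auto
      then have "a \<longlonglongrightarrow> E_omega u p + 0 / 2 * E_omega p p + (k/4 - l/2) * (2 * (\<integral>x. u x * p x \<partial>lborel) + 0 * nsq p)
           - k/4 * (2 * (\<integral>x. u x * p x * ln ((u x)\<^sup>2) \<partial>lborel) + 2 * (\<integral>x. u x * p x \<partial>lborel))"
        unfolding an[symmetric] .
      also have "E_omega u p + 0 / 2 * E_omega p p + (k/4 - l/2) * (2 * (\<integral>x. u x * p x \<partial>lborel) + 0 * nsq p)
           - k/4 * (2 * (\<integral>x. u x * p x * ln ((u x)\<^sup>2) \<partial>lborel) + 2 * (\<integral>x. u x * p x \<partial>lborel)) = D p"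
        unfolding D_def by (simp add: algebra_simps)
      finally show ?thesis .
    qed
    ultimately show "D p \<ge> 0" using LIMSEQ_le[of b 0 a "D p"] ba by blast
  qed
  have "D p = 0" if p: "p \<in> H0_ln \<Omega>" for p
  proof -
    have mp: "(\<lambda>x. - p x) \<in> H0_ln \<Omega>" using H0_cmult[OF p, of "-1"] by simp
    have "E_integrand u (\<lambda>x. - p x) = (\<lambda>z. - E_integrand u p z)" by (auto simp: E_integrand_def algebra_simps)
    then have "E_omega u (\<lambda>x. - p x) = - E_omega u p" by (simp add: E_omega_def)
    then have "D (\<lambda>x. - p x) = - D p" by (simp add: D_def)
    then show ?thesis using D0[OF p] D0[OF mp] by simp
  qed
  then have *: "E_omega u p = l * (\<integral>x. u x * p x \<partial>lborel) + k / 2 * (\<integral>x. u x * p x * ln ((u x)\<^sup>2) \<partial>lborel)" if "p \<in> H0_ln \<Omega>" for p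
    using that by (force simp: D_def)
  show ?thesis unfolding weak_solution_def
  proof (intro conjI ballI u)
    fix p assume p: "p \<in> H0_ln \<Omega>"
    note [measurable] = H0_D(2)[OF u] H0_D(2)[OF p]
    have 1: "(LINT x:\<Omega>|lborel. u x * p x) = (\<integral>x. u x * p x \<partial>lborel)"
      by (rule set_integral_dom, measurable, use H0_D(4)[OF u] in eventually_elim) simp
    have l: "ln ((u x)\<^sup>2) = 2 * ln \<bar>u x\<bar>" for x
      using ln_realpow[of "\<bar>u x\<bar>" 2] by (cases "u x = 0") auto
    have "(LINT x:\<Omega>|lborel. p x * u x * ln \<bar>u x\<bar>) = (\<integral>x. p x * u x * ln \<bar>u x\<bar> \<partial>lborel)"
      by (rule set_integral_dom, measurable, use H0_D(4)[OF u] in eventually_elim) simp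
    also have "\<dots> = (\<integral>x. (u x * p x * ln ((u x)\<^sup>2)) / 2 \<partial>lborel)" unfolding l by (simp add: mult.commute mult.left_commute)
    finally have 2: "(LINT x:\<Omega>|lborel. p x * u x * ln \<bar>u x\<bar>) = (\<integral>x. u x * p x * ln ((u x)\<^sup>2) \<partial>lborel) / 2" by simp
    show "E_omega u p = l * (LINT x:\<Omega>|lborel. u x * p x) + k * (LINT x:\<Omega>|lborel. p x * u x * ln \<bar>u x\<bar>)"
      unfolding 1 2 using *[OF p] by simp
  qed
qed

lemma weak_solution_nehari: "weak_solution \<Omega> l k u \<Longrightarrow> \<not> ae_zero u \<Longrightarrow> u \<in> nehari \<Omega> l k"
  unfolding weak_solution_def nehari_def by (auto simp: power2_eq_square)

end

section \<open>Negative \<open>k\<close>: global minimisers\<close>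

lemma eventually_ge_of_le_liminf:
  assumes "ennreal a \<le> liminf X" "e > 0"
  shows "\<forall>\<^sub>F n in sequentially. ennreal (a - e) \<le> X n"
proof (cases "a - e \<ge> 0")
  case True
  then have "ennreal (a - e) < ennreal a" using assms(2) by (simp add: ennreal_less_iff)
  then have "\<forall>\<^sub>F n in sequentially. ennreal (a - e) < X n" using assms(1) by (simp add: le_Liminf_iff)
  then show ?thesis by eventually_elim simp
qed (simp add: ennreal_neg)

lemma sqln_lower_bound:
  assumes "a > 0" shows "a * sqln s - M * s\<^sup>2 \<ge> - (a * exp (M / a))"
proof (cases "s = 0")
  case False
  define t where "t = s\<^sup>2"
  define t0 where "t0 = exp (M / a)"
  have t: "t > 0" "t0 > 0" using False by (auto simp: t_def t0_def)
  have "ln (t0 / t) \<le> t0 / t - 1" using t by (intro ln_le_minus_one) auto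
  then have "M / a - ln t \<le> t0 / t - 1" using t by (simp add: ln_div t0_def)
  then have "(a * t) * (M / a - ln t) \<le> (a * t) * (t0 / t - 1)" using t assms by (intro mult_left_mono) auto
  then have "M * t - a * (t * ln t) \<le> a * t0 - a * t" using t assms by (simp add: algebra_simps)
  moreover have "a * t \<ge> 0" using t assms by simp
  ultimately show ?thesis by (simp add: sqln_def t_def[symmetric] t0_def[symmetric])
qed (use assms in simp)

text \<open>A quantitative form of the convexity of \<open>\<rho> ln \<rho>\<close> in \<open>\<rho> = s\<^sup>2\<close>. With \<open>m\<close> the quadratic mean, the
remainder in the tangent inequality at \<open>m\<^sup>2\<close> is at least \<open>(|s| - m)\<^sup>2\<close>, by \<open>ln x \<le> x - 1\<close>. The linear
terms cancel on averaging, and the two remainders add up to at least \<open>(|a| - |b|)\<^sup>2 / 2\<close>.\<close>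

lemma sqln_quadratic_mean:
  "sqln (sqrt ((a\<^sup>2 + b\<^sup>2) / 2)) \<le> (sqln a + sqln b) / 2 - (\<bar>a\<bar> - \<bar>b\<bar>)\<^sup>2 / 4"
proof (cases "a = 0 \<and> b = 0")
  case False
  define m where "m = sqrt ((a\<^sup>2 + b\<^sup>2) / 2)"
  have pos: "a\<^sup>2 + b\<^sup>2 > 0" using False by (simp add: sum_power2_gt_zero_iff)
  have m: "m > 0" "m\<^sup>2 = (a\<^sup>2 + b\<^sup>2) / 2" using pos by (auto simp: m_def)
  have key: "sqln c \<ge> sqln m + (ln (m\<^sup>2) + 1) * (c\<^sup>2 - m\<^sup>2) + (c - m)\<^sup>2" if c: "c \<ge> 0" for c
  proof (cases "c = 0")
    case True
    then show ?thesis by (simp add: sqln_def algebra_simps)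
  next
    case F: False
    then have c0: "c > 0" using c by simp
    have "ln (m / c) \<le> m / c - 1" using c0 m by (intro ln_le_minus_one) auto
    then have "c\<^sup>2 * ln (m / c) \<le> c\<^sup>2 * (m / c - 1)" by (intro mult_left_mono) auto
    also have "\<dots> = c * m - c\<^sup>2" using c0 by (simp add: field_simps power2_eq_square)
    finally have 1: "c\<^sup>2 * (ln m - ln c) \<le> c * m - c\<^sup>2" using c0 m by (simp add: ln_div)
    have l: "ln (m\<^sup>2) = 2 * ln m" "ln (c\<^sup>2) = 2 * ln c" using c0 m by (auto simp: ln_realpow)
    show ?thesis using 1 unfolding sqln_def l by (simp add: algebra_simps power2_eq_square)
  qed
  have "sqln a + sqln b \<ge> 2 * sqln m + (ln (m\<^sup>2) + 1) * (a\<^sup>2 + b\<^sup>2 - 2 * m\<^sup>2) + ((\<bar>a\<bar> - m)\<^sup>2 + (\<bar>b\<bar> - m)\<^sup>2)"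
    using key[of "\<bar>a\<bar>"] key[of "\<bar>b\<bar>"] by (simp add: algebra_simps)
  moreover have "a\<^sup>2 + b\<^sup>2 - 2 * m\<^sup>2 = 0" using m(2) by simp
  moreover have "(\<bar>a\<bar> - \<bar>b\<bar>)\<^sup>2 / 2 \<le> (\<bar>a\<bar> - m)\<^sup>2 + (\<bar>b\<bar> - m)\<^sup>2"
  proof -
    have "(p - q)\<^sup>2 / 2 \<le> p\<^sup>2 + q\<^sup>2" for p q :: real
      using zero_le_power2[of "p + q"] by (simp add: power2_sum power2_diff)
    from this[of "\<bar>a\<bar> - m" "\<bar>b\<bar> - m"] show ?thesis by simp
  qed
  moreover have "s \<le> t / 2 - p / 4" if "2 * s + c * d + q \<le> t" "d = 0" "p / 2 \<le> q" for s t p q c d :: real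
    using that by simp
  ultimately show ?thesis unfolding m_def[symmetric] by blast
qed simp

context bounded_domain
begin

text \<open>Energy-bounded sequences are closed under \<open>L\<^sup>2\<close> convergence, and every partial energy is lower
semicontinuous. The conclusion is stated for real numbers so that several lower bounds of this kind
can be added.\<close>

lemma H0_limit:
  assumes v: "\<And>n. v n \<in> H0_ln \<Omega>" and w[measurable]: "w \<in> borel_measurable borel"
    and ae: "AE x in lborel. (\<lambda>n. v n x) \<longlonglongrightarrow> w x"
    and B: "\<And>n. E_omega (v n) (v n) \<le> B"
    and lim: "(\<lambda>n. \<integral>\<^sup>+x. ennreal ((v n x - w x)\<^sup>2) \<partial>lborel) \<longlonglongrightarrow> 0"
  shows "w \<in> H0_ln \<Omega>" "(\<lambda>n. nsq (\<lambda>x. v n x - w x)) \<longlonglongrightarrow> 0"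
    "D \<in> sets borel \<Longrightarrow> e > 0 \<Longrightarrow> \<forall>\<^sub>F n in sequentially. enn2real (energy_on D w) - e \<le> enn2real (energy_on D (v n))"
proof -
  note [measurable] = H0_D(2)[OF v]
  show wH: "w \<in> H0_ln \<Omega>"
  proof (rule H0_I)
    have "\<forall>\<^sub>F n in sequentially. (\<integral>\<^sup>+x. ennreal ((v n x - w x)\<^sup>2) \<partial>lborel) < 1"
      using lim by (rule order_tendstoD) simp
    then obtain n where n: "(\<integral>\<^sup>+x. ennreal ((v n x - w x)\<^sup>2) \<partial>lborel) < 1"
      using eventually_happens'[OF sequentially_bot] by blast
    have "(\<integral>\<^sup>+x. ennreal ((w x)\<^sup>2) \<partial>lborel) = (\<integral>\<^sup>+x. ennreal ((v n x + (w x - v n x))\<^sup>2) \<partial>lborel)" by simp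
    also have "\<dots> \<le> 2 * (\<integral>\<^sup>+x. ennreal ((v n x)\<^sup>2) \<partial>lborel) + 2 * (\<integral>\<^sup>+x. ennreal ((w x - v n x)\<^sup>2) \<partial>lborel)"
      by (rule nn_integral_square_add_le) measurable
    also have "\<dots> \<le> 2 * ennreal (nsq (v n)) + 2 * 1"
      using n by (intro add_mono mult_left_mono) (auto simp: H0_D(8)[OF v] power2_commute[of "w _"])
    also have "\<dots> < \<infinity>" by (simp add: ennreal_mult_less_top)
    finally show "(\<integral>\<^sup>+x. ennreal ((w x)\<^sup>2) \<partial>lborel) < \<infinity>" .
    have "energy_on UNIV w \<le> liminf (\<lambda>n. energy_on UNIV (v n))"
      by (rule energy_on_liminf[OF _ _ _ ae]) auto
    also have "\<dots> \<le> ennreal (2 * B)"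
      by (rule Liminf_le) (use B in \<open>auto simp: H0_D(9)[OF v] intro!: ennreal_leI always_eventually\<close>)
    also have "\<dots> < \<infinity>" by simp
    finally show "energy_on UNIV w < \<infinity>" .
    have "AE x in lborel. \<forall>n. x \<notin> \<Omega> \<longrightarrow> v n x = 0" unfolding AE_all_countable using H0_D(4)[OF v] by blast
    then show "AE x in lborel. x \<notin> \<Omega> \<longrightarrow> w x = 0"
      using ae
    proof eventually_elim
      case (elim x)
      show ?case
      proof
        assume "x \<notin> \<Omega>"
        then have "(\<lambda>n. v n x) = (\<lambda>n. 0)" using elim by auto
        then show "w x = 0" using elim(2) LIMSEQ_unique[OF _ tendsto_const] by metis
      qed
    qed
  qed simp
  have "(\<lambda>n. ennreal (nsq (\<lambda>x. v n x - w x))) \<longlonglongrightarrow> ennreal 0"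
    using lim by (simp add: H0_D(8)[OF H0_diff[OF v wH]])
  then show "(\<lambda>n. nsq (\<lambda>x. v n x - w x)) \<longlonglongrightarrow> 0"
    by (subst (asm) tendsto_ennreal_iff) auto
  assume [measurable]: "D \<in> sets borel" and e: "e > 0"
  have fin: "energy_on D u < top" if "u \<in> H0_ln \<Omega>" for u
    using H0_D(6)[OF that] energy_on_subset[of D UNIV u] by (simp add: le_less_trans)
  have "ennreal (enn2real (energy_on D w)) \<le> liminf (\<lambda>n. energy_on D (v n))"
    using energy_on_liminf[OF _ _ _ ae, of D] fin[OF wH] by simp
  from eventually_ge_of_le_liminf[OF this e]
  show "\<forall>\<^sub>F n in sequentially. enn2real (energy_on D w) - e \<le> enn2real (energy_on D (v n))"
  proof eventually_elim
    case (elim n)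
    then have "ennreal (enn2real (energy_on D w) - e) \<le> ennreal (enn2real (energy_on D (v n)))"
      using fin[OF v[of n]] by simp
    then show ?case by simp
  qed
qed

text \<open>The energy of the quadratic mean is at most the mean energy, its squared norm is the mean of the
squared norms, and the entropy gains the quadratic term of \<open>sqln_quadratic_mean\<close>, which
the positive factor \<open>- k / 4\<close> turns into a gain for the functional.\<close>

lemma J_ln_quadratic_mean:
  assumes k: "k < 0" and u: "u \<in> H0_ln \<Omega>" and v: "v \<in> H0_ln \<Omega>"
  shows "J_ln \<Omega> l k (\<lambda>x. sqrt (((u x)\<^sup>2 + (v x)\<^sup>2) / 2)) \<le> (J_ln \<Omega> l k u + J_ln \<Omega> l k v) / 2 + k / 16 * nsq (\<lambda>x. \<bar>u x\<bar> - \<bar>v x\<bar>)"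
proof -
  define w where "w x = sqrt (((u x)\<^sup>2 + (v x)\<^sup>2) / 2)" for x
  have w: "w \<in> H0_ln \<Omega>" unfolding w_def by (rule H0_quadratic_mean[OF u v])
  note [measurable] = H0_D(2)[OF u] H0_D(2)[OF v]
  have d: "(\<lambda>x. \<bar>u x\<bar> - \<bar>v x\<bar>) \<in> H0_ln \<Omega>" by (intro H0_diff H0_abs u v)
  have "energy_on UNIV w \<le> ennreal (1/2) * (energy_on UNIV u + energy_on UNIV v)"
  proof (rule energy_on_le_sum)
    fix x y
    have "\<bar>w x - w y\<bar> \<le> sqrt (((u x - u y)\<^sup>2 + (v x - v y)\<^sup>2) / 2)" unfolding w_def by (rule quadratic_mean_bound)
    then have "\<bar>w x - w y\<bar>\<^sup>2 \<le> (sqrt (((u x - u y)\<^sup>2 + (v x - v y)\<^sup>2) / 2))\<^sup>2" by (rule power_mono) simp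
    then show "(w x - w y)\<^sup>2 \<le> 1/2 * ((u x - u y)\<^sup>2 + (v x - v y)\<^sup>2)" by simp
  qed auto
  also have "\<dots> = ennreal (1/2 * (2 * E_omega u u + 2 * E_omega v v))"
    using H0_D(7)[OF u] H0_D(7)[OF v] by (simp only: H0_D(9)[OF u] H0_D(9)[OF v] ennreal_plus[symmetric] ennreal_mult'[symmetric] mult_nonneg_nonneg zero_le_numeral)
  finally have E: "E_omega w w \<le> (E_omega u u + E_omega v v) / 2"
    using H0_D(7)[OF u] H0_D(7)[OF v] by (simp add: H0_D(9)[OF w])
  have N: "nsq w = (nsq u + nsq v) / 2"
    using H0_D(3)[OF u] H0_D(3)[OF v] by (simp add: nsq_def w_def)
  have "ent w \<le> (\<integral>x. (sqln (u x) + sqln (v x)) / 2 - (\<bar>u x\<bar> - \<bar>v x\<bar>)\<^sup>2 / 4 \<partial>lborel)"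
    unfolding ent_def
  proof (rule integral_mono)
    show "integrable lborel (\<lambda>x. sqln (w x))" by (rule sqln_integrable[OF w])
    show "integrable lborel (\<lambda>x. (sqln (u x) + sqln (v x)) / 2 - (\<bar>u x\<bar> - \<bar>v x\<bar>)\<^sup>2 / 4)"
      using sqln_integrable[OF u] sqln_integrable[OF v] H0_D(3)[OF d] by simp
    show "sqln (w x) \<le> (sqln (u x) + sqln (v x)) / 2 - (\<bar>u x\<bar> - \<bar>v x\<bar>)\<^sup>2 / 4" for x
      unfolding w_def by (rule sqln_quadratic_mean)
  qed
  also have "\<dots> = (ent u + ent v) / 2 - nsq (\<lambda>x. \<bar>u x\<bar> - \<bar>v x\<bar>) / 4"
    unfolding ent_def nsq_def using sqln_integrable[OF u] sqln_integrable[OF v] H0_D(3)[OF d] by simp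
  finally have A: "(- k / 4) * ent w \<le> (- k / 4) * ((ent u + ent v) / 2 - nsq (\<lambda>x. \<bar>u x\<bar> - \<bar>v x\<bar>) / 4)"
    using k by (intro mult_left_mono) auto
  show ?thesis unfolding w_def[symmetric] J_ln_eq[OF w] J_ln_eq[OF u] J_ln_eq[OF v] N
    using E A by (simp add: algebra_simps add_divide_distrib diff_divide_distrib)
qed

text \<open>For \<open>k < 0\<close> the potential \<open>a s\<^sup>2 ln s\<^sup>2 - M s\<^sup>2\<close> is bounded below by \<open>- C\<close>. Adding \<open>C\<close> on the bounded
domain makes it nonnegative, so that the functional is bounded below and Fatou's lemma
applies.\<close>

lemma J_ln_potential_form:
  fixes k l :: real
  assumes k: "k < 0"
  defines "M \<equiv> l / 2 - k / 4" and "a \<equiv> - k / 4"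
  defines "C \<equiv> a * exp (M / a)"
  assumes u: "u \<in> H0_ln \<Omega>"
  shows "J_ln \<Omega> l k u = E_omega u u / 2 + (\<integral>x. a * sqln (u x) - M * (u x)\<^sup>2 \<partial>lborel)"
    "(\<integral>\<^sup>+x. ennreal (a * sqln (u x) - M * (u x)\<^sup>2 + C * indicator \<Omega> x) \<partial>lborel) = ennreal ((\<integral>x. a * sqln (u x) - M * (u x)\<^sup>2 \<partial>lborel) + C * dom_vol)"
    "(\<integral>x. a * sqln (u x) - M * (u x)\<^sup>2 \<partial>lborel) + C * dom_vol \<ge> 0"
proof -
  have a: "a > 0" using k by (simp add: a_def)
  have i: "integrable lborel (\<lambda>x. a * sqln (u x) - M * (u x)\<^sup>2)" using sqln_integrable[OF u] H0_D(3)[OF u] by simp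
  have "(\<integral>x. a * sqln (u x) - M * (u x)\<^sup>2 \<partial>lborel) = a * ent u - M * nsq u"
    unfolding ent_def nsq_def using sqln_integrable[OF u] H0_D(3)[OF u] by simp
  then show "J_ln \<Omega> l k u = E_omega u u / 2 + (\<integral>x. a * sqln (u x) - M * (u x)\<^sup>2 \<partial>lborel)"
    by (simp add: J_ln_eq[OF u] a_def M_def algebra_simps)
  have i2: "integrable lborel (\<lambda>x. a * sqln (u x) - M * (u x)\<^sup>2 + C * indicator \<Omega> x)" using i integrable_dom by simp
  have e: "(\<integral>x. a * sqln (u x) - M * (u x)\<^sup>2 + C * indicator \<Omega> x \<partial>lborel) = (\<integral>x. a * sqln (u x) - M * (u x)\<^sup>2 \<partial>lborel) + C * dom_vol"
    using i integrable_dom by (subst Bochner_Integration.integral_add) (auto simp: dom_vol_def)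
  have ae: "AE x in lborel. 0 \<le> a * sqln (u x) - M * (u x)\<^sup>2 + C * indicator \<Omega> x"
    using H0_D(4)[OF u]
  proof eventually_elim
    case (elim x)
    then show ?case using sqln_lower_bound[OF a, of M "u x"] by (cases "x \<in> \<Omega>") (auto simp: C_def)
  qed
  show "(\<integral>\<^sup>+x. ennreal (a * sqln (u x) - M * (u x)\<^sup>2 + C * indicator \<Omega> x) \<partial>lborel) = ennreal ((\<integral>x. a * sqln (u x) - M * (u x)\<^sup>2 \<partial>lborel) + C * dom_vol)"
    unfolding e[symmetric] by (rule nn_integral_eq_integral[OF i2 ae])
  show "(\<integral>x. a * sqln (u x) - M * (u x)\<^sup>2 \<partial>lborel) + C * dom_vol \<ge> 0"
    unfolding e[symmetric] by (rule integral_nonneg_AE[OF ae])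
qed

text \<open>By uniform convexity a minimising sequence of nonnegative functions is Cauchy in \<open>L\<^sup>2\<close>, and the
functional is lower semicontinuous along it. The limit is nonzero because \<open>t\<^sup>2 ln t\<^sup>2\<close>, with its positive
coefficient \<open>- k / 4\<close>, makes the functional negative near the origin.\<close>

theorem global_minimizer_exists:
  assumes k: "k < 0"
  shows "\<exists>w\<in>H0_ln \<Omega>. \<not> ae_zero w \<and> (\<forall>v\<in>H0_ln \<Omega>. J_ln \<Omega> l k w \<le> J_ln \<Omega> l k v)"
proof -
  let ?J = "J_ln \<Omega> l k"
  define M where "M = l / 2 - k / 4"
  define a where "a = - k / 4"
  define C where "C = a * exp (M / a)"
  note pot = J_ln_potential_form[OF k, where l=l, folded M_def a_def, folded C_def]
  define P where "P u = (\<integral>x. a * sqln (u x) - M * (u x)\<^sup>2 \<partial>lborel)" for u :: "'a \<Rightarrow> real"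
  note pot = pot[folded P_def]
  define m where "m = Inf (?J ` H0_ln \<Omega>)"
  have lb: "E_omega u u / 2 - C * dom_vol \<le> ?J u" if "u \<in> H0_ln \<Omega>" for u using pot(1,3)[OF that] by simp
  then have bdd: "bdd_below (?J ` H0_ln \<Omega>)"
    using H0_D(7) by (intro bdd_belowI[of _ "- C * dom_vol"]) fastforce
  have ml: "m \<le> ?J v" if "v \<in> H0_ln \<Omega>" for v unfolding m_def using that bdd by (intro cInf_lower) auto
  have "\<exists>u\<in>H0_ln \<Omega>. ?J u < m + inverse (real (Suc n))" for n
  proof -
    have "Inf (?J ` H0_ln \<Omega>) < m + inverse (real (Suc n))" unfolding m_def by simp
    note lt = this
    obtain y where "y \<in> ?J ` H0_ln \<Omega>" "y < m + inverse (real (Suc n))" using cInf_lessD[OF _ lt] H0_zero by blast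
    then show ?thesis by auto
  qed
  then obtain u where u: "\<And>n. u n \<in> H0_ln \<Omega>" "\<And>n. ?J (u n) < m + inverse (real (Suc n))" by metis
  define v where "v n x = \<bar>u n x\<bar>" for n x
  have v: "v n \<in> H0_ln \<Omega>" for n unfolding v_def by (rule H0_abs[OF u(1)])
  have Jv: "?J (v n) < m + inverse (real (Suc n))" for n
    using le_less_trans[OF J_ln_abs_le(1)[OF u(1)] u(2)] unfolding v_def .
  note [measurable] = H0_D(2)[OF v]
  have ij: "(- k / 16) * nsq (\<lambda>x. v i x - v j x) \<le> (inverse (real (Suc i)) + inverse (real (Suc j))) / 2" for i j
  proof -
    have "(\<lambda>x. \<bar>v i x\<bar> - \<bar>v j x\<bar>) = (\<lambda>x. v i x - v j x)" by (simp add: v_def)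
    moreover have "m \<le> (?J (v i) + ?J (v j)) / 2 + k / 16 * nsq (\<lambda>x. \<bar>v i x\<bar> - \<bar>v j x\<bar>)"
      by (rule order_trans[OF ml[OF H0_quadratic_mean[OF v v]] J_ln_quadratic_mean[OF k v v]])
    ultimately have "m \<le> (?J (v i) + ?J (v j)) / 2 + k / 16 * nsq (\<lambda>x. v i x - v j x)" by (simp only:)
    moreover have "- c \<le> (p + q) / 2" if "m \<le> (A + B) / 2 + c" "A < m + p" "B < m + q" for A B c p q :: real
      using that by (simp add: field_simps)
    moreover have "- k / 16 * nsq (\<lambda>x. v i x - v j x) = - (k / 16 * nsq (\<lambda>x. v i x - v j x))" by simp
    ultimately show ?thesis using Jv[of i] Jv[of j] by metis
  qed
  have "\<exists>r w. strict_mono r \<and> w \<in> borel_measurable lborel \<and> (AE x in lborel. (\<lambda>n. v (r n) x) \<longlonglongrightarrow> w x) \<and>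
     (\<lambda>n. \<integral>\<^sup>+x. ennreal ((v n x - w x)\<^sup>2) \<partial>lborel) \<longlonglongrightarrow> 0"
  proof (rule L2_Cauchy_limit)
    fix e :: real assume e: "e > 0"
    define q where "q = e * (- k / 16)"
    have q: "q > 0" using e k unfolding q_def by (intro mult_pos_pos) auto
    obtain N where N: "inverse (real (Suc N)) < q" using reals_Archimedean[OF q] by blast
    have "(\<integral>\<^sup>+x. ennreal ((v i x - v j x)\<^sup>2) \<partial>lborel) \<le> ennreal e" if ij': "i \<ge> N" "j \<ge> N" for i j
    proof -
      have "inverse (real (Suc i)) \<le> inverse (real (Suc N))" "inverse (real (Suc j)) \<le> inverse (real (Suc N))"
        using ij' by (auto intro!: le_imp_inverse_le)
      moreover have "(b + c) / 2 \<le> q" if "b \<le> d" "c \<le> d" "d < q" for b c d :: real using that by (simp add: field_simps)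
      ultimately have "(inverse (real (Suc i)) + inverse (real (Suc j))) / 2 \<le> q" using N by blast
      also have "q = (- k / 16) * e" unfolding q_def by (rule mult.commute)
      finally have "(- k / 16) * nsq (\<lambda>x. v i x - v j x) \<le> (- k / 16) * e" by (rule order_trans[OF ij])
      then have "nsq (\<lambda>x. v i x - v j x) \<le> e" using k by (subst (asm) mult_le_cancel_left_pos) auto
      then show ?thesis unfolding H0_D(8)[OF H0_diff[OF v v]] by (rule ennreal_leI)
    qed
    then show "\<exists>N. \<forall>i\<ge>N. \<forall>j\<ge>N. (\<integral>\<^sup>+x. ennreal ((v i x - v j x)\<^sup>2) \<partial>lborel) \<le> ennreal e" by blast
  qed simp
  then obtain r w where rw: "strict_mono r" "w \<in> borel_measurable lborel" "AE x in lborel. (\<lambda>n. v (r n) x) \<longlonglongrightarrow> w x"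
     "(\<lambda>n. \<integral>\<^sup>+x. ennreal ((v n x - w x)\<^sup>2) \<partial>lborel) \<longlonglongrightarrow> 0" by blast
  have wm[measurable]: "w \<in> borel_measurable borel" using rw(2) by simp
  define y where "y n = v (r n)" for n
  have y: "y n \<in> H0_ln \<Omega>" for n by (simp add: y_def v)
  note [measurable] = H0_D(2)[OF y]
  have Jy: "?J (y n) < m + inverse (real (Suc n))" for n
  proof -
    have "inverse (real (Suc (r n))) \<le> inverse (real (Suc n))"
      using strict_mono_imp_increasing[OF rw(1), of n] by (intro le_imp_inverse_le) auto
    then show ?thesis unfolding y_def by (intro less_le_trans[OF Jv[of "r n"]] add_left_mono)
  qed
  have yB: "E_omega (y n) (y n) \<le> 2 * (m + 1 + C * dom_vol)" for n
  proof -
    have "inverse (real (Suc n)) \<le> 1" by (simp add: inverse_le_1_iff)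
    then have "?J (y n) \<le> m + 1" using less_le_trans[OF Jy[of n] add_left_mono] by (intro less_imp_le) blast
    then show ?thesis using lb[OF y[of n]] by simp
  qed
  have aey: "AE x in lborel. (\<lambda>n. y n x) \<longlonglongrightarrow> w x" using rw(3) by (simp add: y_def)
  have limy: "(\<lambda>n. \<integral>\<^sup>+x. ennreal ((y n x - w x)\<^sup>2) \<partial>lborel) \<longlonglongrightarrow> 0"
    using LIMSEQ_subseq_LIMSEQ[OF rw(4,1)] by (simp add: y_def o_def)
  note L = H0_limit[OF y wm aey yB limy]
  note w = L(1)
  have Jw: "?J w \<le> m"
  proof (rule field_le_epsilon)
    fix e :: real assume e: "e > 0"
    have 1: "\<forall>\<^sub>F n in sequentially. enn2real (energy_on UNIV w) - e \<le> enn2real (energy_on UNIV (y n))"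
      by (rule L(3)) (use e in auto)
    have "ennreal (P w + C * dom_vol) = (\<integral>\<^sup>+x. liminf (\<lambda>n. ennreal (a * sqln (y n x) - M * (y n x)\<^sup>2 + C * indicator \<Omega> x)) \<partial>lborel)"
      unfolding pot(2)[OF w, symmetric]
    proof (rule nn_integral_cong_AE, use aey in eventually_elim)
      case (elim x)
      have "(\<lambda>n. sqln (y n x)) \<longlonglongrightarrow> sqln (w x)"
        by (rule isCont_tendsto_compose[OF DERIV_isCont[OF DERIV_sqln] elim])
      then have "(\<lambda>n. ennreal (a * sqln (y n x) - M * (y n x)\<^sup>2 + C * indicator \<Omega> x)) \<longlonglongrightarrow> ennreal (a * sqln (w x) - M * (w x)\<^sup>2 + C * indicator \<Omega> x)"
        by (intro tendsto_intros elim)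
      then show ?case by (rule lim_imp_Liminf[OF sequentially_bot, symmetric])
    qed
    also have "\<dots> \<le> liminf (\<lambda>n. \<integral>\<^sup>+x. ennreal (a * sqln (y n x) - M * (y n x)\<^sup>2 + C * indicator \<Omega> x) \<partial>lborel)"
      by (rule nn_integral_liminf) measurable
    finally have "ennreal (P w + C * dom_vol) \<le> liminf (\<lambda>n. ennreal (P (y n) + C * dom_vol))" by (simp only: pot(2)[OF y])
    from eventually_ge_of_le_liminf[OF this, of "e / 4"]
    have 2: "\<forall>\<^sub>F n in sequentially. ennreal (P w + C * dom_vol - e / 4) \<le> ennreal (P (y n) + C * dom_vol)" using e by simp
    have 3: "\<forall>\<^sub>F n in sequentially. inverse (real (Suc n)) < e / 4"
      using LIMSEQ_inverse_real_of_nat by (rule order_tendstoD) (use e in simp)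
    have "\<forall>\<^sub>F n in sequentially. ?J w \<le> m + e"
      using 1 2 3
    proof eventually_elim
      case (elim n)
      have E: "E_omega w w - e / 2 \<le> E_omega (y n) (y n)"
        using elim(1) H0_D(7)[OF w] H0_D(7)[OF y[of n]] by (simp add: H0_D(9)[OF w] H0_D(9)[OF y])
      have "P w + C * dom_vol - e / 4 \<le> P (y n) + C * dom_vol"
        using elim(2) pot(3)[OF y[of n]] by (subst (asm) ennreal_le_iff) auto
      moreover have "A / 2 + p \<le> m + e" if "A - e / 2 \<le> B" "p + c - e / 4 \<le> q + c" "B / 2 + q < m + d" "d < e / 4" for A B c d p q :: real
        using that e by (simp add: field_simps)
      ultimately show ?case using E Jy[of n] elim(3) unfolding pot(1)[OF w] pot(1)[OF y] by blast
    qed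
    then show "?J w \<le> m + e" using eventually_happens'[OF sequentially_bot] by blast
  qed
  have "m < 0"
  proof -
    obtain p where p: "p \<in> H0_ln \<Omega>" "nsq p > 0" using H0_nontrivial by blast
    \<comment> \<open>This \<open>t\<close> makes \<open>J_ln(p) - (k / 4) \<parallel>p\<parallel>\<^sup>2 ln t\<^sup>2\<close> equal to \<open>J_ln(p) - |J_ln(p)| - 1 < 0\<close>.\<close>
    define t where "t = exp (- (\<bar>?J p\<bar> + 1) / (2 * a * nsq p))"
    have a: "a > 0" using k by (simp add: a_def)
    have t: "t > 0" by (simp add: t_def)
    have l: "a * nsq p * ln (t\<^sup>2) = - (\<bar>?J p\<bar> + 1)"
    proof -
      have "ln (t\<^sup>2) = 2 * (- (\<bar>?J p\<bar> + 1) / (2 * a * nsq p))" using t by (simp add: ln_realpow) (simp add: t_def)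
      then show ?thesis using a p(2) by (simp add: field_simps)
    qed
    have "?J (\<lambda>x. t * p x) = t\<^sup>2 * (?J p + a * nsq p * ln (t\<^sup>2))"
      unfolding J_ln_eq[OF H0_cmult[OF p(1)]] J_ln_eq[OF p(1)] nsq_cmult E_omega_cmult using t
      by (simp add: ent_cmult[OF p(1)] a_def algebra_simps)
    also have "\<dots> < 0" unfolding l using t by (intro mult_pos_neg) auto
    finally show ?thesis using ml[OF H0_cmult[OF p(1), of t]] by simp
  qed
  have "\<not> ae_zero w"
  proof
    assume z: "ae_zero w"
    then have "nsq w = 0" using ae_zero_iff_nsq[OF w] by simp
    moreover have "ent w = 0" unfolding ent_def
      using z by (intro integral_eq_zero_AE) (auto simp: ae_zero_def elim: eventually_mono)
    ultimately have "?J w \<ge> 0" using H0_D(7)[OF w] by (simp add: J_ln_eq[OF w])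
    then show False using Jw \<open>m < 0\<close> by simp
  qed
  then show ?thesis using w Jw ml by (intro bexI[of _ w]) (auto intro: order_trans)
qed

lemma global_least_energy_D:
  assumes "global_least_energy_solution \<Omega> l k u"
  shows "u \<in> H0_ln \<Omega>" "v \<in> H0_ln \<Omega> \<Longrightarrow> J_ln \<Omega> l k u \<le> J_ln \<Omega> l k v"
proof -
  show "u \<in> H0_ln \<Omega>" using assms by (simp add: global_least_energy_solution_def weak_solution_def)
  assume v: "v \<in> H0_ln \<Omega>"
  have "ereal (J_ln \<Omega> l k u) \<le> ereal (J_ln \<Omega> l k v)"
    using assms INF_lower[OF v, of "\<lambda>v. ereal (J_ln \<Omega> l k v)"] by (simp add: global_least_energy_solution_def)
  then show "J_ln \<Omega> l k u \<le> J_ln \<Omega> l k v" by simp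
qed

theorem global_solution_exists:
  assumes k: "k < 0" shows "\<exists>u. global_least_energy_solution \<Omega> l k u"
proof -
  obtain w where w: "w \<in> H0_ln \<Omega>" "\<not> ae_zero w" "\<And>v. v \<in> H0_ln \<Omega> \<Longrightarrow> J_ln \<Omega> l k w \<le> J_ln \<Omega> l k v"
    using global_minimizer_exists[OF k] by blast
  have ws: "weak_solution \<Omega> l k w"
    by (rule euler_lagrange[OF w(1), where h="\<lambda>_. J_ln \<Omega> l k w"]) (auto intro: w(3))
  have "ereal (J_ln \<Omega> l k w) = (INF v\<in>H0_ln \<Omega>. ereal (J_ln \<Omega> l k v))"
    using w by (intro antisym INF_greatest INF_lower) auto
  then show ?thesis using ws weak_solution_nehari[OF ws w(2)] unfolding global_least_energy_solution_def by blast
qed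

theorem global_solution_no_sign_change:
  assumes "global_least_energy_solution \<Omega> l k u" shows "no_sign_change \<Omega> u"
  by (rule minimal_no_sign_change[OF global_least_energy_D(1)[OF assms] global_least_energy_D(2)[OF assms H0_abs[OF global_least_energy_D(1)[OF assms]]]])

text \<open>The quadratic mean of two minimisers cannot lie below the minimum, so their moduli agree; and each
of them has a sign.\<close>

theorem global_solution_unique:
  assumes k: "k < 0" and gu: "global_least_energy_solution \<Omega> l k u" and gv: "global_least_energy_solution \<Omega> l k v"
  shows "(AE x in lborel. v x = u x) \<or> (AE x in lborel. v x = - u x)"
proof -
  note u = global_least_energy_D[OF gu] and v = global_least_energy_D[OF gv]
  have eq: "J_ln \<Omega> l k u = J_ln \<Omega> l k v" using u v by (intro antisym) auto
  have d: "(\<lambda>x. \<bar>u x\<bar> - \<bar>v x\<bar>) \<in> H0_ln \<Omega>" by (intro H0_diff H0_abs u v)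
  have "k / 16 * nsq (\<lambda>x. \<bar>u x\<bar> - \<bar>v x\<bar>) \<ge> 0"
    using order_trans[OF u(2)[OF H0_quadratic_mean[OF u(1) v(1)]] J_ln_quadratic_mean[OF k u(1) v(1)]] eq by simp
  then have "nsq (\<lambda>x. \<bar>u x\<bar> - \<bar>v x\<bar>) = 0" using k nsq_nonneg[of "\<lambda>x. \<bar>u x\<bar> - \<bar>v x\<bar>"]
    by (auto simp: zero_le_mult_iff)
  then have ae: "AE x in lborel. \<bar>u x\<bar> - \<bar>v x\<bar> = 0" using ae_zero_iff_nsq[OF d] by (simp add: ae_zero_def)
  note out = H0_D(4)[OF u(1)] H0_D(4)[OF v(1)]
  from global_solution_no_sign_change[OF gu] global_solution_no_sign_change[OF gv]
  consider "AE x in lborel. x \<in> \<Omega> \<longrightarrow> u x \<ge> 0" "AE x in lborel. x \<in> \<Omega> \<longrightarrow> v x \<ge> 0"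
    | "AE x in lborel. x \<in> \<Omega> \<longrightarrow> u x \<ge> 0" "AE x in lborel. x \<in> \<Omega> \<longrightarrow> v x \<le> 0"
    | "AE x in lborel. x \<in> \<Omega> \<longrightarrow> u x \<le> 0" "AE x in lborel. x \<in> \<Omega> \<longrightarrow> v x \<ge> 0"
    | "AE x in lborel. x \<in> \<Omega> \<longrightarrow> u x \<le> 0" "AE x in lborel. x \<in> \<Omega> \<longrightarrow> v x \<le> 0"
    unfolding no_sign_change_def by blast
  then show ?thesis
  proof cases
    case 1
    have "AE x in lborel. v x = u x" using 1 ae out by eventually_elim (auto simp: abs_if split: if_splits)
    then show ?thesis ..
  next
    case 2
    have "AE x in lborel. v x = - u x" using 2 ae out by eventually_elim (auto simp: abs_if split: if_splits)
    then show ?thesis ..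
  next
    case 3
    have "AE x in lborel. v x = - u x" using 3 ae out by eventually_elim (auto simp: abs_if split: if_splits)
    then show ?thesis ..
  next
    case 4
    have "AE x in lborel. v x = u x" using 4 ae out by eventually_elim (auto simp: abs_if split: if_splits)
    then show ?thesis ..
  qed
qed

end

section \<open>Positive \<open>k\<close>: Nehari solutions and the mountain pass level\<close>

lemma sqln_trunc_le: assumes "L \<ge> 1" shows "sqln_trunc L s \<le> ln (L\<^sup>2) * s\<^sup>2"
proof (cases "s = 0")
  case False
  have "ln (min (s\<^sup>2) (L\<^sup>2)) \<le> ln (L\<^sup>2)" using False assms by (intro ln_mono) auto
  then have "s\<^sup>2 * ln (min (s\<^sup>2) (L\<^sup>2)) \<le> s\<^sup>2 * ln (L\<^sup>2)" by (intro mult_left_mono) auto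
  then show ?thesis by (simp add: sqln_trunc_def mult.commute)
qed (simp add: sqln_trunc_def)

context bounded_domain
begin

lemma energy_on_finite: "u \<in> H0_ln \<Omega> \<Longrightarrow> energy_on D u < top"
  using H0_D(6)[of u] energy_on_subset[of D UNIV u] by (simp add: le_less_trans)

lemma E_omega_split:
  assumes u: "u \<in> H0_ln \<Omega>" and D: "D \<in> sets borel"
  shows "2 * E_omega u u = enn2real (energy_on D u) + enn2real (energy_on (- D) u)"
proof -
  have "ennreal (2 * E_omega u u) = energy_on D u + energy_on (- D) u"
    unfolding H0_D(9)[OF u, symmetric] by (rule energy_on_split[OF H0_D(2)[OF u] D])
  then have "enn2real (ennreal (2 * E_omega u u)) = enn2real (energy_on D u) + enn2real (energy_on (- D) u)"
    by (simp add: enn2real_plus energy_on_finite[OF u])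
  then show ?thesis using H0_D(7)[OF u] by simp
qed

lemma tail_le_energy_real:
  assumes k: "0 < \<kappa>" "\<kappa> < 4 / real DIM('a)" and \<delta>: "\<delta> > 0"
  obtains L where "L \<ge> 1" "\<And>u. u \<in> H0_ln \<Omega> \<Longrightarrow> nsq u = 1 \<Longrightarrow> \<kappa> * (\<integral>x. sqln_tail L (u x) \<partial>lborel) \<le> enn2real (energy_on (ball 0 \<delta>) u)"
proof -
  obtain L where L: "L \<ge> 1" "\<And>u. u \<in> H0_ln \<Omega> \<Longrightarrow> nsq u \<le> 1 \<Longrightarrow> ennreal (\<kappa> * (\<integral>x. sqln_tail L (u x) \<partial>lborel)) \<le> energy_on (ball 0 \<delta>) u"
    using tail_le_energy[OF k \<delta>, of 1] by auto
  have "\<kappa> * (\<integral>x. sqln_tail L (u x) \<partial>lborel) \<le> enn2real (energy_on (ball 0 \<delta>) u)" if u: "u \<in> H0_ln \<Omega>" "nsq u = 1" for u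
  proof -
    have "ennreal (\<kappa> * (\<integral>x. sqln_tail L (u x) \<partial>lborel)) \<le> ennreal (enn2real (energy_on (ball 0 \<delta>) u))"
      using L(2)[OF u(1)] u(2) energy_on_finite[OF u(1)] by simp
    then show ?thesis by simp
  qed
  then show ?thesis using that L(1) by blast
qed

text \<open>On the unit sphere of \<open>L\<^sup>2\<close> this is \<open>2 J_ln\<close> up to an additive constant.\<close>

definition sphere_energy :: "real \<Rightarrow> ('a \<Rightarrow> real) \<Rightarrow> real" where
  "sphere_energy k u = E_omega u u - k / 2 * ent u"

text \<open>Coercivity is \<open>log_sobolev\<close> for some \<open>\<kappa>\<close> between \<open>k\<close> and \<open>4 / N\<close>. For lower semicontinuity, the same
inequality for \<open>k\<close> itself absorbs the large values of the entropy into the energy of pairs closer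
than \<open>\<delta>\<close>. What remains is the energy of distant pairs, lower semicontinuous by Fatou's lemma, and a
truncated entropy, continuous in \<open>L\<^sup>2\<close>. Finally \<open>\<delta>\<close> tends to zero.\<close>

theorem sphere_minimizer_exists:
  assumes k: "0 < k" "k < 4 / real DIM('a)"
  shows "\<exists>w\<in>H0_ln \<Omega>. nsq w = 1 \<and> (\<forall>v\<in>H0_ln \<Omega>. nsq v = 1 \<longrightarrow> sphere_energy k w \<le> sphere_energy k v)"
proof -
  define X where "X = {u \<in> H0_ln \<Omega>. nsq u = 1}"
  let ?I = "sphere_energy k"
  define \<kappa> where "\<kappa> = (k + 4 / real DIM('a)) / 2"
  have "0 < \<kappa>" unfolding \<kappa>_def using k by (intro divide_pos_pos add_pos_pos) auto
  moreover have "k < \<kappa>" "\<kappa> < 4 / real DIM('a)" using k by (auto simp: \<kappa>_def field_simps)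
  ultimately have \<kappa>: "0 < \<kappa>" "k < \<kappa>" "\<kappa> < 4 / real DIM('a)" by auto
  obtain L0 where L0: "L0 \<ge> 1" "\<And>u. u \<in> H0_ln \<Omega> \<Longrightarrow> nsq u = 1 \<Longrightarrow> \<kappa> * (\<integral>x. sqln_tail L0 (u x) \<partial>lborel) \<le> enn2real (energy_on (ball 0 1) u)"
    using tail_le_energy_real[OF \<kappa>(1,3), of 1] by auto
  define \<theta> where "\<theta> = 1 - k / \<kappa>"
  have \<theta>: "\<theta> > 0" using \<kappa> by (simp add: \<theta>_def)
  define c where "c = k / 2 * ln (L0\<^sup>2)"
  have coercive: "\<theta> * E_omega u u - c \<le> ?I u" if "u \<in> X" for u
  proof -
    have u: "u \<in> H0_ln \<Omega>" "nsq u = 1" using that by (auto simp: X_def)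
    have "(\<integral>x. sqln_trunc L0 (u x) \<partial>lborel) \<le> (\<integral>x. ln (L0\<^sup>2) * (u x)\<^sup>2 \<partial>lborel)"
      using trunc_integrable[OF L0(1) u(1)] H0_D(3)[OF u(1)] sqln_trunc_le[OF L0(1)] by (intro integral_mono) auto
    also have "\<dots> = ln (L0\<^sup>2)" using u(2) by (simp add: nsq_def)
    finally have "k / 2 * (\<integral>x. sqln_trunc L0 (u x) \<partial>lborel) \<le> c" unfolding c_def using k by (intro mult_left_mono) auto
    moreover have "k / 2 * (\<integral>x. sqln_tail L0 (u x) \<partial>lborel) \<le> k / \<kappa> * E_omega u u"
    proof -
      have "\<kappa> * (\<integral>x. sqln_tail L0 (u x) \<partial>lborel) \<le> 2 * E_omega u u"
        using L0(2)[OF u] E_omega_split[OF u(1), of "ball 0 1"] enn2real_nonneg[of "energy_on (- ball 0 1) u"]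
        by (simp del: enn2real_nonneg)
      then have "(k / (2 * \<kappa>)) * (\<kappa> * (\<integral>x. sqln_tail L0 (u x) \<partial>lborel)) \<le> (k / (2 * \<kappa>)) * (2 * E_omega u u)"
        using k \<kappa> by (intro mult_left_mono) auto
      then show ?thesis using \<kappa> by simp
    qed
    ultimately show ?thesis unfolding sphere_energy_def ent_split[OF L0(1) u(1)] \<theta>_def distrib_left left_diff_distrib mult_1_left
      by linarith
  qed
  have Xne: "X \<noteq> {}"
  proof -
    obtain p where p: "p \<in> H0_ln \<Omega>" "nsq p > 0" using H0_nontrivial by blast
    have "nsq (\<lambda>x. (1 / sqrt (nsq p)) * p x) = 1" unfolding nsq_cmult using p(2) by (simp add: power_divide)
    then have "(\<lambda>x. (1 / sqrt (nsq p)) * p x) \<in> X" using H0_cmult[OF p(1), of "1 / sqrt (nsq p)"] by (simp add: X_def)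
    then show ?thesis by blast
  qed
  define m where "m = Inf (?I ` X)"
  have "bdd_below (?I ` X)"
  proof (rule bdd_belowI2[of _ "- c"])
    fix u assume u: "u \<in> X"
    then have "0 \<le> \<theta> * E_omega u u" using \<theta> H0_D(7)[of u] by (auto simp: X_def)
    then show "- c \<le> ?I u" using coercive[OF u] by linarith
  qed
  then have ml: "m \<le> ?I v" if "v \<in> X" for v unfolding m_def using that by (intro cInf_lower) auto
  have "\<exists>u\<in>X. ?I u < m + inverse (real (Suc n))" for n
  proof -
    have lt: "Inf (?I ` X) < m + inverse (real (Suc n))" unfolding m_def by simp
    obtain y where "y \<in> ?I ` X" "y < m + inverse (real (Suc n))" using cInf_lessD[OF _ lt] Xne by blast
    then show ?thesis by auto
  qed
  then obtain u where u: "\<And>n. u n \<in> X" "\<And>n. ?I (u n) < m + inverse (real (Suc n))" by metis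
  have uH: "u n \<in> H0_ln \<Omega>" and u1: "nsq (u n) = 1" for n using u(1)[of n] by (auto simp: X_def)
  define B where "B = (m + 1 + c) / \<theta>"
  have uB: "E_omega (u n) (u n) \<le> B" for n
  proof -
    have "inverse (real (Suc n)) \<le> 1" by (simp add: inverse_le_1_iff)
    then have "?I (u n) < m + 1" by (rule less_le_trans[OF u(2) add_left_mono])
    then have "\<theta> * E_omega (u n) (u n) \<le> m + 1 + c" using coercive[OF u(1)[of n]] by simp
    then show ?thesis using \<theta> by (simp add: B_def field_simps)
  qed
  have "\<exists>r w. strict_mono r \<and> w \<in> borel_measurable borel \<and> (AE x in lborel. (\<lambda>n. u (r n) x) \<longlonglongrightarrow> w x) \<and>
     (\<lambda>n. \<integral>\<^sup>+x. ennreal ((u (r n) x - w x)\<^sup>2) \<partial>lborel) \<longlonglongrightarrow> 0"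
  proof (rule energy_bounded_compact[of u \<Omega> 1 "2 * B"])
    show "energy_on UNIV (u n) \<le> ennreal (2 * B)" for n
      unfolding H0_D(9)[OF uH] using uB[of n] by (intro ennreal_leI) simp
  qed (use H0_D[OF uH] u1 bounded_dom in auto)
  then obtain r w where rw: "strict_mono (r::nat \<Rightarrow> nat)" and wm[measurable]: "w \<in> borel_measurable borel" and ae: "AE x in lborel. (\<lambda>n. u (r n) x) \<longlonglongrightarrow> w x"
     and lim: "(\<lambda>n. \<integral>\<^sup>+x. ennreal ((u (r n) x - w x)\<^sup>2) \<partial>lborel) \<longlonglongrightarrow> 0" by blast
  define y where "y n = u (r n)" for n
  have y: "y n \<in> H0_ln \<Omega>" and y1: "nsq (y n) = 1" for n by (simp_all add: y_def uH u1)
  have Iy: "?I (y n) < m + inverse (real (Suc n))" for n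
  proof -
    have "inverse (real (Suc (r n))) \<le> inverse (real (Suc n))"
      using strict_mono_imp_increasing[OF rw(1), of n] by (intro le_imp_inverse_le) auto
    then show ?thesis unfolding y_def by (intro less_le_trans[OF u(2)[of "r n"]] add_left_mono)
  qed
  note L = H0_limit[of y, OF y wm ae[folded y_def] uB[of "r _", folded y_def] lim[folded y_def]]
  note w = L(1)
  have w1: "nsq w = 1"
    using LIMSEQ_unique[OF nsq_diff_tendsto[OF y w L(2)]] y1 by simp
  have far: "enn2real (energy_on (- ball 0 \<delta>) w) / 2 - k / 2 * ent w \<le> m" if \<delta>: "\<delta> > 0" for \<delta>
  proof (rule field_le_epsilon)
    fix e :: real assume e: "e > 0"
    obtain T where T: "T \<ge> 1" "\<And>u. u \<in> H0_ln \<Omega> \<Longrightarrow> nsq u = 1 \<Longrightarrow> k * (\<integral>x. sqln_tail T (u x) \<partial>lborel) \<le> enn2real (energy_on (ball 0 \<delta>) u)"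
      using tail_le_energy_real[OF k \<delta>] by auto
    \<comment> \<open>The three errors below add up to at most \<open>(3 / 2 + k / 2) e1\<close>.\<close>
    define e1 where "e1 = e / (2 + k)"
    have e1: "e1 > 0" "e1 * (2 + k) = e" using e k by (auto simp: e1_def)
    have 1: "\<forall>\<^sub>F n in sequentially. enn2real (energy_on (- ball 0 \<delta>) w) - e1 \<le> enn2real (energy_on (- ball 0 \<delta>) (y n))"
      by (rule L(3)) (use e1 in auto)
    have 2: "\<forall>\<^sub>F n in sequentially. (\<integral>x. sqln_trunc T (y n x) \<partial>lborel) < (\<integral>x. sqln_trunc T (w x) \<partial>lborel) + e1"
      using trunc_tendsto[OF T(1) y w L(2)] by (rule order_tendstoD) (use e1 in simp)
    have 3: "\<forall>\<^sub>F n in sequentially. inverse (real (Suc n)) < e1"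
      using LIMSEQ_inverse_real_of_nat by (rule order_tendstoD) (use e1 in simp)
    have "\<forall>\<^sub>F n in sequentially. enn2real (energy_on (- ball 0 \<delta>) w) / 2 - k / 2 * ent w \<le> m + e"
      using 1 2 3
    proof eventually_elim
      case (elim n)
      define tw where "tw = (\<integral>x. sqln_trunc T (w x) \<partial>lborel)"
      define ty where "ty = (\<integral>x. sqln_trunc T (y n x) \<partial>lborel)"
      define ta where "ta = (\<integral>x. sqln_tail T (y n x) \<partial>lborel)"
      define fw where "fw = enn2real (energy_on (- ball 0 \<delta>) w)"
      define fy where "fy = enn2real (energy_on (- ball 0 \<delta>) (y n))"
      define ny where "ny = enn2real (energy_on (ball 0 \<delta>) (y n))"
      have a1: "2 * E_omega (y n) (y n) = ny + fy" unfolding ny_def fy_def by (rule E_omega_split[OF y]) simp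
      have a2: "k * ta \<le> ny" unfolding ta_def ny_def by (rule T(2)[OF y y1])
      have "?I (y n) = (ny + fy) / 2 - k / 2 * (ty + ta)"
        unfolding sphere_energy_def ent_split[OF T(1) y] using a1 by (simp add: ty_def ta_def)
      moreover have "?I (y n) < m + e1" using less_trans[OF Iy add_strict_left_mono[OF elim(3)]] .
      ultimately have "fy / 2 - k / 2 * ty < m + e1" using a2 by (simp add: field_simps)
      moreover have "fw - e1 \<le> fy" using elim(1) by (simp add: fw_def fy_def)
      moreover have "k / 2 * ty \<le> k / 2 * (tw + e1)" using elim(2) k by (intro mult_left_mono) (auto simp: ty_def tw_def)
      moreover have "k / 2 * tw \<le> k / 2 * ent w"
      proof (rule mult_left_mono)
        have "0 \<le> (\<integral>x. sqln_tail T (w x) \<partial>lborel)" by (auto intro!: integral_nonneg_AE AE_I2 sqln_tail_nonneg)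
        then show "tw \<le> ent w" unfolding tw_def ent_split[OF T(1) w] by simp
      qed (use k in simp)
      ultimately have "fw / 2 - k / 2 * ent w \<le> m + e1 + e1 / 2 + k / 2 * e1" by (simp add: field_simps)
      also have "\<dots> \<le> m + e1 * (2 + k)" using e1(1) k by (simp add: field_simps)
      finally show ?case unfolding e1(2) fw_def .
    qed
    then show "enn2real (energy_on (- ball 0 \<delta>) w) / 2 - k / 2 * ent w \<le> m + e"
      using eventually_happens'[OF sequentially_bot] by blast
  qed
  have "(\<lambda>n. enn2real (energy_on (- ball 0 (inverse (real (Suc n)))) w)) \<longlonglongrightarrow> enn2real (energy_on UNIV w)"
  proof (rule tendsto_enn2real)
    have fin: "ennreal (enn2real (energy_on UNIV w)) = energy_on UNIV w" using energy_on_finite[OF w] by simp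
    show "(\<lambda>n. energy_on (- ball 0 (inverse (real (Suc n)))) w) \<longlonglongrightarrow> ennreal (enn2real (energy_on UNIV w))"
      unfolding fin by (rule energy_far_tendsto[OF wm])
  qed simp
  then have "(\<lambda>n. enn2real (energy_on (- ball 0 (inverse (real (Suc n)))) w) / 2 - k / 2 * ent w) \<longlonglongrightarrow> enn2real (energy_on UNIV w) / 2 - k / 2 * ent w"
    by (rule tendsto_diff[OF tendsto_divide[OF _ tendsto_const] tendsto_const]) simp
  then have "enn2real (energy_on UNIV w) / 2 - k / 2 * ent w \<le> m"
    by (rule LIMSEQ_le_const2) (use far in \<open>auto simp del: of_nat_Suc\<close>)
  then have "?I w \<le> m" using H0_D(7)[OF w] by (simp add: H0_D(9)[OF w] sphere_energy_def)
  then show ?thesis using w w1 ml by (intro bexI[of _ w]) (auto simp: X_def intro: order_trans)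
qed

lemma mountain_path_continuous:
  assumes "\<sigma> \<in> mountain_paths \<Omega> l k"
  shows "continuous_on {0..1} (\<lambda>t. nsq (\<sigma> t))" "continuous_on {0..1} (\<lambda>t. J_ln \<Omega> l k (\<sigma> t))"
proof -
  have \<sigma>: "\<And>t. t \<in> {0..1} \<Longrightarrow> \<sigma> t \<in> H0_ln \<Omega>"
    and lim: "\<And>t. t \<in> {0..1} \<Longrightarrow> ((\<lambda>s. H_norm (\<lambda>x. \<sigma> s x - \<sigma> t x)) \<longlongrightarrow> 0) (at t within {0..1})"
    using assms by (auto simp: mountain_paths_def)
  have *: "(\<lambda>n. nsq (\<sigma> (s n))) \<longlonglongrightarrow> nsq (\<sigma> t) \<and> (\<lambda>n. J_ln \<Omega> l k (\<sigma> (s n))) \<longlonglongrightarrow> J_ln \<Omega> l k (\<sigma> t)"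
    if t: "t \<in> {0..1}" and s: "\<And>n. s n \<in> {0..1}" "s \<longlonglongrightarrow> t" for s t
  proof -
    have "H_norm (\<lambda>x. \<sigma> t x - \<sigma> t x) = 0" by (simp add: H_norm_def E_omega_def E_integrand_def case_prod_beta)
    then have "continuous (at t within {0..1}) (\<lambda>r. H_norm (\<lambda>x. \<sigma> r x - \<sigma> t x))"
      using lim[OF t] by (simp add: continuous_within)
    then have "(\<lambda>n. H_norm (\<lambda>x. \<sigma> (s n) x - \<sigma> t x)) \<longlonglongrightarrow> H_norm (\<lambda>x. \<sigma> t x - \<sigma> t x)"
      using s unfolding continuous_within_sequentially by (auto simp: o_def)
    then have "(\<lambda>n. (H_norm (\<lambda>x. \<sigma> (s n) x - \<sigma> t x))\<^sup>2) \<longlonglongrightarrow> 0\<^sup>2"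
      using \<open>H_norm (\<lambda>x. \<sigma> t x - \<sigma> t x) = 0\<close> by (intro tendsto_power) simp
    moreover have "(H_norm (\<lambda>x. \<sigma> (s n) x - \<sigma> t x))\<^sup>2 = E_omega (\<lambda>x. \<sigma> (s n) x - \<sigma> t x) (\<lambda>x. \<sigma> (s n) x - \<sigma> t x)" for n
      unfolding H_norm_def using H0_D(7)[OF H0_diff[OF \<sigma>[OF s(1)[of n]] \<sigma>[OF t]]] by simp
    ultimately have "(\<lambda>n. E_omega (\<lambda>x. \<sigma> (s n) x - \<sigma> t x) (\<lambda>x. \<sigma> (s n) x - \<sigma> t x)) \<longlonglongrightarrow> 0" by simp
    note et = energy_tendsto[of "\<lambda>n. \<sigma> (s n)", OF \<sigma>[OF s(1)] \<sigma>[OF t] this]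
    have n: "(\<lambda>n. nsq (\<sigma> (s n))) \<longlonglongrightarrow> nsq (\<sigma> t)" by (rule nsq_diff_tendsto[OF \<sigma>[OF s(1)] \<sigma>[OF t] et(1)])
    show ?thesis unfolding J_ln_eq[OF \<sigma>[OF s(1)]] J_ln_eq[OF \<sigma>[OF t]]
      by (intro conjI n tendsto_intros et)
  qed
  show "continuous_on {0..1} (\<lambda>t. nsq (\<sigma> t))" "continuous_on {0..1} (\<lambda>t. J_ln \<Omega> l k (\<sigma> t))"
    unfolding continuous_on_sequentially using * by (auto simp: o_def)
qed

end

text \<open>The value of \<open>J_ln\<close> at the multiple of squared norm \<open>s\<close> of an optimal direction; \<open>S\<close> is the
squared norm at which this ray meets the Nehari manifold.\<close>

definition profile :: "real \<Rightarrow> real \<Rightarrow> real \<Rightarrow> real" where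
  "profile k S s = k / 4 * (s * (ln S - ln s + 1))"

text \<open>This is \<open>ln x \<le> x - 1\<close> for \<open>x = S / s\<close>.\<close>

lemma profile_max: "k > 0 \<Longrightarrow> S > 0 \<Longrightarrow> s \<ge> 0 \<Longrightarrow> profile k S s \<le> k / 4 * S"
proof (cases "s = 0")
  case False
  assume a: "k > 0" "S > 0" "s \<ge> 0"
  then have s: "s > 0" using False by simp
  have "ln (S / s) \<le> S / s - 1" using a s by (intro ln_le_minus_one) auto
  then have "s * (ln S - ln s + 1) \<le> s * (S / s)" using a s by (intro mult_left_mono) (auto simp: ln_div)
  then show ?thesis unfolding profile_def using a s by (intro mult_left_mono) auto
qed (simp add: profile_def)

lemma profile_le_imp_ge:
  assumes "k > 0" "S > 0" "s > 0" "profile k S s \<le> k / 4 * s" shows "S \<le> s"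
proof -
  have "s * (ln S - ln s + 1) \<le> s * 1" using assms by (simp add: profile_def)
  then have "ln S - ln s + 1 \<le> 1" using assms(3) by (subst (asm) mult_le_cancel_left_pos) auto
  then show ?thesis using assms by simp
qed

context bounded_domain
begin

text \<open>For \<open>c\<^sup>2 = 1 / \<parallel>u\<parallel>\<^sup>2\<close>, scaling adds only \<open>c\<^sup>2 ln c\<^sup>2 \<parallel>u\<parallel>\<^sup>2\<close> to the scaled entropy; so the minimality of
\<open>m\<close> on the unit sphere turns into a lower bound for \<open>J_ln(u)\<close> that depends on \<open>\<parallel>u\<parallel>\<close> only. The
number \<open>S\<close> is the solution of \<open>(k / 2) ln S = m - l\<close>.\<close>

theorem J_ln_profile:
  assumes k: "0 < k" "k < 4 / real DIM('a)"
  shows "\<exists>S w. S > 0 \<and> w \<in> H0_ln \<Omega> \<and> nsq w = 1 \<and> (\<forall>u\<in>H0_ln \<Omega>. profile k S (nsq u) \<le> J_ln \<Omega> l k u) \<and>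
     (\<forall>c. J_ln \<Omega> l k (\<lambda>x. c * w x) = profile k S (c\<^sup>2))"
proof -
  obtain w where w: "w \<in> H0_ln \<Omega>" "nsq w = 1" "\<And>v. v \<in> H0_ln \<Omega> \<Longrightarrow> nsq v = 1 \<Longrightarrow> sphere_energy k w \<le> sphere_energy k v"
    using sphere_minimizer_exists[OF k] by blast
  define m where "m = sphere_energy k w"
  define S where "S = exp (2 * (m - l) / k)"
  have S: "S > 0" "k * ln S = 2 * (m - l)" using k by (auto simp: S_def)
  have Jc: "J_ln \<Omega> l k (\<lambda>x. c * w x) = profile k S (c\<^sup>2)" for c
  proof (cases "c = 0")
    case True
    then show ?thesis unfolding J_ln_eq[OF H0_cmult[OF w(1)]] E_omega_cmult nsq_cmult profile_def by (simp add: ent_def)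
  next
    case False
    have "E_omega w w = m + k / 2 * ent w" by (simp add: m_def sphere_energy_def)
    then have "J_ln \<Omega> l k (\<lambda>x. c * w x) = c\<^sup>2 * ((m - l) / 2 + k / 4 - k / 4 * ln (c\<^sup>2))"
      unfolding J_ln_eq[OF H0_cmult[OF w(1)]] E_omega_cmult nsq_cmult ent_cmult[OF w(1) False] w(2) by (simp add: algebra_simps add_divide_distrib diff_divide_distrib)
    also have "(m - l) / 2 = k * ln S / 4" using S(2) by simp
    finally show ?thesis by (simp add: profile_def algebra_simps)
  qed
  have "profile k S (nsq u) \<le> J_ln \<Omega> l k u" if u: "u \<in> H0_ln \<Omega>" for u
  proof (cases "nsq u = 0")
    case True
    then have "ae_zero u" using ae_zero_iff_nsq[OF u] by simp
    then have "ent u = 0" unfolding ent_def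
      by (intro integral_eq_zero_AE) (auto simp: ae_zero_def elim: eventually_mono)
    then show ?thesis using True H0_D(7)[OF u] by (simp add: J_ln_eq[OF u] profile_def)
  next
    case False
    define s where "s = nsq u"
    have s: "s > 0" using False nsq_nonneg[of u] by (simp add: s_def less_le del: nsq_nonneg)
    define c where "c = 1 / sqrt s"
    have c: "c \<noteq> 0" "c\<^sup>2 = 1 / s" using s by (auto simp: c_def power_divide)
    have "nsq (\<lambda>x. c * u x) = 1" unfolding nsq_cmult c(2) using s by (simp add: s_def[symmetric])
    then have "m \<le> sphere_energy k (\<lambda>x. c * u x)" unfolding m_def by (intro w(3) H0_cmult u)
    also have "\<dots> = 1 / s * (E_omega u u - k / 2 * ent u + k / 2 * s * ln s)"
      unfolding sphere_energy_def E_omega_cmult ent_cmult[OF u c(1)] c(2) s_def[symmetric] using s by (simp add: ln_div field_simps)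
    finally have "m * s \<le> E_omega u u - k / 2 * ent u + k / 2 * s * ln s" using s by (simp add: field_simps)
    then have "(m - l) * s / 2 + k / 4 * s - k / 4 * s * ln s \<le> J_ln \<Omega> l k u"
      unfolding J_ln_eq[OF u] s_def[symmetric] by (simp add: field_simps)
    also have "(m - l) * s / 2 + k / 4 * s - k / 4 * s * ln s = (2 * (m - l)) * s / 4 + k / 4 * s - k / 4 * s * ln s" by simp
    also have "\<dots> = profile k S s" unfolding S(2)[symmetric] profile_def by (simp add: algebra_simps)
    finally show ?thesis unfolding s_def .
  qed
  then show ?thesis using S(1) w(1,2) Jc by blast
qed

text \<open>All claims are read off from the comparison with \<open>profile\<close>. On the Nehari manifold
\<open>J_ln = k \<parallel>v\<parallel>\<^sup>2 / 4\<close>, and comparison gives \<open>\<parallel>v\<parallel>\<^sup>2 \<ge> S\<close>. The same estimate at the endpoint of a mountain path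
shows that its squared norm has passed \<open>S\<close>, where \<open>J_ln \<ge> k S / 4\<close>; the ray through the minimiser,
followed up to \<open>\<parallel>\<cdot>\<parallel>\<^sup>2 = e S\<close>, never exceeds this level.\<close>

theorem nehari_solution:
  assumes k: "0 < k" "k < 4 / real DIM('a)"
  shows "\<exists>u. nehari_least_energy_solution \<Omega> l k u \<and>
                 ereal (J_ln \<Omega> l k u) = (INF v\<in>nehari \<Omega> l k. ereal (J_ln \<Omega> l k v)) \<and>
                 (\<forall>\<sigma>\<in>mountain_paths \<Omega> l k.
                    \<exists>t\<in>{0..1}. \<forall>s\<in>{0..1}. J_ln \<Omega> l k (\<sigma> s) \<le> J_ln \<Omega> l k (\<sigma> t)) \<and>
                 ereal (J_ln \<Omega> l k u) =
                   (INF \<sigma>\<in>mountain_paths \<Omega> l k. SUP t\<in>{0..1}. ereal (J_ln \<Omega> l k (\<sigma> t))) \<and>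
                 0 < J_ln \<Omega> l k u"
    and "nehari_least_energy_solution \<Omega> l k v \<Longrightarrow> no_sign_change \<Omega> v"
proof -
  let ?J = "J_ln \<Omega> l k"
  obtain S w where S: "S > 0" and w: "w \<in> H0_ln \<Omega>" "nsq w = 1" and low: "\<And>u. u \<in> H0_ln \<Omega> \<Longrightarrow> profile k S (nsq u) \<le> ?J u"
    and Jc: "\<And>c. ?J (\<lambda>x. c * w x) = profile k S (c\<^sup>2)" using J_ln_profile[OF k, of l] by blast
  have pS: "profile k S S = k / 4 * S" by (simp add: profile_def)
  have JN: "?J v = k / 4 * nsq v" if "v \<in> nehari \<Omega> l k" for v
    using that unfolding nehari_iff by (simp add: J_ln_eq field_simps)
  have NS: "S \<le> nsq v" if v: "v \<in> nehari \<Omega> l k" for v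
  proof -
    have vH: "v \<in> H0_ln \<Omega>" "nsq v > 0" using v nsq_pos by (auto simp: nehari_iff)
    then show ?thesis using profile_le_imp_ge[OF k(1) S vH(2)] low[OF vH(1)] JN[OF v] by simp
  qed
  define u where "u x = sqrt S * w x" for x
  have u: "u \<in> H0_ln \<Omega>" unfolding u_def by (rule H0_cmult[OF w(1)])
  have nu: "nsq u = S" unfolding u_def nsq_cmult w(2) using S by simp
  have Ju: "?J u = k / 4 * S" unfolding u_def Jc using S pS by simp
  have ws: "weak_solution \<Omega> l k u"
  proof (rule euler_lagrange[OF u low])
    show "?J u = profile k S (nsq u)" by (simp add: Ju nu pS)
    show "DERIV (profile k S) (nsq u) :> 0"
      unfolding nu profile_def[abs_def] using S by (auto intro!: derivative_eq_intros)
  qed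
  have "\<not> ae_zero u" using ae_zero_iff_nsq[OF u] nu S by simp
  then have uN: "u \<in> nehari \<Omega> l k" by (rule weak_solution_nehari[OF ws])
  have inf: "ereal (k / 4 * S) = (INF v\<in>nehari \<Omega> l k. ereal (?J v))"
  proof (rule antisym)
    show "ereal (k / 4 * S) \<le> (INF v\<in>nehari \<Omega> l k. ereal (?J v))"
      using NS k by (intro INF_greatest) (auto simp: JN intro!: mult_left_mono)
    show "(INF v\<in>nehari \<Omega> l k. ereal (?J v)) \<le> ereal (k / 4 * S)"
      using INF_lower[OF uN, of "\<lambda>v. ereal (?J v)"] by (simp add: Ju)
  qed
  have nls: "nehari_least_energy_solution \<Omega> l k u"
    unfolding nehari_least_energy_solution_def using ws uN inf by (simp add: Ju)
  have max: "\<exists>t\<in>{0..1}. \<forall>s\<in>{0..1}. ?J (\<sigma> s) \<le> ?J (\<sigma> t)" if "\<sigma> \<in> mountain_paths \<Omega> l k" for \<sigma>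
    using continuous_attains_sup[OF _ _ mountain_path_continuous(2)[OF that]] by auto
  have cross: "\<exists>t\<in>{0..1}. k / 4 * S \<le> ?J (\<sigma> t)" if p: "\<sigma> \<in> mountain_paths \<Omega> l k" for \<sigma>
  proof -
    have \<sigma>: "\<And>t. t \<in> {0..1} \<Longrightarrow> \<sigma> t \<in> H0_ln \<Omega>" and z: "ae_zero (\<sigma> 0)" "\<not> ae_zero (\<sigma> 1)" "?J (\<sigma> 1) \<le> 0"
      using p by (auto simp: mountain_paths_def)
    have n0: "nsq (\<sigma> 0) = 0" using z(1) ae_zero_iff_nsq[OF \<sigma>[of 0]] by simp
    have n1: "nsq (\<sigma> 1) > 0" using nsq_pos[OF \<sigma>[of 1]] z(2) by simp
    have "profile k S (nsq (\<sigma> 1)) \<le> 0" using order_trans[OF low[OF \<sigma>[of 1]] z(3)] by simp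
    also have "0 \<le> k / 4 * nsq (\<sigma> 1)" using k n1 by simp
    finally have "S \<le> nsq (\<sigma> 1)" by (rule profile_le_imp_ge[OF k(1) S n1])
    then obtain t where t: "0 \<le> t" "t \<le> 1" "nsq (\<sigma> t) = S"
      using IVT'[of "\<lambda>t. nsq (\<sigma> t)" 0 S 1] mountain_path_continuous(1)[OF p] n0 S by auto
    then show ?thesis using low[OF \<sigma>[of t]] pS by (intro bexI[of _ t]) auto
  qed
  \<comment> \<open>The profile vanishes at \<open>e S\<close>, so that the ray may end there.\<close>
  define R where "R = sqrt (exp 1 * S)"
  have R: "R > 0" "R\<^sup>2 = exp 1 * S" using S by (auto simp: R_def)
  define \<sigma>0 where "\<sigma>0 t x = (t * R) * w x" for t x
  have J0: "?J (\<sigma>0 t) = profile k S ((t * R)\<^sup>2)" for t unfolding \<sigma>0_def by (rule Jc)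
  have path: "\<sigma>0 \<in> mountain_paths \<Omega> l k"
    unfolding mountain_paths_def
  proof (intro CollectI conjI ballI)
    show s0: "\<sigma>0 t \<in> H0_ln \<Omega>" for t unfolding \<sigma>0_def by (rule H0_cmult[OF w(1)])
    fix t :: real
    show "((\<lambda>s. H_norm (\<lambda>x. \<sigma>0 s x - \<sigma>0 t x)) \<longlongrightarrow> 0) (at t within {0..1})"
    proof -
      have "H_norm (\<lambda>x. \<sigma>0 s x - \<sigma>0 t x) = \<bar>(s - t) * R\<bar> * sqrt (E_omega w w)" for s
      proof -
        have "(\<lambda>x. \<sigma>0 s x - \<sigma>0 t x) = (\<lambda>x. ((s - t) * R) * w x)" by (auto simp: \<sigma>0_def algebra_simps)
        then show ?thesis by (simp add: H_norm_def E_omega_cmult real_sqrt_mult)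
      qed
      moreover have "((\<lambda>s. \<bar>(s - t) * R\<bar> * sqrt (E_omega w w)) \<longlongrightarrow> \<bar>(t - t) * R\<bar> * sqrt (E_omega w w)) (at t within {0..1})"
        by (intro tendsto_intros)
      ultimately show ?thesis by simp
    qed
    show "ae_zero (\<sigma>0 0)" by (simp add: ae_zero_def \<sigma>0_def)
    have "nsq (\<sigma>0 1) = R\<^sup>2" unfolding \<sigma>0_def nsq_cmult w(2) by simp
    then show "\<not> ae_zero (\<sigma>0 1)" using ae_zero_iff_nsq[OF s0[of 1]] R(1) by simp
    have "ln (exp 1 * S) = 1 + ln S" using S by (simp add: ln_mult)
    then show "?J (\<sigma>0 1) \<le> 0" unfolding J0 by (simp add: R(2) profile_def)
  qed
  have mp: "ereal (k / 4 * S) = (INF \<sigma>\<in>mountain_paths \<Omega> l k. SUP t\<in>{0..1}. ereal (?J (\<sigma> t)))"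
  proof (rule antisym)
    show "ereal (k / 4 * S) \<le> (INF \<sigma>\<in>mountain_paths \<Omega> l k. SUP t\<in>{0..1}. ereal (?J (\<sigma> t)))"
    proof (rule INF_greatest)
      fix \<sigma> assume "\<sigma> \<in> mountain_paths \<Omega> l k"
      then obtain t where "t \<in> {0..1}" "k / 4 * S \<le> ?J (\<sigma> t)" using cross by blast
      then show "ereal (k / 4 * S) \<le> (SUP t\<in>{0..1}. ereal (?J (\<sigma> t)))" by (intro SUP_upper2[of t]) auto
    qed
    show "(INF \<sigma>\<in>mountain_paths \<Omega> l k. SUP t\<in>{0..1}. ereal (?J (\<sigma> t))) \<le> ereal (k / 4 * S)"
      using profile_max[OF k(1) S] by (intro INF_lower2[OF path] SUP_least) (auto simp: J0)
  qed
  have "0 < k / 4 * S" using k S by simp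
  then show "\<exists>u. nehari_least_energy_solution \<Omega> l k u \<and>
                 ereal (J_ln \<Omega> l k u) = (INF v\<in>nehari \<Omega> l k. ereal (J_ln \<Omega> l k v)) \<and>
                 (\<forall>\<sigma>\<in>mountain_paths \<Omega> l k.
                    \<exists>t\<in>{0..1}. \<forall>s\<in>{0..1}. J_ln \<Omega> l k (\<sigma> s) \<le> J_ln \<Omega> l k (\<sigma> t)) \<and>
                 ereal (J_ln \<Omega> l k u) =
                   (INF \<sigma>\<in>mountain_paths \<Omega> l k. SUP t\<in>{0..1}. ereal (J_ln \<Omega> l k (\<sigma> t))) \<and>
                 0 < J_ln \<Omega> l k u"
    using nls inf mp max by (intro exI[of _ u]) (simp only: Ju, blast)
  assume v: "nehari_least_energy_solution \<Omega> l k v"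
  then have vN: "v \<in> nehari \<Omega> l k" and "ereal (?J v) = ereal (k / 4 * S)"
    unfolding nehari_least_energy_solution_def inf by auto
  then have Jv: "?J v = k / 4 * S" by simp
  have vH: "v \<in> H0_ln \<Omega>" using vN by (simp add: nehari_iff)
  have nv: "nsq v = S" using JN[OF vN] Jv k by simp
  show "no_sign_change \<Omega> v"
  proof (rule minimal_no_sign_change[OF vH])
    show "?J v \<le> ?J (\<lambda>x. \<bar>v x\<bar>)"
      using low[OF H0_abs[OF vH]] unfolding J_ln_abs_le(2)[OF vH] nv pS Jv .
  qed
qed

end

theorem theorem1p1:
  fixes \<Omega> :: "'a::euclidean_space set"
  assumes "open \<Omega>" and "bounded \<Omega>" and "\<Omega> \<noteq> {}" and "lipschitz_boundary \<Omega>"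
  shows "(\<forall>k l. 0 < k \<and> k < 4 / real DIM('a) \<longrightarrow>
            (\<exists>u. nehari_least_energy_solution \<Omega> l k u \<and>
                 ereal (J_ln \<Omega> l k u) = (INF v\<in>nehari \<Omega> l k. ereal (J_ln \<Omega> l k v)) \<and>
                 (\<forall>\<sigma>\<in>mountain_paths \<Omega> l k.
                    \<exists>t\<in>{0..1}. \<forall>s\<in>{0..1}. J_ln \<Omega> l k (\<sigma> s) \<le> J_ln \<Omega> l k (\<sigma> t)) \<and>
                 ereal (J_ln \<Omega> l k u) =
                   (INF \<sigma>\<in>mountain_paths \<Omega> l k. SUP t\<in>{0..1}. ereal (J_ln \<Omega> l k (\<sigma> t))) \<and>
                 0 < J_ln \<Omega> l k u) \<and>
            (\<forall>u. nehari_least_energy_solution \<Omega> l k u \<longrightarrow> no_sign_change \<Omega> u))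
       \<and> (\<forall>k l. k < 0 \<longrightarrow>
            (\<exists>u. global_least_energy_solution \<Omega> l k u) \<and>
            (\<forall>u. global_least_energy_solution \<Omega> l k u \<longrightarrow> no_sign_change \<Omega> u) \<and>
            (\<forall>u v. global_least_energy_solution \<Omega> l k u \<and> global_least_energy_solution \<Omega> l k v \<longrightarrow>
                 (AE x in lborel. v x = u x) \<or> (AE x in lborel. v x = - u x)))"
proof -
  interpret bounded_domain \<Omega> using assms by unfold_locales
  show ?thesis
    using nehari_solution global_solution_exists global_solution_no_sign_change global_solution_unique
    by (intro conjI allI impI) blast+
qed

end
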